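(* Given $0<s<1$ and $v\in C_c^\infty(\mathbb{R}^n)$, for each $x\in\Omega_{-\delta}$, $$\int_{\Omega_{-\delta}}\Phi^s_\delta(x-y)\,\Delta^s_\delta v(y)\,dy-v(x)=\int_{\Gamma_{\pm\delta}}\left[\Phi^s_\delta(x-y)\,\mathcal{N}D^s_\delta v(y)-v(y)\,\mathcal{N}D^s_\delta\Phi^s_\delta(x-y)\right]dy ,$$ where in the last term $D^s_\delta$ and $\mathcal{N}$ act in the second variable, i.e. $\mathcal{N}D^s_\delta\Phi^s_\delta(x-y)$ denotes $\mathcal{N}\big(D^s_\delta[\Phi^s_\delta(x-\cdot)]\big)(y)$.
   Context: Setting: $\delta>0$, $\Omega\subset\mathbb{R}^n$ is a bounded open set, $\gamma(t)=\pi^{n/2}2^t\Gamma(t/2)/\Gamma(\frac{n-t}{2})$ and $c_{n,s}=\frac{n+s-1}{\gamma(1-s)}$. The cut-off $w_\delta:\mathbb{R}^n\to[0,\infty)$ is a fixed radial function $w_\delta(x)=\bar w_\delta(|x|)$ with $\bar w_\delta\in C_c^\infty([0,\infty))$ nonnegative, nonincreasing, $\operatorname{supp}\bar w_\delta\subset[0,\delta)$, and $\bar w_\delta\equiv a_0:=\max\bar w_\delta$ on $[0,b_0\delta]$ for some $0<b_0<1$. Domains: $\Omega_\delta=\Omega+B(0,\delta)$, $\Omega_{-\delta}=\{x\in\Omega:\operatorname{dist}(x,\partial\Omega)>\delta\}$, $\Gamma_{\pm\delta}=\Omega_\delta\setminus\Omega_{-\delta}$. Operators: $D^s_\delta u(x)=c_{n,s}\int_{B(x,\delta)}(u(x)-u(y))\frac{x-y}{|x-y|^{n+s+1}}w_\delta(x-y)\,dy$;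 $\operatorname{div}^s_\delta\varphi(x)=-c_{n,s}\,\mathrm{pv}_x\int_{B(x,\delta)}(\varphi(x)+\varphi(y))\cdot\frac{x-y}{|x-y|^{n+s+1}}w_\delta(x-y)\,dy$ ($\mathrm{pv}_x$: limit as $r\to0^+$ of the integral with $B(x,r)$ removed); $\Delta^s_\delta u=\operatorname{div}^s_\delta(D^s_\delta u)$. For a measurable vector field $\varphi:\Omega_\delta\to\mathbb{R}^n$, whenever it makes sense, $\mathcal{N}\varphi(x)=c_{n,s}\,\mathrm{pv}_x\int_\Omega\varphi(y)\cdot\frac{x-y}{|x-y|^{n+s+1}}w_\delta(x-y)\,dy$, $x\in\Gamma_{\pm\delta}$. On distributions, $D^s_\delta$ and $\Delta^s_\delta$ act by duality: $\langle D^s_\delta T,\varphi\rangle=-\langle T,\operatorname{div}^s_\delta\varphi\rangle$, $\langle\Delta^s_\delta T,\varphi\rangle=\langle T,\Delta^s_\delta\varphi\rangle$. Fundamental solution: $Q^s_\delta(x)=c_{n,s}\int_{|x|}^{\delta}\frac{\bar w_\delta(r)}{r^{n+s}}\,dr$ for $0<|x|<\delta$, $Q^s_\delta=0$ for $|x|\ge\delta$. With $\widehat f(\xi)=\int f(x)e^{-2\pi i\xi\cdot x}dx$, $\Phi^s_\delta$ denotes the radial fundamental solution of $\Delta^s_\delta$ (so $\Delta^s_\delta\Phi^s_\delta=\delta_0$ in the sense of distributions): $\Phi^s_\delta\in C^\infty(\mathbb{R}^n\setminus\{0\})$, $\widehat{\nabla\Phi^s_\delta}(\xi)=-i\frac{\xi}{|\xi|}\frac{1}{|2\pi\xi|\widehat{Q^s_\delta}(\xi)^2}$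 as tempered distributions (principal value at $0$ if $n=1$), and $\Phi^s_\delta(x)=A_n(x)-\frac{1}{a_0^2\gamma(2s)}|x|^{-(n-2s)}$ with $A_n\in C^\infty(\mathbb{R}^n)$, vanishing at infinity if $n\ge3$ (for $(n,s)=(1,\frac12)$: $\Phi^s_\delta(x)=A_1(x)+\frac1{a_0^2\pi}\log|x|$). Its distributional nonlocal gradient $D^s_\delta\Phi^s_\delta$ is a locally integrable function.
   Formalization: For very rough Ω the right-hand integral can diverge; the identity is proved when the double integral of w_δ(y-z)/|y-z|^{n+s} over y in Ω, z outside Ω is finite; for every bounded open Ω it is proved with the right side read as the limit r→0 of integrals with N truncated to |x-y|≥r. *)

theory Defs
  imports "HOL-Analysis.Analysis"
begin

text \<open>The ambient space $\mathbb{R}^n$ is a type \<open>'a::euclidean_space\<close> with \<open>n = DIM('a)\<close>.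
  All integrals are Lebesgue integrals with respect to \<open>lebesgue\<close>.\<close>

subsection \<open>Smooth functions, test functions, Schwartz functions\<close>

definition partial_deriv :: "'a::euclidean_space \<Rightarrow> ('a \<Rightarrow> 'b::real_normed_vector) \<Rightarrow> 'a \<Rightarrow> 'b"
  where "partial_deriv b f x = vector_derivative (\<lambda>t. f (x + t *\<^sub>R b)) (at 0)"

primrec iter_partial ::
  "'a::euclidean_space list \<Rightarrow> ('a \<Rightarrow> 'b::real_normed_vector) \<Rightarrow> 'a \<Rightarrow> 'b"
where
  "iter_partial [] f = f"
| "iter_partial (b # bs) f = partial_deriv b (iter_partial bs f)"

text \<open>Meant for open \<open>S\<close>: iterated partial derivatives at a point of \<open>S\<close> then
  only depend on \<open>f\<close> restricted to \<open>S\<close>, and differentiability of all of them makes them all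
  continuous.\<close>

definition smooth_on :: "'a::euclidean_space set \<Rightarrow> ('a \<Rightarrow> 'b::real_normed_vector) \<Rightarrow> bool"
  where "smooth_on S f \<longleftrightarrow> (\<forall>bs. set bs \<subseteq> Basis \<longrightarrow> iter_partial bs f differentiable_on S)"

definition test_function :: "('a::euclidean_space \<Rightarrow> 'b::real_normed_vector) \<Rightarrow> bool"
  where "test_function f \<longleftrightarrow> smooth_on UNIV f \<and> compact (closure {x. f x \<noteq> 0})"

definition schwartz :: "('a::euclidean_space \<Rightarrow> complex) \<Rightarrow> bool"
  where "schwartz f \<longleftrightarrow> smooth_on UNIV f \<and>
    (\<forall>bs k. set bs \<subseteq> Basis \<longrightarrow> bounded (range (\<lambda>x. norm x ^ k *\<^sub>R iter_partial bs f x)))"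

definition locally_integrable :: "('a::euclidean_space \<Rightarrow> 'b::{banach, second_countable_topology}) \<Rightarrow> bool"
  where "locally_integrable f \<longleftrightarrow> (\<forall>K. compact K \<longrightarrow> set_integrable lebesgue K f)"

definition fourier :: "('a::euclidean_space \<Rightarrow> complex) \<Rightarrow> 'a \<Rightarrow> complex"
  where "fourier f \<xi> =
    (LINT x|lebesgue. exp (- (2 * complex_of_real pi * \<i> * complex_of_real (\<xi> \<bullet> x))) * f x)"

subsection \<open>Domains\<close>

definition outer_set :: "real \<Rightarrow> 'a::euclidean_space set \<Rightarrow> 'a set"
  where "outer_set \<delta> \<Omega> = {x + z | x z. x \<in> \<Omega> \<and> z \<in> ball 0 \<delta>}"

definition inner_set :: "real \<Rightarrow> 'a::euclidean_space set \<Rightarrow> 'a set"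
  where "inner_set \<delta> \<Omega> = {x \<in> \<Omega>. infdist x (frontier \<Omega>) > \<delta>}"

definition collar :: "real \<Rightarrow> 'a::euclidean_space set \<Rightarrow> 'a set"
  where "collar \<delta> \<Omega> = outer_set \<delta> \<Omega> - inner_set \<delta> \<Omega>"

subsection \<open>Constants and cut-off\<close>

definition riesz_gamma :: "nat \<Rightarrow> real \<Rightarrow> real"
  where "riesz_gamma n t = pi powr (real n / 2) * 2 powr t * Gamma (t / 2) / Gamma ((real n - t) / 2)"

definition c_const :: "nat \<Rightarrow> real \<Rightarrow> real"
  where "c_const n s = (real n + s - 1) / riesz_gamma n (1 - s)"

text \<open>\<open>w\<close> is the profile of the radial cut-off $w_\delta(x) = w(|x|)$; only its values on
  $[0,\infty)$ matter. Smoothness on $[0,\infty)$ means being the restriction of a smooth function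
  on the line. The last two conditions say that \<open>a\<^sub>0\<close> is the maximum of \<open>w\<close>.\<close>

definition cutoff_profile :: "real \<Rightarrow> real \<Rightarrow> real \<Rightarrow> (real \<Rightarrow> real) \<Rightarrow> bool"
  where "cutoff_profile \<delta> b\<^sub>0 a\<^sub>0 w \<longleftrightarrow>
    (\<exists>g. smooth_on UNIV g \<and> (\<forall>t\<ge>0. w t = g t)) \<and>
    closure {t. 0 \<le> t \<and> w t \<noteq> 0} \<subseteq> {0..<\<delta>} \<and>
    (\<forall>t\<ge>0. 0 \<le> w t) \<and>
    antimono_on {0..} w \<and>
    0 < b\<^sub>0 \<and> b\<^sub>0 < 1 \<and> 0 < a\<^sub>0 \<and>
    (\<forall>t\<in>{0..b\<^sub>0 * \<delta>}. w t = a\<^sub>0) \<and> (\<forall>t\<ge>0. w t \<le> a\<^sub>0)"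

subsection \<open>Nonlocal operators\<close>

definition nl_kernel :: "real \<Rightarrow> (real \<Rightarrow> real) \<Rightarrow> 'a::euclidean_space \<Rightarrow> 'a"
  where "nl_kernel s w h = (w (norm h) / norm h powr (real DIM('a) + s + 1)) *\<^sub>R h"

definition pv_integral :: "'a::euclidean_space \<Rightarrow> 'a set \<Rightarrow> ('a \<Rightarrow> real) \<Rightarrow> real"
  where "pv_integral x A f = Lim (at_right 0) (\<lambda>r. LINT y:A - ball x r|lebesgue. f y)"

definition pv_converges :: "'a::euclidean_space \<Rightarrow> 'a set \<Rightarrow> ('a \<Rightarrow> real) \<Rightarrow> bool"
  where "pv_converges x A f \<longleftrightarrow>
    (\<forall>r>0. set_integrable lebesgue (A - ball x r) f) \<and>
    (\<exists>l. ((\<lambda>r. LINT y:A - ball x r|lebesgue. f y) \<longlongrightarrow> l) (at_right 0))"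

definition nl_grad ::
  "real \<Rightarrow> real \<Rightarrow> (real \<Rightarrow> real) \<Rightarrow> ('a::euclidean_space \<Rightarrow> real) \<Rightarrow> 'a \<Rightarrow> 'a"
  where "nl_grad s \<delta> w u x = c_const DIM('a) s *\<^sub>R
    (LINT y:ball x \<delta>|lebesgue. (u x - u y) *\<^sub>R nl_kernel s w (x - y))"

definition nl_div ::
  "real \<Rightarrow> real \<Rightarrow> (real \<Rightarrow> real) \<Rightarrow> ('a::euclidean_space \<Rightarrow> 'a) \<Rightarrow> 'a \<Rightarrow> real"
  where "nl_div s \<delta> w \<phi> x = - c_const DIM('a) s *
    pv_integral x (ball x \<delta>) (\<lambda>y. (\<phi> x + \<phi> y) \<bullet> nl_kernel s w (x - y))"

definition nl_laplace ::
  "real \<Rightarrow> real \<Rightarrow> (real \<Rightarrow> real) \<Rightarrow> ('a::euclidean_space \<Rightarrow> real) \<Rightarrow> 'a \<Rightarrow> real"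
  where "nl_laplace s \<delta> w u = nl_div s \<delta> w (nl_grad s \<delta> w u)"

definition nl_normal ::
  "real \<Rightarrow> (real \<Rightarrow> real) \<Rightarrow> 'a::euclidean_space set \<Rightarrow> ('a \<Rightarrow> 'a) \<Rightarrow> 'a \<Rightarrow> real"
  where "nl_normal s w \<Omega> \<phi> x = c_const DIM('a) s *
    pv_integral x \<Omega> (\<lambda>y. \<phi> y \<bullet> nl_kernel s w (x - y))"

text \<open>The expression whose limit as $r \to 0^+$ is \<open>nl_normal\<close>.\<close>

definition nl_normal_trunc ::
  "real \<Rightarrow> (real \<Rightarrow> real) \<Rightarrow> 'a::euclidean_space set \<Rightarrow> real \<Rightarrow> ('a \<Rightarrow> 'a) \<Rightarrow> 'a \<Rightarrow> real"
  where "nl_normal_trunc s w \<Omega> r \<phi> x = c_const DIM('a) s *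
    (LINT y:\<Omega> - ball x r|lebesgue. \<phi> y \<bullet> nl_kernel s w (x - y))"

text \<open>\<open>G\<close> is a locally integrable function representing the distributional nonlocal gradient of the
  (locally integrable) function \<open>u\<close>. Such a \<open>G\<close> is unique up to null sets, so \<open>nl_normal\<close> does
  not depend on the representative chosen by \<open>dist_nl_grad\<close>.\<close>

definition is_dist_nl_grad ::
  "real \<Rightarrow> real \<Rightarrow> (real \<Rightarrow> real) \<Rightarrow> ('a::euclidean_space \<Rightarrow> real) \<Rightarrow> ('a \<Rightarrow> 'a) \<Rightarrow> bool"
  where "is_dist_nl_grad s \<delta> w u G \<longleftrightarrow> locally_integrable G \<and>
    (\<forall>\<phi> :: 'a \<Rightarrow> 'a. test_function \<phi> \<longrightarrow>
      (LINT y|lebesgue. G y \<bullet> \<phi> y) = - (LINT y|lebesgue. u y * nl_div s \<delta> w \<phi> y))"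

definition dist_nl_grad ::
  "real \<Rightarrow> real \<Rightarrow> (real \<Rightarrow> real) \<Rightarrow> ('a::euclidean_space \<Rightarrow> real) \<Rightarrow> 'a \<Rightarrow> 'a"
  where "dist_nl_grad s \<delta> w u = (SOME G. is_dist_nl_grad s \<delta> w u G)"

subsection \<open>The fundamental solution\<close>

definition Q_kernel ::
  "real \<Rightarrow> real \<Rightarrow> (real \<Rightarrow> real) \<Rightarrow> 'a::euclidean_space \<Rightarrow> real"
  where "Q_kernel s \<delta> w x = (if 0 < norm x \<and> norm x < \<delta>
    then c_const DIM('a) s * (LINT r:{norm x..\<delta>}|lebesgue. w r / r powr (real DIM('a) + s))
    else 0)"

text \<open>The symbol of $\nabla\Phi$, in the direction \<open>b\<close>.\<close>

definition grad_symbol ::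
  "real \<Rightarrow> real \<Rightarrow> (real \<Rightarrow> real) \<Rightarrow> 'a::euclidean_space \<Rightarrow> 'a \<Rightarrow> complex"
  where "grad_symbol s \<delta> w b \<xi> =
    - \<i> * complex_of_real ((\<xi> \<bullet> b) / norm \<xi>) *
    (1 / (complex_of_real (norm ((2 * pi) *\<^sub>R \<xi>)) *
      (fourier (\<lambda>x. complex_of_real (Q_kernel s \<delta> w x)) \<xi>)\<^sup>2))"

text \<open>The conditions are, in this order: \<open>\<Phi>\<close> is radial; it is smooth away from the origin;
  it defines a tempered distribution; $\Delta^s_\delta \Phi = \delta_0$; the Fourier transform of
  the distributional gradient $\nabla\Phi$ is the stated symbol, tested as
  $\langle\widehat{\partial_b \Phi}, \psi\rangle = - \int \Phi\, \partial_b \widehat\psi$; the singular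
  part at the origin; the distributional nonlocal gradient is locally integrable. The limit in the
  Fourier condition is the principal value at the origin. It is needed for $n = 1$; for $n \ge 2$
  the symbol is integrable near the origin (of size $|\xi|^{-1}$), so the limit is the plain
  integral. The value of \<open>\<Phi>\<close> at the origin is irrelevant.\<close>

definition nl_fundamental_solution ::
  "real \<Rightarrow> real \<Rightarrow> (real \<Rightarrow> real) \<Rightarrow> real \<Rightarrow> ('a::euclidean_space \<Rightarrow> real) \<Rightarrow> bool"
  where "nl_fundamental_solution s \<delta> w a\<^sub>0 \<Phi> \<longleftrightarrow>
    (\<forall>x y. norm x = norm y \<longrightarrow> \<Phi> x = \<Phi> y) \<and>
    smooth_on (- {0}) \<Phi> \<and>
    (\<exists>N::nat. integrable lebesgue (\<lambda>x. \<Phi> x / (1 + norm x) ^ N)) \<and>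
    (\<forall>\<phi>. test_function \<phi> \<longrightarrow> (LINT y|lebesgue. \<Phi> y * nl_laplace s \<delta> w \<phi> y) = \<phi> 0) \<and>
    (\<forall>\<psi>. \<forall>b\<in>Basis. schwartz \<psi> \<longrightarrow>
      ((\<lambda>r. LINT \<xi>:- ball 0 r|lebesgue. grad_symbol s \<delta> w b \<xi> * \<psi> \<xi>) \<longlongrightarrow>
        - (LINT x|lebesgue. complex_of_real (\<Phi> x) * partial_deriv b (fourier \<psi>) x)) (at_right 0)) \<and>
    (\<exists>A. smooth_on UNIV A \<and> (DIM('a) \<ge> 3 \<longrightarrow> (A \<longlongrightarrow> 0) at_infinity) \<and>
      (\<forall>x. x \<noteq> 0 \<longrightarrow> \<Phi> x =
        (if DIM('a) = 1 \<and> s = 1/2 then A x + 1 / (a\<^sub>0\<^sup>2 * pi) * ln (norm x)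
         else A x - 1 / (a\<^sub>0\<^sup>2 * riesz_gamma DIM('a) (2 * s)) * norm x powr (- (real DIM('a) - 2 * s))))) \<and>
    (\<exists>G. is_dist_nl_grad s \<delta> w \<Phi> G)"

subsection \<open>Convergence of the boundary integral\<close>

text \<open>For a bounded open set with very rough boundary, the principal values defining \<open>nl_normal\<close>
  of a smooth field need not exist almost everywhere on the collar (if the frontier has positive
  measure) and need not be integrable there: near the frontier they behave like the nonlocal
  gradient of the indicator function of \<open>\<Omega>\<close>. The following is the usual condition that excludes
  this; bounded Lipschitz domains satisfy it for all $s \in (0,1)$.\<close>

definition finite_nl_perimeter ::
  "real \<Rightarrow> (real \<Rightarrow> real) \<Rightarrow> 'a::euclidean_space set \<Rightarrow> bool"
  where "finite_nl_perimeter s w \<Omega> \<longleftrightarrow>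
    (\<integral>\<^sup>+ y\<in>\<Omega>. (\<integral>\<^sup>+ z\<in>- \<Omega>. ennreal (norm (nl_kernel s w (y - z))) \<partial>lebesgue) \<partial>lebesgue) < \<infinity>"

end

theory Submission
  imports Defs
begin

text \<open>Let \<open>\<Psi> y = \<Phi> (x - y)\<close>, let \<open>G\<close> be its distributional nonlocal gradient, and truncate the
  kernel at distance \<open>r\<close> from the origin. The integral over the collar is the integral over
  $\Omega_\delta$ minus the one over $\Omega_{-\delta}$. By Fubini and the oddness of the kernel, the
  former equals an integral over $\Omega$ of truncated gradients that tends to
  $\int_\Omega (G \cdot Dv - G \cdot Dv) = 0$. On $\Omega_{-\delta}$ the truncated normal operators are
  truncated divergences, so the latter tends to $v(x) - \int \Psi \Delta v$ because
  $\mathrm{div}\, G = \delta_x$.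

  The limits are justified by a cut-off at \<open>x\<close>. Near \<open>x\<close>, where \<open>\<Psi>\<close> and \<open>G\<close> are merely
  integrable, Fubini moves the truncation onto a test function, and the distributional identities
  apply. Away from \<open>x\<close>, the fundamental lemma of the calculus of variations identifies \<open>G\<close> with
  the pointwise gradient of \<open>\<Psi>\<close>, which is locally Lipschitz, so the truncations converge
  uniformly. If the nonlocal perimeter is finite, it dominates the truncated normal operators on
  the collar, and dominated convergence applies.\<close>

subsection \<open>Smooth functions\<close>

text \<open>Nothing need converge pointwise at \<open>x\<close>: \<Psi> and \<open>G\<close> may be
  unbounded there, and \<open>G\<close> is known only through its pairings with test fields. For
  fixed \<open>r\<close> the kernel is bounded, so interchanging integrals and splitting domains is
  harmless; only the passage to \<open>r = 0\<close> is delicate. It is arranged as an integrable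
  factor, of no regularity, against truncations of a Lipschitz one. The rate is the Lipschitz
  constant times the integral of \<open>norm h * norm (K h)\<close> over the ball of radius
  \<open>r\<close>, finite because the product is of order \<open>norm h powr (1 - n - s)\<close>
  and \<open>s < 1\<close>. A second obstacle is the jump of the indicator of \<Omega>, which
  destroys the Lipschitz property of the fields entering the normal operator. In integrals over all
  of the outer set, Fubini moves the truncation to a function on the whole space and the jump
  disappears; pointwise on the collar it must be paid for by the kernel mass across the frontier,
  which is what the nonlocal perimeter integrates.\<close>

lemma has_vector_derivative_line:
  assumes "(f has_derivative f') (at x)"
  shows "((\<lambda>t::real. f (x + t *\<^sub>R b)) has_vector_derivative f' b) (at 0)"
proof -
  have "((\<lambda>t::real. x + t *\<^sub>R b) has_derivative (\<lambda>t. t *\<^sub>R b)) (at 0)"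
    by (auto intro!: derivative_eq_intros)
  moreover have "(f has_derivative f') (at (x + 0 *\<^sub>R b))" using assms by simp
  ultimately have "((\<lambda>t::real. f (x + t *\<^sub>R b)) has_derivative (\<lambda>t. f' (t *\<^sub>R b))) (at 0)"
    by (rule has_derivative_compose)
  then show ?thesis
    unfolding has_vector_derivative_def
    using linear_scale[OF has_derivative_linear[OF assms]] by simp
qed

lemma partial_deriv_eq:
  assumes "(f has_derivative f') (at x)"
  shows "partial_deriv b f x = f' b"
  unfolding partial_deriv_def
  by (rule vector_derivative_at[OF has_vector_derivative_line[OF assms]])

lemma has_derivative_partials:
  fixes f :: "'a::euclidean_space \<Rightarrow> 'b::real_normed_vector"
  assumes "f differentiable (at x)"
  shows "(f has_derivative (\<lambda>k. \<Sum>b\<in>Basis. (k \<bullet> b) *\<^sub>R partial_deriv b f x)) (at x)"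
proof -
  obtain f' where f': "(f has_derivative f') (at x)"
    using assms by (auto simp: differentiable_def)
  have lin: "linear f'" using f' by (rule has_derivative_linear)
  have "f' k = (\<Sum>b\<in>Basis. (k \<bullet> b) *\<^sub>R partial_deriv b f x)" for k
  proof -
    have "f' k = f' (\<Sum>b\<in>Basis. (k \<bullet> b) *\<^sub>R b)" by (simp add: euclidean_representation)
    also have "\<dots> = (\<Sum>b\<in>Basis. (k \<bullet> b) *\<^sub>R f' b)"
      by (simp add: linear_sum[OF lin] linear_scale[OF lin])
    finally show ?thesis by (simp add: partial_deriv_eq[OF f'])
  qed
  then have "f' = (\<lambda>k. \<Sum>b\<in>Basis. (k \<bullet> b) *\<^sub>R partial_deriv b f x)" by blast
  then show ?thesis using f' by simp
qed

lemma partial_deriv_cong: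
  assumes "open S" "x \<in> S" "\<And>y. y \<in> S \<Longrightarrow> f y = g y"
  shows "partial_deriv b f x = partial_deriv b g x"
proof -
  have "((\<lambda>t::real. x + t *\<^sub>R b) \<longlongrightarrow> x + 0 *\<^sub>R b) (at 0)" by (intro tendsto_intros)
  then have "((\<lambda>t::real. x + t *\<^sub>R b) \<longlongrightarrow> x) (at 0)" by simp
  then have "\<forall>\<^sub>F t in at (0::real). x + t *\<^sub>R b \<in> S"
    using assms(1,2) by (rule topological_tendstoD)
  then have ev: "\<forall>\<^sub>F t in at (0::real). f (x + t *\<^sub>R b) = g (x + t *\<^sub>R b)"
    by eventually_elim (simp add: assms(3))
  then have ev': "\<forall>\<^sub>F t in nhds (0::real). f (x + t *\<^sub>R b) = g (x + t *\<^sub>R b)"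
    using assms(2,3) by (simp add: eventually_at_filter eventually_mono[OF _ ] )
       (auto elim!: eventually_mono)
  show ?thesis unfolding partial_deriv_def
    by (rule vector_derivative_cong_eq) (use ev' in auto)
qed

text \<open>Smoothness quantifies over all lists of directions, and the iterated derivatives of a
  composite function have no manageable closed form. It is enough to exhibit a class of functions
  that are differentiable on \<open>S\<close> and closed under partial derivatives. Closure is asked
  only up to equality on \<open>S\<close>; since \<open>S\<close> is open, such an equality passes
  through the next derivative.\<close>

lemma smooth_on_coinduct:
  assumes "open S" "P f"
    and step: "\<And>f. P f \<Longrightarrow> f differentiable_on S \<and>
      (\<forall>b\<in>Basis. \<exists>g. P g \<and> (\<forall>y\<in>S. partial_deriv b f y = g y))"
  shows "smooth_on S f"
proof -
  have "\<exists>g. P g \<and> (\<forall>y\<in>S. iter_partial bs f y = g y)" if "set bs \<subseteq> Basis" for bs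
    using that
  proof (induction bs)
    case Nil
    then show ?case using assms(2) by auto
  next
    case (Cons b bs)
    then obtain g where g: "P g" "\<forall>y\<in>S. iter_partial bs f y = g y" by auto
    have "b \<in> Basis" using Cons.prems by simp
    then obtain g' where "P g'" "\<forall>y\<in>S. partial_deriv b g y = g' y"
      using step[OF g(1)] by blast
    then show ?case
      using partial_deriv_cong[OF assms(1), of _ "iter_partial bs f" g] g(2) by auto
  qed
  then show ?thesis
    unfolding smooth_on_def using step
    by (metis differentiable_on_def differentiable_transform_within less_numeral_extra(1))
qed

lemma smooth_on_imp_differentiable_on: "smooth_on S f \<Longrightarrow> f differentiable_on S"
  unfolding smooth_on_def by (metis empty_set empty_subsetI iter_partial.simps(1))

lemma smooth_on_imp_differentiable_at:
  "smooth_on S f \<Longrightarrow> open S \<Longrightarrow> x \<in> S \<Longrightarrow> f differentiable (at x)"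
  using smooth_on_imp_differentiable_on differentiable_on_eq_differentiable_at by blast

lemma iter_partial_append: "iter_partial (bs @ cs) f = iter_partial bs (iter_partial cs f)"
  by (induction bs) auto

lemma smooth_on_partial_deriv:
  assumes "smooth_on S f" "b \<in> Basis"
  shows "smooth_on S (partial_deriv b f)"
  unfolding smooth_on_def
proof (intro allI impI)
  fix bs :: "'a list"
  assume "set bs \<subseteq> Basis"
  then have "iter_partial (bs @ [b]) f differentiable_on S"
    using assms unfolding smooth_on_def by (metis Un_subset_iff empty_subsetI insert_subset list.simps(15) empty_set set_append)
  then show "iter_partial bs (partial_deriv b f) differentiable_on S"
    by (simp add: iter_partial_append)
qed

lemma smooth_on_cong:
  assumes "open S" "smooth_on S f" "\<And>y. y \<in> S \<Longrightarrow> f y = g y"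
  shows "smooth_on S g"
proof (rule smooth_on_coinduct[where P = "\<lambda>g. \<exists>f. smooth_on S f \<and> (\<forall>y\<in>S. f y = g y)"])
  fix g :: "'a \<Rightarrow> 'b"
  assume "\<exists>f. smooth_on S f \<and> (\<forall>y\<in>S. f y = g y)"
  then obtain f where f: "smooth_on S f" "\<forall>y\<in>S. f y = g y" by blast
  have "g differentiable_on S"
    using smooth_on_imp_differentiable_on[OF f(1)] f(2)
    by (metis differentiable_on_def differentiable_transform_within less_numeral_extra(1))
  moreover have "partial_deriv b f y = partial_deriv b g y" if "y \<in> S" for b y
    using partial_deriv_cong[OF assms(1) that] f(2) by blast
  ultimately show "g differentiable_on S \<and> (\<forall>b\<in>Basis. \<exists>h. (\<exists>f. smooth_on S f \<and>
      (\<forall>y\<in>S. f y = h y)) \<and> (\<forall>y\<in>S. partial_deriv b g y = h y))"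
    using smooth_on_partial_deriv[OF f(1)] by metis
qed (use assms in auto)

lemma smooth_on_subset: "smooth_on S f \<Longrightarrow> T \<subseteq> S \<Longrightarrow> smooth_on T f"
  unfolding smooth_on_def using differentiable_on_subset by blast

lemma smooth_on_Un:
  assumes "open S" "open T" "smooth_on S f" "smooth_on T f"
  shows "smooth_on (S \<union> T) f"
  using assms unfolding smooth_on_def
  by (auto simp: differentiable_on_eq_differentiable_at open_Un)

lemma smooth_on_const: "open S \<Longrightarrow> smooth_on S (\<lambda>x. c)"
  by (rule smooth_on_coinduct[where P = "\<lambda>f. \<exists>c. f = (\<lambda>_. c)"])
     (auto simp: partial_deriv_def intro!: exI[of _ "\<lambda>_. 0"])

lemma partial_deriv_add:
  assumes "f differentiable (at x)" "g differentiable (at x)"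
  shows "partial_deriv b (\<lambda>y. f y + g y) x = partial_deriv b f x + partial_deriv b g x"
proof -
  obtain f' g' where d: "(f has_derivative f') (at x)" "(g has_derivative g') (at x)"
    using assms by (auto simp: differentiable_def)
  show ?thesis
    using partial_deriv_eq[OF has_derivative_add[OF d]] partial_deriv_eq[OF d(1)]
      partial_deriv_eq[OF d(2)] by simp
qed

lemma partial_deriv_scaleR:
  fixes a :: "'a::euclidean_space \<Rightarrow> real"
  assumes "a differentiable (at x)" "f differentiable (at x)"
  shows "partial_deriv b (\<lambda>y. a y *\<^sub>R f y) x
    = a x *\<^sub>R partial_deriv b f x + partial_deriv b a x *\<^sub>R f x"
proof -
  obtain a' f' where d: "(a has_derivative a') (at x)" "(f has_derivative f') (at x)"
    using assms by (auto simp: differentiable_def)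
  show ?thesis
    using partial_deriv_eq[OF has_derivative_scaleR[OF d]] partial_deriv_eq[OF d(1)]
      partial_deriv_eq[OF d(2)] by simp
qed

lemma smooth_on_add:
  assumes "open S" "smooth_on S f" "smooth_on S g"
  shows "smooth_on S (\<lambda>x. f x + g x)"
proof (rule smooth_on_coinduct[where
    P = "\<lambda>h. \<exists>f g. smooth_on S f \<and> smooth_on S g \<and> h = (\<lambda>x. f x + g x)"])
  fix h :: "'a \<Rightarrow> 'b"
  assume "\<exists>f g. smooth_on S f \<and> smooth_on S g \<and> h = (\<lambda>x. f x + g x)"
  then obtain f g where fg: "smooth_on S f" "smooth_on S g" and h: "h = (\<lambda>x. f x + g x)"
    by blast
  have "\<forall>y\<in>S. partial_deriv b h y = partial_deriv b f y + partial_deriv b g y" for b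
    unfolding h using partial_deriv_add smooth_on_imp_differentiable_at fg assms(1) by blast
  moreover have "h differentiable_on S"
    unfolding h using fg smooth_on_imp_differentiable_on by (intro differentiable_on_add) auto
  ultimately show "h differentiable_on S \<and> (\<forall>b\<in>Basis. \<exists>k. (\<exists>f g. smooth_on S f \<and>
      smooth_on S g \<and> k = (\<lambda>x. f x + g x)) \<and> (\<forall>y\<in>S. partial_deriv b h y = k y))"
    using smooth_on_partial_deriv fg by blast
qed (use assms in auto)

text \<open>The product rule leads out of the class of single products, so the invariant class for
  the coinduction consists of finite sums of products.\<close>

inductive product_span :: "'a::euclidean_space set \<Rightarrow> ('a \<Rightarrow> 'b::real_normed_vector) \<Rightarrow> bool"
  for S where
  prod: "smooth_on S a \<Longrightarrow> smooth_on S f \<Longrightarrow> product_span S (\<lambda>x. a x *\<^sub>R f x)"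
| add: "product_span S f \<Longrightarrow> product_span S g \<Longrightarrow> product_span S (\<lambda>x. f x + g x)"

lemma smooth_on_scaleR:
  fixes f :: "'a::euclidean_space \<Rightarrow> 'b::real_normed_vector"
  assumes "open S" "smooth_on S a" "smooth_on S f"
  shows "smooth_on S (\<lambda>x. a x *\<^sub>R f x)"
proof (rule smooth_on_coinduct[where P = "product_span S"])
  fix h :: "'a \<Rightarrow> 'b"
  assume "product_span S h"
  then show "h differentiable_on S \<and>
      (\<forall>b\<in>Basis. \<exists>g. product_span S g \<and> (\<forall>y\<in>S. partial_deriv b h y = g y))"
  proof (induction)
    case (prod a f)
    have "\<forall>y\<in>S. partial_deriv b (\<lambda>x. a x *\<^sub>R f x) y
        = a y *\<^sub>R partial_deriv b f y + partial_deriv b a y *\<^sub>R f y" for b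
      using prod assms(1) by (intro ballI partial_deriv_scaleR smooth_on_imp_differentiable_at)
    moreover have "product_span S (\<lambda>y. a y *\<^sub>R partial_deriv b f y + partial_deriv b a y *\<^sub>R f y)"
      if "b \<in> Basis" for b
      using prod that by (intro product_span.intros smooth_on_partial_deriv)
    ultimately show ?case
      using prod
      by (intro conjI differentiable_on_scaleR ballI exI) (auto intro: smooth_on_imp_differentiable_on)
  next
    case (add f g)
    have "\<forall>y\<in>S. partial_deriv b (\<lambda>x. f x + g x) y = partial_deriv b f y + partial_deriv b g y" for b
      using partial_deriv_add add.IH assms(1) differentiable_on_eq_differentiable_at by blast
    moreover have "\<exists>h. product_span S h \<and> (\<forall>y\<in>S. partial_deriv b f y + partial_deriv b g y = h y)"
      if b: "b \<in> Basis" for b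
    proof -
      obtain f' where "product_span S f'" "\<forall>y\<in>S. partial_deriv b f y = f' y"
        using bspec[OF conjunct2[OF add.IH(1)] b] by blast
      moreover obtain g' where "product_span S g'" "\<forall>y\<in>S. partial_deriv b g y = g' y"
        using bspec[OF conjunct2[OF add.IH(2)] b] by blast
      ultimately show ?thesis by (intro exI[of _ "\<lambda>x. f' x + g' x"]) (simp add: product_span.add)
    qed
    ultimately show ?case
      using differentiable_on_add[OF conjunct1[OF add.IH(1)] conjunct1[OF add.IH(2)]] by simp
  qed
qed (use assms in \<open>auto intro: product_span.prod\<close>)

lemma smooth_on_mult:
  fixes f g :: "'a::euclidean_space \<Rightarrow> real"
  shows "open S \<Longrightarrow> smooth_on S f \<Longrightarrow> smooth_on S g \<Longrightarrow> smooth_on S (\<lambda>x. f x * g x)"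
  using smooth_on_scaleR[of S f g] by simp

lemma smooth_on_prod:
  fixes f :: "'i \<Rightarrow> 'a::euclidean_space \<Rightarrow> real"
  assumes "open S" "\<And>i. i \<in> I \<Longrightarrow> smooth_on S (f i)"
  shows "smooth_on S (\<lambda>x. \<Prod>i\<in>I. f i x)"
  using assms(2)
  by (induction I rule: infinite_finite_induct) (auto intro!: smooth_on_mult smooth_on_const assms(1))

text \<open>The hypothesis on \<open>L\<close> covers dilations, reflections and coordinate projections; it keeps
  the partial derivatives of a composition single terms.\<close>

lemma smooth_on_compose_affine:
  fixes L :: "'a::euclidean_space \<Rightarrow> 'b::euclidean_space" and f :: "'b \<Rightarrow> 'c::real_normed_vector"
  assumes "open S" "open T" "linear L" "(\<lambda>y. p + L y) ` S \<subseteq> T" "smooth_on T f"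
    and basis: "\<And>b. b \<in> Basis \<Longrightarrow> \<exists>k. \<exists>b'\<in>Basis. L b = k *\<^sub>R b'"
  shows "smooth_on S (\<lambda>y. f (p + L y))"
proof (rule smooth_on_coinduct[where
    P = "\<lambda>h. \<exists>\<alpha> f. smooth_on T f \<and> h = (\<lambda>y. \<alpha> *\<^sub>R f (p + L y))"])
  fix h :: "'a \<Rightarrow> 'c"
  assume "\<exists>\<alpha> f. smooth_on T f \<and> h = (\<lambda>y. \<alpha> *\<^sub>R f (p + L y))"
  then obtain \<alpha> f where f: "smooth_on T f" and h: "h = (\<lambda>y. \<alpha> *\<^sub>R f (p + L y))" by blast
  have dh: "(h has_derivative (\<lambda>v. \<alpha> *\<^sub>R (\<Sum>b\<in>Basis. (L v \<bullet> b) *\<^sub>R partial_deriv b f (p + L y)))) (at y)"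
    if "y \<in> S" for y
  proof -
    have "f differentiable (at (p + L y))"
      using smooth_on_imp_differentiable_at[OF f assms(2)] assms(4) that by blast
    then have "(f has_derivative (\<lambda>k. \<Sum>b\<in>Basis. (k \<bullet> b) *\<^sub>R partial_deriv b f (p + L y))) (at (p + L y))"
      by (rule has_derivative_partials)
    moreover have "((\<lambda>y. p + L y) has_derivative L) (at y)"
      using linear_imp_has_derivative[OF assms(3)] by (auto intro!: derivative_eq_intros)
    ultimately have "((\<lambda>y. f (p + L y)) has_derivative
        (\<lambda>v. \<Sum>b\<in>Basis. (L v \<bullet> b) *\<^sub>R partial_deriv b f (p + L y))) (at y)"
      using has_derivative_compose by blast
    then show ?thesis unfolding h by (rule has_derivative_scaleR_right)
  qed
  have "\<exists>g. (\<exists>\<alpha> f. smooth_on T f \<and> g = (\<lambda>y. \<alpha> *\<^sub>R f (p + L y))) \<and>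
      (\<forall>y\<in>S. partial_deriv b h y = g y)" if b: "b \<in> Basis" for b
  proof -
    obtain k b' where b': "b' \<in> Basis" "L b = k *\<^sub>R b'" using basis[OF b] by blast
    have "partial_deriv b h y = (\<alpha> * k) *\<^sub>R partial_deriv b' f (p + L y)" if "y \<in> S" for y
    proof -
      have "(\<Sum>c\<in>Basis. (L b \<bullet> c) *\<^sub>R partial_deriv c f (p + L y))
          = (\<Sum>c\<in>Basis. (if c = b' then k *\<^sub>R partial_deriv c f (p + L y) else 0))"
        by (rule sum.cong) (auto simp: b' inner_Basis)
      also have "\<dots> = k *\<^sub>R partial_deriv b' f (p + L y)" using b'(1) by simp
      finally show ?thesis using partial_deriv_eq[OF dh[OF that]] by simp
    qed
    then show ?thesis using smooth_on_partial_deriv[OF f b'(1)] by blast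
  qed
  moreover have "h differentiable_on S"
    unfolding differentiable_on_eq_differentiable_at[OF assms(1)] using dh differentiableI by blast
  ultimately show "h differentiable_on S \<and> (\<forall>b\<in>Basis. \<exists>g. (\<exists>\<alpha> f. smooth_on T f \<and>
      g = (\<lambda>y. \<alpha> *\<^sub>R f (p + L y))) \<and> (\<forall>y\<in>S. partial_deriv b h y = g y))" by blast
next
  show "\<exists>\<alpha> g. smooth_on T g \<and> (\<lambda>y. f (p + L y)) = (\<lambda>y. \<alpha> *\<^sub>R g (p + L y))"
    using assms(5) by (intro exI[of _ 1] exI[of _ f]) simp
qed (rule assms(1))

lemma smooth_on_reflect:
  fixes f :: "'a::euclidean_space \<Rightarrow> 'b::real_normed_vector"
  assumes "open S" "open T" "smooth_on T f" "\<And>y. y \<in> S \<Longrightarrow> x - y \<in> T"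
  shows "smooth_on S (\<lambda>y. f (x - y))"
proof -
  have "linear (uminus :: 'a \<Rightarrow> 'a)" by (rule linear_uminus)
  moreover have "\<exists>k. \<exists>b'\<in>Basis. - b = k *\<^sub>R b'" if "b \<in> Basis" for b :: 'a
    using that by (intro exI[of _ "-1"] bexI[of _ b]) auto
  ultimately show ?thesis
    using smooth_on_compose_affine[OF assms(1,2), of uminus x f] assms(3,4) by (auto simp: image_subset_iff)
qed

lemma smooth_on_compose_coordinate:
  fixes f :: "real \<Rightarrow> 'c::real_normed_vector"
  assumes "smooth_on UNIV f"
  shows "smooth_on UNIV (\<lambda>y::'a::euclidean_space. f (p + k * (y \<bullet> b)))"
proof -
  have "linear (\<lambda>y::'a. k * (y \<bullet> b))" by (auto simp: linear_iff algebra_simps)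
  then show ?thesis
    using smooth_on_compose_affine[of UNIV UNIV "\<lambda>y::'a. k * (y \<bullet> b)" p f] assms by simp
qed

lemma smooth_on_linear:
  fixes f :: "'a::euclidean_space \<Rightarrow> 'b::real_normed_vector"
  assumes "open S" "smooth_on S f" "bounded_linear L"
  shows "smooth_on S (\<lambda>x. L (f x))"
proof (rule smooth_on_coinduct[where P = "\<lambda>h. \<exists>f. smooth_on S f \<and> h = (\<lambda>x. L (f x))"])
  fix h
  assume "\<exists>f. smooth_on S f \<and> h = (\<lambda>x. L (f x))"
  then obtain f where f: "smooth_on S f" and h: "h = (\<lambda>x. L (f x))" by blast
  have d: "(h has_derivative (\<lambda>k. L (\<Sum>b\<in>Basis. (k \<bullet> b) *\<^sub>R partial_deriv b f y))) (at y)"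
    if "y \<in> S" for y
    unfolding h using has_derivative_partials[OF smooth_on_imp_differentiable_at[OF f assms(1) that]]
    by (rule bounded_linear.has_derivative[OF assms(3)])
  have "partial_deriv b h y = L (partial_deriv b f y)" if "y \<in> S" "b \<in> Basis" for b y
    using partial_deriv_eq[OF d[OF that(1)], of b] that(2) 
      by (simp add: inner_Basis if_distrib[of "\<lambda>t. t *\<^sub>R _"] cong: if_cong)
  note pd = this
  show "h differentiable_on S \<and> (\<forall>b\<in>Basis. \<exists>g. (\<exists>f. smooth_on S f \<and> g = (\<lambda>x. L (f x))) \<and>
      (\<forall>y\<in>S. partial_deriv b h y = g y))"
    unfolding differentiable_on_eq_differentiable_at[OF assms(1)]
  proof (intro conjI ballI exI)
    show "h differentiable at y" if "y \<in> S" for y using d[OF that] differentiableI by blast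
  next
    fix b :: 'a assume b: "b \<in> Basis"
    show "smooth_on S (partial_deriv b f)" using f b by (rule smooth_on_partial_deriv)
    show "(\<lambda>x. L (partial_deriv b f x)) = (\<lambda>x. L (partial_deriv b f x))" ..
  qed (simp_all add: pd)
qed (use assms in auto)

lemma test_function_iff: "test_function f \<longleftrightarrow> smooth_on UNIV f \<and> bounded {x. f x \<noteq> 0}"
  unfolding test_function_def by (simp add: compact_closure)

lemma test_function_support:
  assumes "test_function f"
  obtains R where "0 < R" "\<And>x. R \<le> norm x \<Longrightarrow> f x = 0"
proof -
  obtain R where "\<And>x. f x \<noteq> 0 \<Longrightarrow> norm x \<le> R"
    using assms unfolding test_function_iff bounded_iff by blast
  \<comment> \<open>One is added because the bound on the support is not strict; the maximum makes
    the radius positive.\<close>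
  then show ?thesis
    by (intro that[of "max 1 (R + 1)"]) (auto, smt (verit))
qed

lemma bounded_supportI:
  fixes f :: "'a::real_normed_vector \<Rightarrow> 'b::zero"
  shows "(\<And>x. R \<le> norm x \<Longrightarrow> f x = 0) \<Longrightarrow> bounded {x. f x \<noteq> 0}"
  by (rule boundedI[of _ R]) (metis (mono_tags, lifting) linorder_not_le mem_Collect_eq nle_le)

lemma test_function_partial_deriv:
  assumes "test_function f" "b \<in> Basis"
  shows "test_function (partial_deriv b f)"
proof -
  obtain R where R: "\<And>x. R \<le> norm x \<Longrightarrow> f x = 0" using test_function_support[OF assms(1)] by blast
  have "partial_deriv b f x = 0" if "R + 1 \<le> norm x" for x
  proof -
    have "partial_deriv b f x = partial_deriv b (\<lambda>_. 0) x"
    proof (rule partial_deriv_cong)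
      show "open {x. R < norm x}" by (intro open_Collect_less continuous_intros)
    qed (use that R in auto)
    then show ?thesis by (simp add: partial_deriv_def)
  qed
  then show ?thesis
    using assms smooth_on_partial_deriv unfolding test_function_iff
    by (blast intro: bounded_supportI)
qed

lemma test_function_scaleR:
  assumes "smooth_on UNIV a" "test_function f"
  shows "test_function (\<lambda>x. a x *\<^sub>R f x)"
  using assms smooth_on_scaleR[of UNIV a f] unfolding test_function_iff
  by (auto elim: bounded_subset)

lemma test_function_scaleR_left:
  assumes "test_function a" "smooth_on UNIV f"
  shows "test_function (\<lambda>x. a x *\<^sub>R f x)"
  using assms smooth_on_scaleR[of UNIV a f] unfolding test_function_iff
  by (auto elim: bounded_subset)

lemma test_function_mult:
  fixes a f :: "'a::euclidean_space \<Rightarrow> real"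
  shows "smooth_on UNIV a \<Longrightarrow> test_function f \<Longrightarrow> test_function (\<lambda>x. a x * f x)"
  using test_function_scaleR[of a f] by simp

lemma test_function_linear:
  fixes f :: "'a::euclidean_space \<Rightarrow> 'b::real_normed_vector"
  assumes "test_function f" "bounded_linear L"
  shows "test_function (\<lambda>x. L (f x))"
proof -
  have "{x. L (f x) \<noteq> 0} \<subseteq> {x. f x \<noteq> 0}"
    using linear_0[OF bounded_linear.linear[OF assms(2)]] by auto
  then show ?thesis
    using assms smooth_on_linear[of UNIV f L] unfolding test_function_iff
    by (auto elim: bounded_subset)
qed

lemma test_function_reflect:
  fixes f :: "'a::euclidean_space \<Rightarrow> 'b::real_normed_vector"
  assumes "test_function f"
  shows "test_function (\<lambda>y. f (x - y))"
proof -
  obtain R where R: "\<And>y. R \<le> norm y \<Longrightarrow> f y = 0"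
    using test_function_support[OF assms] by blast
  have "f (x - y) = 0" if "R + norm x \<le> norm y" for y
    using that norm_triangle_ineq2[of y x] by (intro R) (simp add: norm_minus_commute)
  then have "bounded {y. f (x - y) \<noteq> 0}" by (rule bounded_supportI)
  then show ?thesis
    using assms smooth_on_reflect[of UNIV UNIV f x] by (simp add: test_function_iff)
qed

lemma smooth_on_continuous_on: "smooth_on S f \<Longrightarrow> continuous_on S f"
  using smooth_on_imp_differentiable_on differentiable_imp_continuous_on by blast

lemma test_function_continuous: "test_function f \<Longrightarrow> continuous_on UNIV f"
  unfolding test_function_iff using smooth_on_continuous_on by blast

lemma test_function_bounded:
  fixes f :: "'a::euclidean_space \<Rightarrow> 'b::real_normed_vector"
  assumes "test_function f"
  obtains M where "0 < M" "\<And>x. norm (f x) \<le> M"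
proof -
  obtain R where R: "0 < R" "\<And>x. R \<le> norm x \<Longrightarrow> f x = 0" using test_function_support[OF assms] by blast
  have "compact (f ` cball 0 R)"
    using test_function_continuous[OF assms] continuous_on_subset
    by (intro compact_continuous_image) auto
  then have "bounded (f ` cball 0 R)" by (rule compact_imp_bounded)
  then obtain M where M: "\<And>x. x \<in> cball 0 R \<Longrightarrow> norm (f x) \<le> M"
    unfolding bounded_iff by (metis imageI)
  then have "norm (f x) \<le> max 1 M" for x
  proof (cases "norm x \<le> R")
    case True
    then show ?thesis using M[of x] by (simp add: le_max_iff_disj)
  next
    case False
    then show ?thesis using R(2)[of x] by (simp add: le_max_iff_disj)
  qed
  then show ?thesis using that[of "max 1 M"] by auto
qed

text \<open>The partial derivatives are again test functions, hence bounded, and the sum of their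
  bounds controls the operator norm of the derivative; the mean value inequality on the whole space
  does the rest.\<close>

lemma test_function_Lipschitz:
  fixes f :: "'a::euclidean_space \<Rightarrow> 'b::real_normed_vector"
  assumes "test_function f"
  obtains L where "0 < L" "\<And>x y. norm (f x - f y) \<le> L * norm (x - y)"
proof -
  have "\<exists>M>0. \<forall>x. norm (partial_deriv b f x) \<le> M" if "b \<in> Basis" for b
    using test_function_bounded[OF test_function_partial_deriv[OF assms that]] by blast
  then obtain M where M: "\<And>b. b \<in> Basis \<Longrightarrow> 0 < M b" 
      "\<And>b x. b \<in> Basis \<Longrightarrow> norm (partial_deriv b f x) \<le> M b" by metis
  let ?L = "\<Sum>b\<in>Basis. M b"
  have "norm (f x - f y) \<le> ?L * norm (x - y)" for x y
  proof (rule differentiable_bound[of UNIV])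
    fix x
    have "f differentiable (at x)"
      using assms smooth_on_imp_differentiable_at unfolding test_function_iff by blast
    then show "(f has_derivative (\<lambda>k. \<Sum>b\<in>Basis. (k \<bullet> b) *\<^sub>R partial_deriv b f x)) (at x within UNIV)"
      using has_derivative_partials by auto
    show "onorm (\<lambda>k. \<Sum>b\<in>Basis. (k \<bullet> b) *\<^sub>R partial_deriv b f x) \<le> ?L"
    proof (rule onorm_le)
      fix k :: 'a
      have "norm (\<Sum>b\<in>Basis. (k \<bullet> b) *\<^sub>R partial_deriv b f x) \<le> (\<Sum>b\<in>Basis. norm k * M b)"
        by (intro sum_norm_le) (auto intro!: mult_mono M simp: Basis_le_norm)
      then show "norm (\<Sum>b\<in>Basis. (k \<bullet> b) *\<^sub>R partial_deriv b f x) \<le> ?L * norm k"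
        by (simp add: sum_distrib_left mult.commute)
    qed
  qed auto
  moreover have "0 < ?L" using M(1) by (intro sum_pos) auto
  ultimately show ?thesis using that by blast
qed

subsection \<open>Plateau functions\<close>

text \<open>The value 1 is characterised by an equivalence because the box bumps built from \<eta>
  must stay strictly below 1 off their box. The ratio \<open>\<tau> / \<sigma>\<close> is the factor
  by which a support exceeds its plateau after any rescaling.\<close>

definition plateau :: "(real \<Rightarrow> real) \<Rightarrow> real \<Rightarrow> real \<Rightarrow> bool"
  where "plateau \<eta> \<sigma> \<tau> \<longleftrightarrow> smooth_on UNIV \<eta> \<and> 0 < \<sigma> \<and> \<sigma> < \<tau> \<and> (\<forall>t. 0 \<le> \<eta> t \<and> \<eta> t \<le> 1) \<and>
    (\<forall>t. \<eta> t = 1 \<longleftrightarrow> \<bar>t\<bar> \<le> \<sigma>) \<and> (\<forall>t. \<tau> \<le> \<bar>t\<bar> \<longrightarrow> \<eta> t = 0)"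

lemma cutoff_profileD:
  assumes "cutoff_profile \<delta> b\<^sub>0 a\<^sub>0 w" "0 < \<delta>"
  obtains g where "smooth_on UNIV g" "\<And>t. 0 \<le> t \<Longrightarrow> w t = g t"
    "\<And>t. 0 \<le> t \<Longrightarrow> 0 \<le> w t" "\<And>t. 0 \<le> t \<Longrightarrow> w t \<le> a\<^sub>0" "\<And>t. \<delta> \<le> t \<Longrightarrow> w t = 0" "0 < a\<^sub>0"
proof -
  obtain g where g: "smooth_on UNIV g" "\<And>t. 0 \<le> t \<Longrightarrow> w t = g t"
    using assms unfolding cutoff_profile_def by blast
  have cl: "closure {t. 0 \<le> t \<and> w t \<noteq> 0} \<subseteq> {0..<\<delta>}"
    using assms unfolding cutoff_profile_def by auto
  have "w t = 0" if "\<delta> \<le> t" for t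
  proof (rule ccontr)
    assume "w t \<noteq> 0"
    then have "t \<in> closure {t. 0 \<le> t \<and> w t \<noteq> 0}"
      using that assms(2) by (intro subsetD[OF closure_subset]) auto
    then show False using cl that by auto
  qed
  then show ?thesis using that[OF g] assms unfolding cutoff_profile_def by blast
qed

text \<open>The cut-off profile itself, extended evenly, is a plateau function.\<close>

lemma plateau_exists:
  assumes "cutoff_profile \<delta> b\<^sub>0 a\<^sub>0 w" "0 < \<delta>"
  shows "\<exists>\<eta> \<sigma> \<tau>. plateau \<eta> \<sigma> \<tau>"
proof -
  obtain g where g: "smooth_on UNIV g" "\<And>t. 0 \<le> t \<Longrightarrow> w t = g t"
    and w: "\<And>t. 0 \<le> t \<Longrightarrow> 0 \<le> w t" "0 < a\<^sub>0" "\<And>t. 0 \<le> t \<Longrightarrow> w t \<le> a\<^sub>0"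
    and w0: "\<And>t. \<delta> \<le> t \<Longrightarrow> w t = 0"
    by (rule cutoff_profileD[OF assms]) blast
  have b0: "0 < b\<^sub>0"
    and wa: "\<And>t. 0 \<le> t \<Longrightarrow> t \<le> b\<^sub>0 * \<delta> \<Longrightarrow> w t = a\<^sub>0"
    and anti: "\<And>t u. 0 \<le> t \<Longrightarrow> t \<le> u \<Longrightarrow> w u \<le> w t"
    using assms unfolding cutoff_profile_def monotone_on_def by auto
  define \<eta> where "\<eta> t = w \<bar>t\<bar> / a\<^sub>0" for t
  \<comment> \<open>Three open sets cover the line. On the half-lines \<eta> is a multiple of
    \<open>g\<close> or of its reflection; around 0, where the absolute value is not smooth, the
    profile is constant.\<close>
  have "smooth_on {0<..} \<eta>"
  proof (rule smooth_on_cong)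
    show "smooth_on {0<..} (\<lambda>t. (1 / a\<^sub>0) *\<^sub>R g t)"
      using smooth_on_subset[OF g(1)] by (intro smooth_on_scaleR smooth_on_const) auto
  qed (auto simp: \<eta>_def g(2))
  moreover have "smooth_on {..<0} \<eta>"
  proof (rule smooth_on_cong)
    have "smooth_on {..<0} (\<lambda>t::real. g (0 - t))"
      by (rule smooth_on_reflect[of _ UNIV]) (auto simp: g(1))
    then show "smooth_on {..<0} (\<lambda>t. (1 / a\<^sub>0) *\<^sub>R g (0 - t))"
      by (intro smooth_on_scaleR smooth_on_const) auto
  qed (auto simp: \<eta>_def g(2))
  moreover have "smooth_on {-(b\<^sub>0 * \<delta>)<..<b\<^sub>0 * \<delta>} \<eta>"
  proof (rule smooth_on_cong)
    show "smooth_on {-(b\<^sub>0 * \<delta>)<..<b\<^sub>0 * \<delta>} (\<lambda>_. 1)" by (intro smooth_on_const) auto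
  qed (use w in \<open>auto simp: \<eta>_def wa\<close>)
  moreover have "({0<..} \<union> {..<0}) \<union> {-(b\<^sub>0 * \<delta>)<..<b\<^sub>0 * \<delta>} = UNIV"
  proof -
    have "t \<in> ({0<..} \<union> {..<0}) \<union> {-(b\<^sub>0 * \<delta>)<..<b\<^sub>0 * \<delta>}" for t
      using mult_pos_pos[OF b0 assms(2)] by (cases "t = 0") auto
    then show ?thesis by blast
  qed
  ultimately have smooth: "smooth_on UNIV \<eta>"
    using smooth_on_Un[of "{0<..} \<union> {..<0}" "{-(b\<^sub>0 * \<delta>)<..<b\<^sub>0 * \<delta>}" \<eta>]
      smooth_on_Un[of "{0<..}" "{..<0}" \<eta>] by (simp add: open_Un)
  have range: "0 \<le> \<eta> t" "\<eta> t \<le> 1" for t using w by (auto simp: \<eta>_def)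
  let ?T = "{t. 0 \<le> t \<and> \<eta> t = 1}"
  \<comment> \<open>The maximal plateau may reach beyond \<open>b\<^sub>0 * \<delta>\<close>. Since
    the profile is nonincreasing, the set where \<eta> equals 1 is an interval, and \<sigma> is its
    right end, attained because the set is closed.\<close>
  define \<sigma> where "\<sigma> = Sup ?T"
  have T1: "b\<^sub>0 * \<delta> \<in> ?T" using w b0 assms(2) by (auto simp: \<eta>_def wa)
  have Tle: "t < \<delta>" if "t \<in> ?T" for t
    using that w0[of t] w by (auto simp: \<eta>_def not_less[symmetric])
  have bdd: "bdd_above ?T" using Tle by (intro bdd_aboveI[of _ \<delta>]) (meson less_le)
  have "closed ?T"
  proof -
    have "continuous_on UNIV \<eta>" by (rule smooth_on_continuous_on[OF smooth])
    then have "closed (\<eta> -` {1})" by (metis closed_singleton closed_vimage_Int inf_top.right_neutral closed_UNIV)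
    moreover have "?T = {0..} \<inter> \<eta> -` {1}" by auto
    ultimately show ?thesis by auto
  qed
  then have sT: "\<sigma> \<in> ?T" unfolding \<sigma>_def using T1 bdd by (intro closed_contains_Sup) auto
  have "b\<^sub>0 * \<delta> \<le> \<sigma>" unfolding \<sigma>_def using T1 bdd by (rule cSup_upper)
  then have "0 < \<sigma>" using mult_pos_pos[OF b0 assms(2)] by simp
  moreover have "\<eta> t = 1 \<longleftrightarrow> \<bar>t\<bar> \<le> \<sigma>" for t
  proof
    assume "\<eta> t = 1"
    then have "\<bar>t\<bar> \<in> ?T" by (auto simp: \<eta>_def)
    then show "\<bar>t\<bar> \<le> \<sigma>" unfolding \<sigma>_def using bdd by (intro cSup_upper)
  next
    assume "\<bar>t\<bar> \<le> \<sigma>"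
    then have "w \<sigma> \<le> w \<bar>t\<bar>" by (intro anti) auto
    moreover have "w \<sigma> = a\<^sub>0" using sT w(2) by (auto simp: \<eta>_def)
    ultimately show "\<eta> t = 1" using w(2) w(3)[of "\<bar>t\<bar>"] by (simp add: \<eta>_def)
  qed
  moreover have "\<eta> t = 0" if "\<delta> \<le> \<bar>t\<bar>" for t using w0[OF that] by (simp add: \<eta>_def)
  ultimately show ?thesis
    using smooth range Tle[OF sT] unfolding plateau_def by blast
qed

text \<open>Since \<open>\<phi>\<close> equals 1 exactly on the box, its powers converge to the indicator of the box.\<close>

lemma box_bump:
  fixes a b :: "'a::euclidean_space"
  assumes "plateau \<eta> \<sigma> \<tau>" and lt: "\<And>i. i \<in> Basis \<Longrightarrow> a \<bullet> i < b \<bullet> i"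
  obtains \<phi> :: "'a \<Rightarrow> real" where "test_function \<phi>" "\<And>y. 0 \<le> \<phi> y" "\<And>y. \<phi> y \<le> 1"
    "\<And>y. \<phi> y = 1 \<longleftrightarrow> y \<in> cbox a b"
    "\<And>y. \<phi> y \<noteq> 0 \<Longrightarrow> \<forall>i\<in>Basis. \<bar>y \<bullet> i - (a + b) \<bullet> i / 2\<bar> \<le> (b - a) \<bullet> i / 2 * (\<tau> / \<sigma>)"
proof -
  note eta = assms(1)[unfolded plateau_def]
  \<comment> \<open>Scaling coordinate \<open>i\<close> by \<open>k i\<close> takes the half-width
    \<open>(b - a) \<bullet> i / 2\<close> of the box to \<sigma>, so the plateau of \<eta> becomes
    exactly the side of the box.\<close>
  define k where "k i = 2 * \<sigma> / ((b - a) \<bullet> i)" for i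
  have k: "0 < k i" if "i \<in> Basis" for i
    using eta lt[OF that] by (simp add: k_def inner_diff_left)
  define \<psi> where "\<psi> i y = \<eta> (- (k i * ((a + b) \<bullet> i / 2)) + k i * (y \<bullet> i))" for i y
  have arg: "- (k i * ((a + b) \<bullet> i / 2)) + k i * (y \<bullet> i) = k i * (y \<bullet> i - (a + b) \<bullet> i / 2)" for i y
    by (simp add: algebra_simps)
  define \<phi> where "\<phi> y = (\<Prod>i\<in>Basis. \<psi> i y)" for y
  have psi: "0 \<le> \<psi> i y" "\<psi> i y \<le> 1" for i y using eta by (auto simp: \<psi>_def)
  have "smooth_on UNIV \<phi>"
    unfolding \<phi>_def[abs_def] \<psi>_def[abs_def]
    using eta by (intro smooth_on_prod smooth_on_compose_coordinate) auto
  moreover have range: "0 \<le> \<phi> y" "\<phi> y \<le> 1" for y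
    unfolding \<phi>_def using psi by (auto intro: prod_nonneg prod_le_1)
  moreover have psi1: "\<psi> i y = 1 \<longleftrightarrow> a \<bullet> i \<le> y \<bullet> i \<and> y \<bullet> i \<le> b \<bullet> i" if "i \<in> Basis" for i y
  proof -
    have "\<psi> i y = 1 \<longleftrightarrow> k i * \<bar>y \<bullet> i - (a + b) \<bullet> i / 2\<bar> \<le> \<sigma>"
      using eta k[OF that] unfolding \<psi>_def arg by (simp add: abs_mult)
    also have "\<dots> \<longleftrightarrow> \<bar>y \<bullet> i - (a + b) \<bullet> i / 2\<bar> \<le> (b - a) \<bullet> i / 2"
    proof -
      have "k i * u \<le> \<sigma> \<longleftrightarrow> u \<le> (b - a) \<bullet> i / 2" for u
      proof -
        have "0 < (b - a) \<bullet> i" using lt[OF that] by (simp add: inner_diff_left)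
        then have "k i * u \<le> \<sigma> \<longleftrightarrow> \<sigma> * (2 * u) \<le> \<sigma> * ((b - a) \<bullet> i)"
          by (simp add: k_def pos_divide_le_eq mult_ac)
        then show ?thesis using eta by (simp add: mult.commute)
      qed
      then show ?thesis .
    qed
    also have "\<dots> \<longleftrightarrow> a \<bullet> i \<le> y \<bullet> i \<and> y \<bullet> i \<le> b \<bullet> i"
      by (auto simp: abs_le_iff inner_add_left inner_diff_left field_simps)
    finally show ?thesis .
  qed
  \<comment> \<open>All factors lie between 0 and 1, so a product equal to 1 forces every factor to
    be 1.\<close>
  have "\<phi> y = 1 \<longleftrightarrow> (\<forall>i\<in>Basis. \<psi> i y = 1)" for y
  proof
    assume 1: "\<phi> y = 1"
    show "\<forall>i\<in>Basis. \<psi> i y = 1"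
    proof
      fix i :: 'a assume i: "i \<in> Basis"
      have "\<phi> y = \<psi> i y * (\<Prod>j\<in>Basis - {i}. \<psi> j y)"
        unfolding \<phi>_def using i by (simp add: prod.remove)
      moreover have "(\<Prod>j\<in>Basis - {i}. \<psi> j y) \<le> 1" using psi by (intro prod_le_1) auto
      ultimately have "1 \<le> \<psi> i y" using 1 psi(1)[of i y] 
        by (metis mult.right_neutral mult_left_mono)
      then show "\<psi> i y = 1" using psi(2)[of i y] by simp
    qed
  qed (simp add: \<phi>_def)
  then have "\<phi> y = 1 \<longleftrightarrow> y \<in> cbox a b" for y using psi1 by (simp add: mem_box)
  moreover have supp: "\<bar>y \<bullet> i - (a + b) \<bullet> i / 2\<bar> \<le> (b - a) \<bullet> i / 2 * (\<tau> / \<sigma>)"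
    if "\<phi> y \<noteq> 0" "i \<in> Basis" for y i
  proof -
    have "\<psi> i y \<noteq> 0" using that unfolding \<phi>_def by auto
    then have "k i * \<bar>y \<bullet> i - (a + b) \<bullet> i / 2\<bar> < \<tau>"
      using eta k[OF that(2)] unfolding \<psi>_def arg by (force simp: abs_mult not_le[symmetric])
    then show ?thesis using eta lt[OF that(2)] by (simp add: k_def inner_diff_left field_simps)
  qed
  moreover have "bounded {y. \<phi> y \<noteq> 0}"
  proof (rule boundedI)
    fix y assume "y \<in> {y. \<phi> y \<noteq> 0}"
    then have s: "\<bar>y \<bullet> i - (a + b) \<bullet> i / 2\<bar> \<le> (b - a) \<bullet> i / 2 * (\<tau> / \<sigma>)" if "i \<in> Basis" for i
      using supp that by blast
    have "norm y \<le> (\<Sum>i\<in>Basis. \<bar>y \<bullet> i\<bar>)" by (rule norm_le_l1)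
    also have "\<dots> \<le> (\<Sum>i\<in>Basis. \<bar>(a + b) \<bullet> i / 2\<bar> + (b - a) \<bullet> i / 2 * (\<tau> / \<sigma>))"
      using s by (intro sum_mono) (smt (verit))
    finally show "norm y \<le> (\<Sum>i\<in>Basis. \<bar>(a + b) \<bullet> i / 2\<bar> + (b - a) \<bullet> i / 2 * (\<tau> / \<sigma>))" .
  qed
  ultimately show ?thesis using that unfolding test_function_iff by blast
qed

text \<open>Cubes are compared with balls. The cube of half-width \<rho> contains the ball of radius
  \<rho>, and the support lies in a cube of half-width \<open>\<rho> * (\<tau> / \<sigma>)\<close>,
  whose points have Euclidean norm at most the dimension times that, by comparison with the sum of
  the absolute coordinates. Hence \<kappa> depends neither on the centre nor on \<rho>.\<close>

lemma bump_exists: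
  assumes "plateau \<eta> \<sigma> \<tau>"
  obtains \<kappa> where "1 < \<kappa>" "\<And>(x::'a::euclidean_space) \<rho>. 0 < \<rho> \<Longrightarrow> \<exists>\<phi> :: 'a \<Rightarrow> real. test_function \<phi> \<and>
    (\<forall>y. norm (y - x) \<le> \<rho> \<longrightarrow> \<phi> y = 1) \<and> (\<forall>y. \<kappa> * \<rho> < norm (y - x) \<longrightarrow> \<phi> y = 0)"
proof -
  have st: "0 < \<sigma>" "\<sigma> < \<tau>" using assms by (auto simp: plateau_def)
  let ?\<kappa> = "DIM('a) * (\<tau> / \<sigma>)"
  have "\<exists>\<phi> :: 'a \<Rightarrow> real. test_function \<phi> \<and>
    (\<forall>y. norm (y - x) \<le> \<rho> \<longrightarrow> \<phi> y = 1) \<and> (\<forall>y. ?\<kappa> * \<rho> < norm (y - x) \<longrightarrow> \<phi> y = 0)"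
    if "0 < \<rho>" for x :: 'a and \<rho>
  proof -
    obtain \<phi> :: "'a \<Rightarrow> real" where \<phi>: "test_function \<phi>"
      "\<And>y. \<phi> y = 1 \<longleftrightarrow> y \<in> cbox (x - \<rho> *\<^sub>R One) (x + \<rho> *\<^sub>R One)"
      "\<And>y. \<phi> y \<noteq> 0 \<Longrightarrow> \<forall>i\<in>Basis. \<bar>y \<bullet> i - ((x - \<rho> *\<^sub>R One) + (x + \<rho> *\<^sub>R One)) \<bullet> i / 2\<bar>
        \<le> ((x + \<rho> *\<^sub>R One) - (x - \<rho> *\<^sub>R One)) \<bullet> i / 2 * (\<tau> / \<sigma>)"
    proof (rule box_bump[OF assms, of "x - \<rho> *\<^sub>R One" "x + \<rho> *\<^sub>R One"])
      show "(x - \<rho> *\<^sub>R One) \<bullet> i < (x + \<rho> *\<^sub>R One) \<bullet> i" if "i \<in> Basis" for i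
        using \<open>0 < \<rho>\<close> that by (simp add: inner_diff_left inner_add_left)
    qed blast
    have "\<phi> y = 1" if "norm (y - x) \<le> \<rho>" for y
    proof -
      have "\<bar>(y - x) \<bullet> i\<bar> \<le> \<rho>" if "i \<in> Basis" for i
        using \<open>norm (y - x) \<le> \<rho>\<close> Basis_le_norm[OF that] order_trans by blast
      then have "y \<in> cbox (x - \<rho> *\<^sub>R One) (x + \<rho> *\<^sub>R One)"
        by (simp add: mem_box inner_diff_left inner_add_left abs_le_iff algebra_simps)
      then show ?thesis using \<phi>(2) by blast
    qed
    moreover have "\<phi> y = 0" if "?\<kappa> * \<rho> < norm (y - x)" for y
    proof (rule ccontr)
      assume n: "\<phi> y \<noteq> 0"
      have "norm (y - x) \<le> (\<Sum>i\<in>Basis. \<bar>(y - x) \<bullet> i\<bar>)" by (rule norm_le_l1)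
      also have "\<dots> \<le> (\<Sum>i\<in>(Basis::'a set). \<rho> * (\<tau> / \<sigma>))"
        using \<phi>(3)[OF n] by (intro sum_mono) (simp add: inner_diff_left inner_add_left)
      finally show False using that by (simp add: mult_ac)
    qed
    ultimately show ?thesis using \<phi>(1) by blast
  qed
  moreover have "1 < ?\<kappa>"
  proof -
    have "1 < \<tau> / \<sigma>" using st by simp
    moreover have "1 \<le> real DIM('a)" using DIM_positive[where 'a='a] by linarith
    ultimately show ?thesis by (smt (verit) mult_le_cancel_right1)
  qed
  ultimately show ?thesis using that by blast
qed

subsection \<open>The fundamental lemma of the calculus of variations\<close>

lemma sigma_finite_lebesgue: "sigma_finite_measure (lebesgue :: 'a::euclidean_space measure)"
proof
  let ?A = "\<lambda>n::nat. box (- (real n *\<^sub>R One)) (real n *\<^sub>R One) :: 'a set"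
  show "\<exists>A::'a set set. countable A \<and> A \<subseteq> sets lebesgue \<and> \<Union> A = space lebesgue \<and>
      (\<forall>a\<in>A. emeasure lebesgue a \<noteq> \<infinity>)"
    by (intro exI[of _ "range ?A"]) (auto simp: UN_box_eq_UNIV[simplified] emeasure_lborel_box_eq)
qed

text \<open>Open boxes are stable under intersection and generate the Borel sets, and the sets over
  which \<open>h\<close> integrates to 0 form a Dynkin system; complements are covered because
  exhausting the space by boxes makes the total integral vanish. A Lebesgue set differs from a Borel
  set by a null set, so all set integrals vanish, and with them the density
  \<open>h\<close>.\<close>

lemma AE_zero_of_boxes:
  fixes h :: "'a::euclidean_space \<Rightarrow> real"
  assumes h: "integrable lebesgue h"
    and box: "\<And>a b. (LINT y:box a b|lebesgue. h y) = 0"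
  shows "AE y in lebesgue. h y = 0"
proof -
  let ?I = "\<lambda>A. LINT y:A|lebesgue. h y"
  have si: "set_integrable lebesgue A h" if "A \<in> sets lebesgue" for A
    using h that by (rule integrable_mult_indicator[folded set_integrable_def, rotated])
  have zero: "?I UNIV = 0"
  proof -
    let ?A = "\<lambda>n::nat. box (- (real n *\<^sub>R One)) (real n *\<^sub>R One) :: 'a set"
    have "(\<lambda>n. ?I (?A n)) \<longlonglongrightarrow> ?I (\<Union>n. ?A n)"
      by (rule set_integral_cont_up) (auto simp: incseq_def subset_box si inner_sum_left_Basis)
    then show ?thesis unfolding box UN_box_eq_UNIV using LIMSEQ_unique tendsto_const by blast
  qed
  have borel: "?I A = 0" if "A \<in> sets borel" for A
  proof -
    let ?E = "range (\<lambda>(a, b). box a b :: 'a set)"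
    have "Int_stable ?E" by (auto simp: Int_stable_def box_Int_box)
    moreover have "?E \<subseteq> Pow UNIV" by auto
    moreover have "A \<in> sigma_sets UNIV ?E" using that by (simp add: borel_eq_box)
    ultimately show ?thesis
    proof (induction rule: sigma_sets_induct_disjoint)
      case (basic A)
      then show ?case using box by auto
    next
      case empty
      then show ?case by (simp add: set_lebesgue_integral_def)
    next
      case (compl A)
      then have "A \<in> sets borel" by (simp add: borel_eq_box)
      then have A: "A \<in> sets lebesgue" by simp
      have "?I (A \<union> (UNIV - A)) = ?I A + ?I (UNIV - A)"
        using A by (intro set_integral_Un si) auto
      moreover have "A \<union> (UNIV - A) = UNIV" by auto
      ultimately show ?case using zero compl by simp
    next
      case (union A)
      then have "A i \<in> sets borel" for i by (auto simp: borel_eq_box)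
      then have A: "A i \<in> sets lebesgue" for i by simp
      have "?I (\<Union>i. A i) = (\<Sum>i. ?I (A i))"
      proof (rule lebesgue_integral_countable_add)
        show "A i \<inter> A j = {}" if "i \<noteq> j" for i j
          using union(1) that by (auto simp: disjoint_family_on_def)
      qed (use A in \<open>auto intro!: si\<close>)
      then show ?case using union by simp
    qed
  qed
  show ?thesis
  proof (rule sigma_finite_measure.density_zero[OF sigma_finite_lebesgue h])
    fix A :: "'a set" assume "A \<in> sets lebesgue"
    then obtain S N N' where A: "A = S \<union> N" "N \<subseteq> N'" "N' \<in> null_sets lborel" "S \<in> sets lborel"
      by (rule sets_completionE)
    have N': "N' \<in> null_sets lebesgue" using A(3) by (rule null_sets_completionI)
    have "?I A = ?I S"
      unfolding set_lebesgue_integral_def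
    proof (rule integral_cong_AE)
      show "AE y in lebesgue. indicator A y *\<^sub>R h y = indicator S y *\<^sub>R h y"
        using AE_not_in[OF N'] by eventually_elim (use A(1,2) in \<open>auto simp: indicator_def\<close>)
    qed (use si \<open>A \<in> sets lebesgue\<close> A(4) in
      \<open>auto simp: set_integrable_def intro!: borel_measurable_integrable\<close>)
    then show "?I A = 0" using borel[of S] A(4) by simp
  qed
qed

text \<open>Powers of a box bump are test functions bounded by 1, so dominated convergence with
  majorant \<open>norm (h y)\<close> gives a zero integral over every closed box. The faces of a box
  are null, which transfers this to open boxes.\<close>

lemma AE_zero_of_test_functions:
  fixes h :: "'a::euclidean_space \<Rightarrow> real"
  assumes "plateau \<eta> \<sigma> \<tau>" and h: "integrable lebesgue h"
    and test: "\<And>\<phi>. test_function \<phi> \<Longrightarrow> (LINT y|lebesgue. \<phi> y * h y) = 0"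
  shows "AE y in lebesgue. h y = 0"
proof (rule AE_zero_of_boxes[OF h])
  fix a b :: 'a
  show "(LINT y:box a b|lebesgue. h y) = 0"
  proof (cases "\<forall>i\<in>Basis. a \<bullet> i < b \<bullet> i")
    case False
    then have "box a b = {}" by (auto simp: box_eq_empty not_less)
    then show ?thesis by (simp add: set_lebesgue_integral_def)
  next
    case True
    obtain \<phi> :: "'a \<Rightarrow> real" where \<phi>: "test_function \<phi>" "\<And>y. 0 \<le> \<phi> y" "\<And>y. \<phi> y \<le> 1"
      "\<And>y. \<phi> y = 1 \<longleftrightarrow> y \<in> cbox a b"
      by (rule box_bump[OF assms(1), of a b]) (use True in blast)+
    \<comment> \<open>Exponents start at 1: the zeroth power is the constant 1, which lacks compact
      support.\<close>
    have pow: "test_function (\<lambda>y. \<phi> y ^ Suc n)" for n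
    proof (induction n)
      case (Suc n)
      then show ?case
        using test_function_mult[of \<phi> "\<lambda>y. \<phi> y ^ Suc n"] \<phi>(1) by (simp add: test_function_iff)
    qed (simp add: \<phi>(1))
    have meas: "h \<in> borel_measurable lebesgue" using h by auto
    have "\<phi> \<in> borel_measurable lebesgue"
      using test_function_continuous[OF \<phi>(1)]
      by (intro measurable_completion) (simp add: borel_measurable_continuous_onI)
    moreover have "cbox a b \<in> sets lebesgue" by simp
    ultimately have [measurable]: "\<phi> \<in> borel_measurable lebesgue" "cbox a b \<in> sets lebesgue" by auto
    note [measurable] = meas
    have "(\<lambda>n. LINT y|lebesgue. \<phi> y ^ Suc n * h y) \<longlonglongrightarrow> (LINT y|lebesgue. indicator (cbox a b) y *\<^sub>R h y)"
    proof (rule integral_dominated_convergence[where w = "\<lambda>y. norm (h y)"])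
      show "AE y in lebesgue. (\<lambda>n. \<phi> y ^ Suc n * h y) \<longlonglongrightarrow> indicator (cbox a b) y *\<^sub>R h y"
      proof (rule AE_I2)
        fix y
        have "(\<lambda>n. \<phi> y ^ Suc n) \<longlonglongrightarrow> indicator (cbox a b) y"
        proof (cases "y \<in> cbox a b")
          case True
          then have "\<phi> y = 1" using \<phi>(4) by blast
          then show ?thesis using True by simp
        next
          case False
          then have "\<phi> y < 1" using \<phi>(3)[of y] \<phi>(4)[of y] by (metis less_eq_real_def)
          then have "(\<lambda>n. \<phi> y ^ n) \<longlonglongrightarrow> 0" using \<phi>(2)[of y] by (intro LIMSEQ_realpow_zero)
          then show ?thesis using False LIMSEQ_Suc by fastforce
        qed
        then show "(\<lambda>n. \<phi> y ^ Suc n * h y) \<longlonglongrightarrow> indicator (cbox a b) y *\<^sub>R h y"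
          using tendsto_mult_right by fastforce
      qed
      show "AE y in lebesgue. norm (\<phi> y ^ Suc n * h y) \<le> norm (h y)" for n
      proof (rule AE_I2)
        fix y
        have "\<phi> y ^ Suc n \<le> 1" using \<phi>(2,3)[of y] by (rule power_le_one)
        then show "norm (\<phi> y ^ Suc n * h y) \<le> norm (h y)"
          unfolding norm_mult using \<phi>(2)[of y] by (intro mult_left_le_one_le) auto
      qed
    qed (use h in auto)
    moreover have "(LINT y|lebesgue. \<phi> y ^ Suc n * h y) = 0" for n using test[OF pow] .
    ultimately have c: "(LINT y:cbox a b|lebesgue. h y) = 0"
      unfolding set_lebesgue_integral_def using LIMSEQ_unique[OF tendsto_const] by force
    have "(LINT y:box a b|lebesgue. h y) = (LINT y:cbox a b|lebesgue. h y)"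
      unfolding set_lebesgue_integral_def
    proof (rule integral_cong_AE)
      have [measurable]: "box a b \<in> sets lebesgue" by simp
      show "(\<lambda>y. indicator (box a b) y *\<^sub>R h y) \<in> borel_measurable lebesgue"
        "(\<lambda>y. indicator (cbox a b) y *\<^sub>R h y) \<in> borel_measurable lebesgue" by measurable
      have "cbox a b - box a b \<in> null_sets lebesgue"
        using negligible_frontier_interval negligible_iff_null_sets by blast
      then have "AE y in lebesgue. y \<notin> cbox a b - box a b" by (rule AE_not_in)
      then show "AE y in lebesgue. indicator (box a b) y *\<^sub>R h y = indicator (cbox a b) y *\<^sub>R h y"
        by eventually_elim (use box_subset_cbox in \<open>auto simp: indicator_def\<close>)
    qed
    then show ?thesis using c by simp
  qed
qed

subsection \<open>Lebesgue integrals on Euclidean space\<close>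

text \<open>The affine change of variables with all coordinate factors equal to -1, whose Jacobian
  has absolute value 1.\<close>

lemma
  fixes x :: "'a::euclidean_space"
  shows distr_lebesgue_reflect: "distr lebesgue lebesgue (\<lambda>y. x - y) = lebesgue"
    and measurable_lebesgue_reflect: "(\<lambda>y. x - y) \<in> lebesgue \<rightarrow>\<^sub>M lebesgue"
proof -
  have eq: "(\<lambda>y. x + (\<Sum>j\<in>Basis. (- 1 * (y \<bullet> j)) *\<^sub>R j)) = (\<lambda>y. x - y)"
    by (simp add: sum_negf euclidean_representation)
  have "lebesgue = density (distr lebesgue lebesgue (\<lambda>y. x - y)) (\<lambda>_. \<Prod>j\<in>(Basis::'a set). ennreal \<bar>- 1\<bar>)"
    using lebesgue_affine_euclidean[of "\<lambda>_. - 1" x] unfolding eq by simp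
  moreover have "(\<Prod>j\<in>(Basis::'a set). ennreal \<bar>- 1\<bar>) = 1" by simp
  ultimately show "distr lebesgue lebesgue (\<lambda>y. x - y) = lebesgue" by (simp add: density_1)
  show "(\<lambda>y. x - y) \<in> lebesgue \<rightarrow>\<^sub>M lebesgue"
    using lebesgue_affine_measurable[of "\<lambda>_. - 1" x] unfolding eq by simp
qed

lemma integral_lebesgue_reflect:
  fixes f :: "'a::euclidean_space \<Rightarrow> 'b::{banach, second_countable_topology}"
  assumes "f \<in> borel_measurable lebesgue"
  shows "(LINT y|lebesgue. f (x - y)) = (LINT y|lebesgue. f y)"
  using integral_distr[OF measurable_lebesgue_reflect assms, of x]
  by (simp add: distr_lebesgue_reflect)

lemma integrable_lebesgue_reflect:
  fixes f :: "'a::euclidean_space \<Rightarrow> 'b::{banach, second_countable_topology}"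
  assumes "integrable lebesgue f"
  shows "integrable lebesgue (\<lambda>y. f (x - y))"
  by (rule integrable_distr[OF measurable_lebesgue_reflect]) (simp add: distr_lebesgue_reflect assms)

lemma borel_measurable_lebesgue_compose:
  "K \<in> borel_measurable borel \<Longrightarrow> f \<in> borel_measurable M \<Longrightarrow> (\<lambda>y. K (f y)) \<in> borel_measurable M"
  by (rule measurable_compose)

lemma measurable_lebesgue_ident: "(\<lambda>y. y) \<in> borel_measurable lebesgue"
  by (intro measurable_completion) simp

lemma set_integrable_locally:
  fixes f :: "'a::euclidean_space \<Rightarrow> 'b::{banach, second_countable_topology}"
  assumes "locally_integrable f" "bounded A" "A \<in> sets lebesgue"
  shows "set_integrable lebesgue A f"
proof -
  obtain c R where "A \<subseteq> cball c R" using assms(2) by (auto simp: bounded_subset_cball)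
  moreover have "set_integrable lebesgue (cball c R) f"
    using assms(1) unfolding locally_integrable_def by simp
  ultimately show ?thesis using set_integrable_subset assms(3) by blast
qed

lemma locally_integrable_measurable:
  fixes f :: "'a::euclidean_space \<Rightarrow> 'b::{banach, second_countable_topology}"
  assumes "locally_integrable f"
  shows "f \<in> borel_measurable lebesgue"
proof (rule borel_measurable_LIMSEQ_metric)
  fix n :: nat
  have "set_integrable lebesgue (cball 0 (real n)) f"
    using assms unfolding locally_integrable_def by simp
  then show "(\<lambda>x. indicator (cball 0 (real n)) x *\<^sub>R f x) \<in> borel_measurable lebesgue"
    unfolding set_integrable_def by (rule borel_measurable_integrable)
next
  fix x :: 'a
  show "(\<lambda>n. indicator (cball 0 (real n)) x *\<^sub>R f x) \<longlonglongrightarrow> f x"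
  proof (rule tendsto_eventually)
    obtain N where N: "norm x \<le> real N" using real_arch_simple by blast
    show "\<forall>\<^sub>F n in sequentially. indicator (cball 0 (real n)) x *\<^sub>R f x = f x"
      by (rule eventually_sequentiallyI[of N]) (use N in \<open>auto simp: indicator_def\<close>)
  qed
qed

lemma integrable_imp_locally_integrable: "integrable lebesgue f \<Longrightarrow> locally_integrable f"
  unfolding locally_integrable_def set_integrable_def
  by (auto intro!: integrable_mult_indicator lmeasurable_compact fmeasurableD)

lemma locally_integrable_continuous:
  fixes f :: "'a::euclidean_space \<Rightarrow> 'b::euclidean_space"
  assumes "continuous_on UNIV f"
  shows "locally_integrable f"
  unfolding locally_integrable_def
proof (intro allI impI)
  fix C :: "'a set" assume C: "compact C"
  have "integrable lborel (\<lambda>x. indicator C x *\<^sub>R f x)"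
    using C continuous_on_subset[OF assms] by (intro borel_integrable_compact) auto
  then show "set_integrable lebesgue C f" 
    unfolding set_integrable_def by (subst integrable_completion) auto
qed

lemma set_integral_Diff_ball_tendsto:
  fixes f :: "'a::euclidean_space \<Rightarrow> 'b::{banach, second_countable_topology}"
  assumes A: "A \<in> sets lebesgue" and f: "set_integrable lebesgue A f"
  shows "((\<lambda>r. LINT z:A - ball y r|lebesgue. f z) \<longlongrightarrow> (LINT z:A|lebesgue. f z)) (at_right 0)"
proof (rule tendsto_at_right_sequentially[of 0 1])
  fix S :: "nat \<Rightarrow> real"
  assume S: "\<And>n. 0 < S n" "S \<longlonglongrightarrow> 0"
  let ?f = "\<lambda>z. indicator A z *\<^sub>R f z"
  have [measurable]: "?f \<in> borel_measurable lebesgue"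
    using f unfolding set_integrable_def by (rule borel_measurable_integrable)
  have [measurable]: "- ball y r \<in> sets lebesgue" for r by simp
  have eq: "(LINT z:A - ball y r|lebesgue. f z) = (LINT z|lebesgue. indicator (- ball y r) z *\<^sub>R ?f z)" for r
    unfolding set_lebesgue_integral_def by (intro Bochner_Integration.integral_cong) (auto simp: indicator_def)
  have "(\<lambda>n. LINT z|lebesgue. indicator (- ball y (S n)) z *\<^sub>R ?f z) \<longlonglongrightarrow> (LINT z|lebesgue. ?f z)"
  proof (rule integral_dominated_convergence[where w = "\<lambda>z. norm (?f z)"])
    have "{y} \<in> null_sets lebesgue" by (simp add: null_sets_completionI finite_imp_null_set_lborel)
    then have "AE z in lebesgue. z \<noteq> y" using AE_not_in by fastforce
    then show "AE z in lebesgue. (\<lambda>n. indicator (- ball y (S n)) z *\<^sub>R ?f z) \<longlonglongrightarrow> ?f z"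
    proof eventually_elim
      case (elim z)
      then have "\<forall>\<^sub>F n in sequentially. S n < dist y z"
        using S(2) by (intro order_tendstoD(2)) auto
      then have "\<forall>\<^sub>F n in sequentially. indicator (- ball y (S n)) z *\<^sub>R ?f z = ?f z"
        by eventually_elim (auto simp: indicator_def)
      then show ?case by (rule tendsto_eventually)
    qed
    show "integrable lebesgue (\<lambda>z. norm (?f z))"
      using f unfolding set_integrable_def by (rule integrable_norm)
    show "?f \<in> borel_measurable lebesgue" by measurable
    show "(\<lambda>z. indicator (- ball y (S n)) z *\<^sub>R ?f z) \<in> borel_measurable lebesgue" for n
      by measurable
  qed (auto simp: indicator_def)
  then show "(\<lambda>n. LINT z:A - ball y (S n)|lebesgue. f z) \<longlonglongrightarrow> (LINT z:A|lebesgue. f z)"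
    unfolding eq unfolding set_lebesgue_integral_def .
qed simp

text \<open>Every limit in \<open>r\<close> outside the collar estimate reduces to this one. All
  regularity is asked of \<open>F\<close>, none of \<open>g\<close>, so \<open>g\<close> may carry a
  singularity. The limit \<open>F0\<close> is given only pointwise: it is measurable as the limit
  along \<open>1 / (n + 1)\<close>, and bounded because it stays within \<open>e (\<rho>/2)\<close>
  of the single bounded function \<open>F (\<rho>/2)\<close>.\<close>

lemma tendsto_integral_inner_uniform:
  fixes F :: "real \<Rightarrow> 'a::euclidean_space \<Rightarrow> 'b::euclidean_space" and g :: "'a \<Rightarrow> 'b"
  assumes A: "A \<in> sets lebesgue" and g: "set_integrable lebesgue A g"
    and meas: "\<And>r. 0 < r \<Longrightarrow> F r \<in> borel_measurable lebesgue"
    and bdd: "\<And>r. 0 < r \<Longrightarrow> \<exists>M. \<forall>y\<in>A. norm (F r y) \<le> M"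
    and "0 < \<rho>" and e: "(e \<longlongrightarrow> 0) (at_right 0)"
    and unif: "\<And>r y. 0 < r \<Longrightarrow> r < \<rho> \<Longrightarrow> y \<in> A \<Longrightarrow> norm (F r y - F0 y) \<le> e r"
  shows "0 < r \<Longrightarrow> set_integrable lebesgue A (\<lambda>y. g y \<bullet> F r y)"
    and "set_integrable lebesgue A (\<lambda>y. g y \<bullet> F0 y)"
    and "((\<lambda>r. LINT y:A|lebesgue. g y \<bullet> F r y) \<longlongrightarrow> (LINT y:A|lebesgue. g y \<bullet> F0 y)) (at_right 0)"
proof -
  have gi: "integrable lebesgue (\<lambda>y. indicator A y *\<^sub>R g y)" using g by (simp add: set_integrable_def)
  have bounded_int: "set_integrable lebesgue A (\<lambda>y. g y \<bullet> H y)"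
    if H: "(\<lambda>y. indicator A y *\<^sub>R H y) \<in> borel_measurable lebesgue" and M: "\<And>y. y \<in> A \<Longrightarrow> norm (H y) \<le> M"
    for H :: "'a \<Rightarrow> 'b" and M
    unfolding set_integrable_def
  proof (rule Bochner_Integration.integrable_bound)
    show "integrable lebesgue (\<lambda>y. M *\<^sub>R (indicator A y *\<^sub>R g y))" using gi by (rule integrable_scaleR_right)
    have "(\<lambda>y. (indicator A y *\<^sub>R g y) \<bullet> (indicator A y *\<^sub>R H y)) \<in> borel_measurable lebesgue"
      using H borel_measurable_integrable[OF gi] by (rule borel_measurable_inner[rotated])
    moreover have "(\<lambda>y. (indicator A y *\<^sub>R g y) \<bullet> (indicator A y *\<^sub>R H y)) = (\<lambda>y. indicator A y *\<^sub>R (g y \<bullet> H y))"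
      by (auto simp: indicator_def)
    ultimately show "(\<lambda>y. indicator A y *\<^sub>R (g y \<bullet> H y)) \<in> borel_measurable lebesgue" by simp
    have "\<bar>g y \<bullet> H y\<bar> \<le> \<bar>M\<bar> * norm (g y)" if "y \<in> A" for y
    proof -
      have "\<bar>g y \<bullet> H y\<bar> \<le> norm (g y) * norm (H y)" by (rule Cauchy_Schwarz_ineq2)
      also have "\<dots> \<le> norm (g y) * \<bar>M\<bar>" using M[OF that] by (intro mult_left_mono) auto
      finally show ?thesis by (simp add: mult.commute)
    qed
    then show "AE y in lebesgue. norm (indicator A y *\<^sub>R (g y \<bullet> H y)) \<le> norm (M *\<^sub>R (indicator A y *\<^sub>R g y))"
      by (auto simp: indicator_def)
  qed
  have Fr: "(\<lambda>y. indicator A y *\<^sub>R F r y) \<in> borel_measurable lebesgue" if "0 < r" for r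
    using A meas[OF that] by (intro borel_measurable_scaleR borel_measurable_indicator) auto
  show int_r: "set_integrable lebesgue A (\<lambda>y. g y \<bullet> F r y)" if r: "0 < r" for r
  proof -
    obtain M where "\<And>y. y \<in> A \<Longrightarrow> norm (F r y) \<le> M" using bdd[OF r] by blast
    then show ?thesis using bounded_int[OF Fr[OF r]] by blast
  qed
  have small: "\<forall>\<^sub>F r in at_right 0. 0 < r \<and> r < \<rho>"
    using \<open>0 < \<rho>\<close> by (auto simp: eventually_at_right_field intro: exI[of _ \<rho>])
  have lim: "((\<lambda>r. F r y) \<longlongrightarrow> F0 y) (at_right 0)" if "y \<in> A" for y
  proof (rule LIM_zero_cancel, rule Lim_null_comparison[OF _ e])
    show "\<forall>\<^sub>F r in at_right 0. norm (F r y - F0 y) \<le> e r"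
      using small by eventually_elim (simp add: unif that)
  qed
  have F0: "(\<lambda>y. indicator A y *\<^sub>R F0 y) \<in> borel_measurable lebesgue"
  proof (rule borel_measurable_LIMSEQ_metric)
    fix n :: nat
    show "(\<lambda>y. indicator A y *\<^sub>R F (inverse (real (Suc n))) y) \<in> borel_measurable lebesgue"
      by (rule Fr) simp
  next
    fix y
    have "filterlim (\<lambda>n. inverse (real (Suc n))) (at_right 0) sequentially"
      unfolding filterlim_at using LIMSEQ_inverse_real_of_nat by auto
    then show "(\<lambda>n. indicator A y *\<^sub>R F (inverse (real (Suc n))) y) \<longlonglongrightarrow> indicator A y *\<^sub>R F0 y"
      using filterlim_compose[OF lim] by (cases "y \<in> A") (auto intro: tendsto_eq_intros)
  qed
  show int0: "set_integrable lebesgue A (\<lambda>y. g y \<bullet> F0 y)"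
  proof -
    obtain M where M: "\<And>y. y \<in> A \<Longrightarrow> norm (F (\<rho>/2) y) \<le> M" using bdd[of "\<rho>/2"] \<open>0 < \<rho>\<close> by auto
    have "norm (F0 y) \<le> M + e (\<rho>/2)" if "y \<in> A" for y
      using unif[of "\<rho>/2" y] M[OF that] that \<open>0 < \<rho>\<close> norm_triangle_ineq4[of "F (\<rho>/2) y" "F (\<rho>/2) y - F0 y"]
      by simp
    then show ?thesis by (rule bounded_int[OF F0])
  qed
  show "((\<lambda>r. LINT y:A|lebesgue. g y \<bullet> F r y) \<longlongrightarrow> (LINT y:A|lebesgue. g y \<bullet> F0 y)) (at_right 0)"
  proof (rule LIM_zero_cancel, rule Lim_null_comparison)
    show "((\<lambda>r. (LINT y:A|lebesgue. norm (g y)) * e r) \<longlongrightarrow> 0) (at_right 0)"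
      using tendsto_mult_right_zero[OF e] by simp
    have gn: "set_integrable lebesgue A (\<lambda>y. norm (g y))" using g by (rule set_integrable_norm)
    have "norm ((LINT y:A|lebesgue. g y \<bullet> F r y) - (LINT y:A|lebesgue. g y \<bullet> F0 y))
        \<le> (LINT y:A|lebesgue. norm (g y)) * e r" if r: "0 < r" "r < \<rho>" for r
    proof -
      have "(LINT y:A|lebesgue. g y \<bullet> F r y) - (LINT y:A|lebesgue. g y \<bullet> F0 y)
          = (LINT y:A|lebesgue. g y \<bullet> F r y - g y \<bullet> F0 y)"
        using int_r[OF r(1)] int0 by (rule set_integral_diff(2)[symmetric])
      also have "norm \<dots> \<le> (LINT y:A|lebesgue. norm (g y) * e r)"
        unfolding set_lebesgue_integral_def
      proof (rule Bochner_Integration.integral_norm_bound_integral)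
        show "integrable lebesgue (\<lambda>y. indicator A y *\<^sub>R (g y \<bullet> F r y - g y \<bullet> F0 y))"
          using set_integral_diff(1)[OF int_r[OF r(1)] int0] by (simp add: set_integrable_def)
        show "integrable lebesgue (\<lambda>y. indicator A y *\<^sub>R (norm (g y) * e r))"
          using gn by (simp add: set_integrable_def flip: mult.assoc)
        fix y
        have "norm (g y \<bullet> F r y - g y \<bullet> F0 y) \<le> norm (g y) * e r" if "y \<in> A"
        proof -
          have "norm (g y \<bullet> F r y - g y \<bullet> F0 y) = \<bar>g y \<bullet> (F r y - F0 y)\<bar>" by (simp add: inner_diff_right)
          also have "\<dots> \<le> norm (g y) * norm (F r y - F0 y)" by (rule Cauchy_Schwarz_ineq2)
          also have "\<dots> \<le> norm (g y) * e r" using unif[OF r that] by (rule mult_left_mono) simp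
          finally show ?thesis .
        qed
        then show "norm (indicator A y *\<^sub>R (g y \<bullet> F r y - g y \<bullet> F0 y)) \<le> indicator A y *\<^sub>R (norm (g y) * e r)"
          by (auto simp: indicator_def)
      qed
      also have "\<dots> = (LINT y:A|lebesgue. norm (g y)) * e r" by simp
      finally show ?thesis .
    qed
    then show "\<forall>\<^sub>F r in at_right 0. norm ((LINT y:A|lebesgue. g y \<bullet> F r y) - (LINT y:A|lebesgue. g y \<bullet> F0 y))
        \<le> (LINT y:A|lebesgue. norm (g y)) * e r"
      using small by (auto elim!: eventually_mono)
  qed
qed

subsection \<open>Truncated singular integrals with an odd kernel\<close>

text \<open>The analytic content of \<open>nl_kernel\<close>, with \<open>s\<close>, the profile and
  the dimension abstracted away. \<open>K_moment\<close> measures the singularity: one power of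
  \<open>norm h\<close>, gained from a Lipschitz field, makes the kernel integrable. Boundedness off
  the origin makes the truncated operators absolutely convergent, and the Lipschitz property off the
  origin gives regularity of contributions from far away.\<close>

locale odd_kernel =
  fixes K :: "'a::euclidean_space \<Rightarrow> 'a" and \<delta> :: real
  assumes delta_pos: "0 < \<delta>"
    and K_measurable [measurable]: "K \<in> borel_measurable borel"
    and K_odd: "K (- h) = - K h"
    and K_support: "\<delta> \<le> norm h \<Longrightarrow> K h = 0"
    and K_bounded: "0 < \<rho> \<Longrightarrow> \<exists>M. \<forall>h. \<rho> \<le> norm h \<longrightarrow> norm (K h) \<le> M"
    and K_Lipschitz: "0 < \<rho> \<Longrightarrow> \<exists>L. \<forall>h h'. \<rho> \<le> norm h \<longrightarrow> \<rho> \<le> norm h' \<longrightarrow>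
      norm (K h - K h') \<le> L * norm (h - h')"
    and K_moment: "integrable lebesgue (\<lambda>h. norm h * norm (K h))"
begin

definition Kt :: "real \<Rightarrow> 'a \<Rightarrow> 'a"
  where "Kt r h = indicator (- ball 0 r) h *\<^sub>R K h"

definition Kn :: "real \<Rightarrow> 'a \<Rightarrow> 'a"
  where "Kn r h = indicator (ball 0 r) h *\<^sub>R K h"

text \<open>The modulus of convergence of truncations: a field with Lipschitz constant
  \<open>L\<close> near a point has truncated integrals there within \<open>L * moment r\<close> of
  their limit.\<close>

definition moment :: "real \<Rightarrow> real"
  where "moment r = (LINT h|lebesgue. norm h * norm (Kn r h))"

lemma Kt_measurable [measurable]: "Kt r \<in> borel_measurable borel"
proof -
  have [measurable]: "- ball (0::'a) r \<in> sets borel" by simp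
  show ?thesis unfolding Kt_def[abs_def] by measurable
qed

lemma Kn_measurable [measurable]: "Kn r \<in> borel_measurable borel"
proof -
  have [measurable]: "ball (0::'a) r \<in> sets borel" by simp
  show ?thesis unfolding Kn_def[abs_def] by measurable
qed

lemma Kt_odd: "Kt r (- h) = - Kt r h"
  by (simp add: Kt_def K_odd indicator_def)

lemma Kt_minus: "Kt r (y - z) = - Kt r (z - y)"
  using Kt_odd[of r "z - y"] by simp

lemma Kt_support: "\<delta> \<le> norm h \<Longrightarrow> Kt r h = 0"
  by (simp add: Kt_def K_support)

lemma Kt_bounded:
  assumes "0 < r"
  obtains M where "0 < M" "\<And>h. norm (Kt r h) \<le> M"
proof -
  obtain M where M: "\<And>h. r \<le> norm h \<Longrightarrow> norm (K h) \<le> M" using K_bounded[OF assms] by blast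
  have "norm (Kt r h) \<le> max 1 M" for h
    using M[of h] by (auto simp: Kt_def indicator_def le_max_iff_disj)
  then show ?thesis using that[of "max 1 M"] by auto
qed

lemma Kt_shift_measurable: "(\<lambda>z. Kt r (y - z)) \<in> borel_measurable lebesgue"
  by (rule borel_measurable_lebesgue_compose[OF Kt_measurable])
     (intro borel_measurable_diff measurable_lebesgue_ident, simp)

lemma Kn_shift_measurable: "(\<lambda>z. Kn r (y - z)) \<in> borel_measurable lebesgue"
  by (rule borel_measurable_lebesgue_compose[OF Kn_measurable])
     (intro borel_measurable_diff measurable_lebesgue_ident, simp)

lemma Kt_integrable:
  assumes "0 < r"
  shows "integrable lebesgue (Kt r)"
proof -
  obtain M where M: "0 < M" "\<And>h. norm (Kt r h) \<le> M" using Kt_bounded[OF assms] by blast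
  show ?thesis
  proof (rule Bochner_Integration.integrable_bound)
    show "integrable lebesgue (\<lambda>h::'a. M * indicator (cball 0 \<delta>) h)"
      by (intro integrable_mult_right integrable_real_indicator) (use emeasure_lborel_cball_finite[of "0::'a" \<delta>] in auto)
    show "Kt r \<in> borel_measurable lebesgue" by (rule measurable_completion) simp
    show "AE h in lebesgue. norm (Kt r h) \<le> norm (M * indicator (cball 0 \<delta>) h)"
      using M Kt_support[of _ r] by (auto simp: indicator_def abs_le_iff intro!: AE_I2)
  qed
qed

lemma Kt_shift_integrable: "0 < r \<Longrightarrow> integrable lebesgue (\<lambda>z. Kt r (y - z))"
  by (rule integrable_lebesgue_reflect[OF Kt_integrable])

text \<open>Reflection turns the integral into its own negative. The sign of \<open>r\<close> does
  not matter, since a non-integrable function has integral 0 by convention.\<close>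

lemma Kt_integral_zero: "(LINT z|lebesgue. Kt r (y - z)) = 0"
proof -
  have m: "Kt r \<in> borel_measurable lebesgue" by (rule measurable_completion) simp
  have "(LINT z|lebesgue. Kt r z) = (LINT z|lebesgue. Kt r (0 - z))"
    by (rule integral_lebesgue_reflect[OF m, symmetric])
  also have "\<dots> = - (LINT z|lebesgue. Kt r z)" by (simp add: Kt_odd)
  finally have "2 *\<^sub>R (LINT z|lebesgue. Kt r z) = 0" unfolding scaleR_2 by (simp add: eq_neg_iff_add_eq_0)
  then have "(LINT z|lebesgue. Kt r z) = 0" by simp
  then show ?thesis using integral_lebesgue_reflect[OF m, of y] by simp
qed

lemma Kn_integrable_moment: "integrable lebesgue (\<lambda>h. norm h * norm (Kn r h))"
proof (rule Bochner_Integration.integrable_bound[OF K_moment])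
  show "(\<lambda>h. norm h * norm (Kn r h)) \<in> borel_measurable lebesgue"
    by (rule measurable_completion) measurable
qed (auto simp: Kn_def indicator_def)

lemma moment_shift: "(LINT z|lebesgue. norm (z - y) * norm (Kn r (y - z))) = moment r"
proof -
  have "(\<lambda>h. norm h * norm (Kn r h)) \<in> borel_measurable lebesgue"
    using Kn_integrable_moment by (rule borel_measurable_integrable)
  from integral_lebesgue_reflect[OF this, of y] show ?thesis
    by (simp add: moment_def norm_minus_commute)
qed

lemma moment_shift_integrable: "integrable lebesgue (\<lambda>z. norm (z - y) * norm (Kn r (y - z)))"
  using integrable_lebesgue_reflect[OF Kn_integrable_moment, of y r] by (simp add: norm_minus_commute)

lemma moment_nonneg: "0 \<le> moment r"
  unfolding moment_def by (rule integral_nonneg_AE) auto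

lemma moment_tendsto: "(moment \<longlongrightarrow> 0) (at_right 0)"
proof -
  let ?f = "\<lambda>h. norm h * norm (K h)"
  have f: "set_integrable lebesgue UNIV ?f" using K_moment by (simp add: set_integrable_def)
  have "moment r = (LINT h:UNIV|lebesgue. ?f h) - (LINT h:UNIV - ball 0 r|lebesgue. ?f h)" for r
  proof -
    have si: "set_integrable lebesgue A ?f" if "A \<in> sets lebesgue" for A
      using set_integrable_subset[OF f that] by simp
    have "(LINT h:ball 0 r \<union> (UNIV - ball 0 r)|lebesgue. ?f h)
        = (LINT h:ball 0 r|lebesgue. ?f h) + (LINT h:UNIV - ball 0 r|lebesgue. ?f h)"
      by (rule set_integral_Un) (auto intro!: si simp: lmeasurable_ball fmeasurableD)
    moreover have "ball (0::'a) r \<union> (UNIV - ball 0 r) = UNIV" by auto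
    moreover have "moment r = (LINT h:ball 0 r|lebesgue. ?f h)"
      unfolding moment_def set_lebesgue_integral_def
      by (intro Bochner_Integration.integral_cong) (auto simp: Kn_def indicator_def)
    ultimately show ?thesis by simp
  qed
  then have eq: "moment = (\<lambda>r. (LINT h:UNIV|lebesgue. ?f h) - (LINT h:UNIV - ball 0 r|lebesgue. ?f h))" by blast
  have "((\<lambda>r. LINT h:UNIV - ball 0 r|lebesgue. ?f h) \<longlongrightarrow> (LINT h:UNIV|lebesgue. ?f h)) (at_right 0)"
    by (rule set_integral_Diff_ball_tendsto[OF _ f]) simp
  from tendsto_diff[OF tendsto_const[of "LINT h:UNIV|lebesgue. ?f h"] this]
  show ?thesis unfolding eq by simp
qed

end

text \<open>Gradient and divergence are treated at once: \<open>pr\<close> is scalar multiplication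
  when the field is a scalar function and the inner product when it is a vector field. Constant 1 in
  \<open>norm_pr\<close> keeps the estimates free of extra factors.\<close>

locale kernel_product = odd_kernel K \<delta> + bounded_bilinear pr
  for K :: "'a::euclidean_space \<Rightarrow> 'a" and \<delta> :: real
    and pr :: "'b::euclidean_space \<Rightarrow> 'a \<Rightarrow> 'c::euclidean_space" +
  assumes norm_pr: "norm (pr b h) \<le> norm b * norm h"
begin

definition trunc :: "real \<Rightarrow> ('a \<Rightarrow> 'b) \<Rightarrow> 'a \<Rightarrow> 'c"
  where "trunc r f y = (LINT z|lebesgue. pr (f z) (Kt r (y - z)))"

text \<open>\<open>Lim\<close> is total, so the value means something only at points where
  convergence of the truncations is established separately.\<close>

definition tlim :: "('a \<Rightarrow> 'b) \<Rightarrow> 'a \<Rightarrow> 'c"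
  where "tlim f y = Lim (at_right 0) (\<lambda>r. trunc r f y)"

lemma pr_measurable:
  "f \<in> borel_measurable M \<Longrightarrow> g \<in> borel_measurable M \<Longrightarrow> (\<lambda>x. pr (f x) (g x)) \<in> borel_measurable M"
  by (rule borel_measurable_continuous_Pair) (auto intro!: continuous_on continuous_intros)

lemma integrable_pr_bounded:
  assumes f: "integrable M f" and g: "g \<in> borel_measurable M" and B: "\<And>x. norm (g x) \<le> B"
  shows "integrable M (\<lambda>x. pr (f x) (g x))"
proof (rule Bochner_Integration.integrable_bound)
  show "integrable M (\<lambda>x. B *\<^sub>R f x)" using f by (rule integrable_scaleR_right)
  show "(\<lambda>x. pr (f x) (g x)) \<in> borel_measurable M" using f g by (intro pr_measurable) auto
  have "norm (pr (f x) (g x)) \<le> norm (B *\<^sub>R f x)" for x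
  proof -
    have "norm (pr (f x) (g x)) \<le> norm (f x) * norm (g x)" by (rule norm_pr)
    also have "\<dots> \<le> norm (f x) * \<bar>B\<bar>" using B[of x] by (intro mult_left_mono) auto
    finally show ?thesis by (simp add: mult.commute)
  qed
  then show "AE x in M. norm (pr (f x) (g x)) \<le> norm (B *\<^sub>R f x)" by simp
qed

lemma trunc_local:
  assumes "\<And>z. norm (z - y) < \<delta> \<Longrightarrow> f z = g z"
  shows "trunc r f y = trunc r g y"
  unfolding trunc_def
proof (intro Bochner_Integration.integral_cong refl)
  fix z
  show "pr (f z) (Kt r (y - z)) = pr (g z) (Kt r (y - z))"
    using assms[of z] Kt_support[of "y - z" r]
    by (cases "norm (z - y) < \<delta>") (auto simp: zero_right norm_minus_commute)
qed

lemma trunc_integrable: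
  assumes f: "locally_integrable f" and r: "0 < r"
  shows "integrable lebesgue (\<lambda>z. pr (f z) (Kt r (y - z)))"
proof -
  obtain M where M: "\<And>h. norm (Kt r h) \<le> M" using Kt_bounded[OF r] by blast
  have "integrable lebesgue (\<lambda>z. indicator (cball y \<delta>) z *\<^sub>R f z)"
    using f unfolding locally_integrable_def set_integrable_def by simp
  then have "integrable lebesgue (\<lambda>z. pr (indicator (cball y \<delta>) z *\<^sub>R f z) (Kt r (y - z)))"
    using Kt_shift_measurable M by (rule integrable_pr_bounded)
  moreover have "pr (indicator (cball y \<delta>) z *\<^sub>R f z) (Kt r (y - z)) = pr (f z) (Kt r (y - z))" for z
    using Kt_support[of "y - z" r] by (auto simp: indicator_def dist_norm zero_right zero_left)
  ultimately show ?thesis by simp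
qed

lemma trunc_measurable:
  assumes "f \<in> borel_measurable lebesgue"
  shows "trunc r f \<in> borel_measurable lebesgue"
proof -
  interpret L: sigma_finite_measure "lebesgue :: 'a measure" by (rule sigma_finite_lebesgue)
  have id: "(\<lambda>z::'a. z) \<in> borel_measurable lebesgue" by (rule measurable_lebesgue_ident)
  have 1: "(\<lambda>p. fst p - snd p) \<in> borel_measurable (lebesgue \<Otimes>\<^sub>M (lebesgue :: 'a measure))"
    by (intro borel_measurable_diff measurable_compose[OF measurable_fst id] measurable_compose[OF measurable_snd id])
  have 2: "(\<lambda>p. Kt r (fst p - snd p)) \<in> borel_measurable (lebesgue \<Otimes>\<^sub>M (lebesgue :: 'a measure))"
    by (rule borel_measurable_lebesgue_compose[OF Kt_measurable 1])
  have 3: "(\<lambda>p. f (snd p)) \<in> borel_measurable (lebesgue \<Otimes>\<^sub>M (lebesgue :: 'a measure))"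
    by (rule measurable_compose[OF measurable_snd assms])
  have "(\<lambda>p. pr (f (snd p)) (Kt r (fst p - snd p))) \<in> borel_measurable (lebesgue \<Otimes>\<^sub>M (lebesgue :: 'a measure))"
    using 3 2 by (rule pr_measurable)
  then show ?thesis
    unfolding trunc_def[abs_def]
    by (intro L.borel_measurable_lebesgue_integral) (simp add: case_prod_beta')
qed

lemma trunc_bounded:
  assumes f: "integrable lebesgue f" and r: "0 < r"
  shows "\<exists>M. \<forall>y. norm (trunc r f y) \<le> M"
proof -
  obtain M where M: "\<And>h. norm (Kt r h) \<le> M" using Kt_bounded[OF r] by blast
  have "norm (trunc r f y) \<le> (LINT z|lebesgue. M * norm (f z))" for y
    unfolding trunc_def
  proof (rule Bochner_Integration.integral_norm_bound_integral)
    show "integrable lebesgue (\<lambda>z. pr (f z) (Kt r (y - z)))"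
      using f by (intro trunc_integrable r integrable_imp_locally_integrable)
    show "integrable lebesgue (\<lambda>z. M * norm (f z))" using f by simp
    fix z
    have "norm (pr (f z) (Kt r (y - z))) \<le> norm (f z) * norm (Kt r (y - z))" by (rule norm_pr)
    also have "\<dots> \<le> norm (f z) * M" using M by (intro mult_left_mono) auto
    finally show "norm (pr (f z) (Kt r (y - z))) \<le> M * norm (f z)" by (simp add: mult.commute)
  qed
  then show ?thesis by blast
qed

lemma trunc_bounded_on:
  assumes f: "locally_integrable f" and r: "0 < r" and A: "bounded A"
  shows "\<exists>M. \<forall>y\<in>A. norm (trunc r f y) \<le> M"
proof -
  obtain R where R: "\<And>y. y \<in> A \<Longrightarrow> norm y \<le> R" using A unfolding bounded_iff by blast
  let ?g = "\<lambda>z. indicator (cball 0 (R + \<delta>)) z *\<^sub>R f z"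
  have "integrable lebesgue ?g" using f unfolding locally_integrable_def set_integrable_def by simp
  then obtain M where "\<And>y. norm (trunc r ?g y) \<le> M" using trunc_bounded[OF _ r] by blast
  moreover have "trunc r ?g y = trunc r f y" if "y \<in> A" for y
  proof (rule trunc_local)
    fix z assume "norm (z - y) < \<delta>"
    then have "norm z \<le> R + \<delta>" using R[OF that] norm_triangle_ineq[of "z - y" y] by simp
    then show "indicator (cball 0 (R + \<delta>)) z *\<^sub>R f z = f z" by simp
  qed
  ultimately show ?thesis by metis
qed

lemma trunc_cong_AE:
  assumes "AE z in lebesgue. f z = g z" "f \<in> borel_measurable lebesgue" "g \<in> borel_measurable lebesgue"
  shows "trunc r f y = trunc r g y"
  unfolding trunc_def
proof (rule integral_cong_AE)
  show "AE z in lebesgue. pr (f z) (Kt r (y - z)) = pr (g z) (Kt r (y - z))"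
    using assms(1) by eventually_elim simp
qed (intro pr_measurable Kt_shift_measurable assms(2,3))+

lemma trunc_reflect:
  assumes "f \<in> borel_measurable lebesgue"
  shows "trunc r (\<lambda>z. f (x - z)) y = - trunc r f (x - y)"
proof -
  have m: "(\<lambda>z. pr (f z) (Kt r (y - (x - z)))) \<in> borel_measurable lebesgue"
  proof (intro pr_measurable assms)
    show "(\<lambda>z. Kt r (y - (x - z))) \<in> borel_measurable lebesgue"
      by (rule borel_measurable_lebesgue_compose[OF Kt_measurable])
         (intro borel_measurable_diff measurable_lebesgue_ident borel_measurable_const)
  qed
  have "trunc r (\<lambda>z. f (x - z)) y = (LINT z|lebesgue. pr (f z) (Kt r (y - (x - z))))"
    unfolding trunc_def using integral_lebesgue_reflect[OF m, of x] by simp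
  also have "\<dots> = (LINT z|lebesgue. - pr (f z) (Kt r ((x - y) - z)))"
  proof (intro Bochner_Integration.integral_cong refl)
    fix z
    have "Kt r (y - (x - z)) = - Kt r ((x - y) - z)"
      using Kt_odd[of r "(x - y) - z"] by (simp add: algebra_simps)
    then show "pr (f z) (Kt r (y - (x - z))) = - pr (f z) (Kt r ((x - y) - z))"
      by (simp add: minus_right)
  qed
  finally show ?thesis by (simp add: trunc_def)
qed

text \<open>On the support of \<open>Kn\<close> the difference of field values is at most
  \<open>L * norm (z - y)\<close>, so the translated moment function is a majorant.\<close>

lemma near_integrable:
  assumes f: "f \<in> borel_measurable lebesgue"
    and L: "\<And>z. norm (z - y) < \<rho> \<Longrightarrow> norm (f z - f y) \<le> L * norm (z - y)"
  shows "integrable lebesgue (\<lambda>z. pr (f z - f y) (Kn \<rho> (y - z)))"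
    and "norm (LINT z|lebesgue. pr (f z - f y) (Kn \<rho> (y - z))) \<le> L * moment \<rho>"
proof -
  have b: "norm (pr (f z - f y) (Kn \<rho> (y - z))) \<le> L * (norm (z - y) * norm (Kn \<rho> (y - z)))" for z
  proof (cases "norm (z - y) < \<rho>")
    case True
    have "norm (pr (f z - f y) (Kn \<rho> (y - z))) \<le> norm (f z - f y) * norm (Kn \<rho> (y - z))" by (rule norm_pr)
    also have "\<dots> \<le> (L * norm (z - y)) * norm (Kn \<rho> (y - z))" using L[OF True] by (intro mult_right_mono) auto
    finally show ?thesis by (simp add: mult.assoc)
  next
    case False
    then have "Kn \<rho> (y - z) = 0" by (auto simp: Kn_def indicator_def norm_minus_commute)
    then show ?thesis by (simp add: zero_right)
  qed
  have i: "integrable lebesgue (\<lambda>z. L * (norm (z - y) * norm (Kn \<rho> (y - z))))"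
    using moment_shift_integrable by (rule integrable_mult_right)
  show i': "integrable lebesgue (\<lambda>z. pr (f z - f y) (Kn \<rho> (y - z)))"
  proof (rule Bochner_Integration.integrable_bound[OF i])
    show "(\<lambda>z. pr (f z - f y) (Kn \<rho> (y - z))) \<in> borel_measurable lebesgue"
      by (intro pr_measurable Kn_shift_measurable borel_measurable_diff f borel_measurable_const)
    show "AE z in lebesgue. norm (pr (f z - f y) (Kn \<rho> (y - z)))
        \<le> norm (L * (norm (z - y) * norm (Kn \<rho> (y - z))))"
      using b by (intro AE_I2 order_trans[OF b]) auto
  qed
  have "norm (LINT z|lebesgue. pr (f z - f y) (Kn \<rho> (y - z)))
      \<le> (LINT z|lebesgue. L * (norm (z - y) * norm (Kn \<rho> (y - z))))"
    using i' i b by (rule Bochner_Integration.integral_norm_bound_integral)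
  also have "\<dots> = L * moment \<rho>" by (simp add: moment_shift)
  finally show "norm (LINT z|lebesgue. pr (f z - f y) (Kn \<rho> (y - z))) \<le> L * moment \<rho>" .
qed

text \<open>Oddness of \<open>K\<close> allows subtracting \<open>f y\<close>, which makes the integral absolutely convergent.\<close>

lemma trunc_limit:
  assumes f: "locally_integrable f" and \<rho>: "0 < r" "r \<le> \<rho>"
    and L: "\<And>z. norm (z - y) < \<rho> \<Longrightarrow> norm (f z - f y) \<le> L * norm (z - y)"
  shows "norm (trunc r f y - (trunc \<rho> f y + (LINT z|lebesgue. pr (f z - f y) (Kn \<rho> (y - z)))))
    \<le> L * moment r"
proof -
  have m: "f \<in> borel_measurable lebesgue" using f by (rule locally_integrable_measurable)
  have Lr: "norm (f z - f y) \<le> L * norm (z - y)" if "norm (z - y) < r" for z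
    using L that \<rho> by simp
  note near = near_integrable[OF m L]
  note nearr = near_integrable[OF m Lr]
  have "0 < \<rho>" using \<rho> by simp
  have i: "integrable lebesgue (\<lambda>z. pr (f z) (Kt r (y - z)))"
    "integrable lebesgue (\<lambda>z. pr (f z) (Kt \<rho> (y - z)))"
    using f \<rho> \<open>0 < \<rho>\<close> by (auto intro: trunc_integrable)
  have k: "integrable lebesgue (\<lambda>z. pr (f y) (Kt r (y - z)))"
      "integrable lebesgue (\<lambda>z. pr (f y) (Kt \<rho> (y - z)))"
    using \<rho> \<open>0 < \<rho>\<close> by (auto intro!: integrable_bounded_linear[OF bounded_linear_right] Kt_shift_integrable)
  have k0: "(LINT z|lebesgue. pr (f y) (Kt s (y - z))) = 0" if "0 < s" for s
    using integral_bounded_linear[OF bounded_linear_right Kt_shift_integrable[OF that]] 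
    by (simp add: Kt_integral_zero zero_right)
  \<comment> \<open>Writing \<open>Kt s = K - Kn s\<close>, all terms with the untruncated kernel
    cancel. What remains is the part of the absolutely convergent integral that lies within distance
    \<open>r\<close> of \<open>y\<close>.\<close>
  have pt: "pr (f z) (Kt r (y - z)) - pr (f z) (Kt \<rho> (y - z)) - pr (f z - f y) (Kn \<rho> (y - z))
      - (pr (f y) (Kt r (y - z)) - pr (f y) (Kt \<rho> (y - z))) = - pr (f z - f y) (Kn r (y - z))" for z
  proof -
    have "Kt s (y - z) = K (y - z) - Kn s (y - z)" for s
      by (auto simp: Kt_def Kn_def indicator_def)
    then show ?thesis by (simp add: diff_left diff_right)
  qed
  have "trunc r f y - (trunc \<rho> f y + (LINT z|lebesgue. pr (f z - f y) (Kn \<rho> (y - z))))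
    = (LINT z|lebesgue. pr (f z) (Kt r (y - z)) - pr (f z) (Kt \<rho> (y - z)) - pr (f z - f y) (Kn \<rho> (y - z))
      - (pr (f y) (Kt r (y - z)) - pr (f y) (Kt \<rho> (y - z))))"
    using i k near(1) k0[OF \<rho>(1)] k0[OF \<open>0 < \<rho>\<close>] by (simp add: trunc_def)
  also have "\<dots> = - (LINT z|lebesgue. pr (f z - f y) (Kn r (y - z)))"
    unfolding pt by simp
  finally show ?thesis using nearr(2) by simp
qed

lemma
  assumes f: "locally_integrable f" and \<rho>: "0 < \<rho>"
    and L: "\<And>z. norm (z - y) < \<rho> \<Longrightarrow> norm (f z - f y) \<le> L * norm (z - y)"
  shows trunc_tendsto: "((\<lambda>r. trunc r f y) \<longlongrightarrow> tlim f y) (at_right 0)"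
    and tlim_eq: "tlim f y = trunc \<rho> f y + (LINT z|lebesgue. pr (f z - f y) (Kn \<rho> (y - z)))"
    and trunc_tlim_bound: "0 < r \<Longrightarrow> r \<le> \<rho> \<Longrightarrow> norm (trunc r f y - tlim f y) \<le> L * moment r"
proof -
  let ?l = "trunc \<rho> f y + (LINT z|lebesgue. pr (f z - f y) (Kn \<rho> (y - z)))"
  have lim: "((\<lambda>r. trunc r f y) \<longlongrightarrow> ?l) (at_right 0)"
  proof (rule LIM_zero_cancel, rule Lim_null_comparison)
    show "((\<lambda>r. L * moment r) \<longlongrightarrow> 0) (at_right 0)"
      by (rule tendsto_mult_right_zero[OF moment_tendsto])
    show "\<forall>\<^sub>F r in at_right 0. norm (trunc r f y - ?l) \<le> L * moment r"
      unfolding eventually_at_right_field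
      using trunc_limit[OF f _ _ L] \<rho> by (auto intro!: exI[of _ \<rho>])
  qed
  show eq: "tlim f y = ?l" unfolding tlim_def by (rule tendsto_Lim[OF _ lim]) simp
  show "((\<lambda>r. trunc r f y) \<longlongrightarrow> tlim f y) (at_right 0)" unfolding eq by (rule lim)
  show "norm (trunc r f y - tlim f y) \<le> L * moment r" if "0 < r" "r \<le> \<rho>"
    unfolding eq using f that L by (rule trunc_limit)
qed

text \<open>With \<open>\<rho> = \<delta>\<close> in \<open>tlim_eq\<close> the far part vanishes
  and the near kernel is all of \<open>K\<close>, so for globally Lipschitz fields the limit is one
  absolutely convergent integral.\<close>

lemma trunc_delta: "trunc \<delta> f y = 0"
proof -
  have "Kt \<delta> h = 0" for h using K_support[of h] by (cases "norm h < \<delta>") (auto simp: Kt_def not_less)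
  then show ?thesis by (simp add: trunc_def zero_right)
qed

lemma Kn_delta: "Kn \<delta> = K"
proof
  show "Kn \<delta> h = K h" for h using K_support[of h] by (cases "norm h < \<delta>") (auto simp: Kn_def not_less)
qed

end

section \<open>Regularity of the limits of truncated integrals\<close>

text \<open>The mean value inequality applies to the increment of \<open>q\<close> in direction
  \<open>k\<close>, whose derivative is of size \<open>norm k\<close> because the partial
  derivatives of \<open>q\<close> are Lipschitz. The bound is bilinear on purpose: the factor
  \<open>norm h\<close> is absorbed by the moment of the kernel, the factor \<open>norm k\<close> is
  kept for differentiating.\<close>

lemma second_difference_bound:
  fixes q :: "'a::euclidean_space \<Rightarrow> 'b::real_normed_vector"
  assumes "test_function q"
  obtains C where "0 < C"
    "\<And>y h k. norm ((q (y + k - h) - q (y + k)) - (q (y - h) - q y)) \<le> C * norm h * norm k"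
proof -
  have "\<exists>L>0. \<forall>x y. norm (partial_deriv b q x - partial_deriv b q y) \<le> L * norm (x - y)" if "b \<in> Basis" for b
    using test_function_Lipschitz[OF test_function_partial_deriv[OF assms that]] by metis
  then obtain L where L: "\<And>b. b \<in> Basis \<Longrightarrow> 0 < L b"
    "\<And>b x y. b \<in> Basis \<Longrightarrow> norm (partial_deriv b q x - partial_deriv b q y) \<le> L b * norm (x - y)"
    by metis
  let ?C = "\<Sum>b\<in>Basis. L b"
  have "norm ((q (y + k - h) - q (y + k)) - (q (y - h) - q y)) \<le> ?C * norm h * norm k" for y h k
  proof -
    let ?p = "\<lambda>x. q (x + k) - q x"
    have "norm (?p (y - h) - ?p y) \<le> (?C * norm k) * norm ((y - h) - y)"
    proof (rule differentiable_bound[of UNIV])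
      fix x
      have dq: "(q has_derivative (\<lambda>v. \<Sum>b\<in>Basis. (v \<bullet> b) *\<^sub>R partial_deriv b q z)) (at z)" for z
        using assms smooth_on_imp_differentiable_at unfolding test_function_iff
        by (intro has_derivative_partials) auto
      have "((\<lambda>x. q (x + k)) has_derivative (\<lambda>v. \<Sum>b\<in>Basis. (v \<bullet> b) *\<^sub>R partial_deriv b q (x + k))) (at x)"
        by (rule has_derivative_compose[OF _ dq]) (auto intro!: derivative_eq_intros)
      from has_derivative_diff[OF this dq]
      show "(?p has_derivative (\<lambda>v. (\<Sum>b\<in>Basis. (v \<bullet> b) *\<^sub>R partial_deriv b q (x + k))
          - (\<Sum>b\<in>Basis. (v \<bullet> b) *\<^sub>R partial_deriv b q x))) (at x within UNIV)" by simp
      show "onorm (\<lambda>v. (\<Sum>b\<in>Basis. (v \<bullet> b) *\<^sub>R partial_deriv b q (x + k))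
          - (\<Sum>b\<in>Basis. (v \<bullet> b) *\<^sub>R partial_deriv b q x)) \<le> ?C * norm k"
      proof (rule onorm_le)
        fix v :: 'a
        have "(\<Sum>b\<in>Basis. (v \<bullet> b) *\<^sub>R partial_deriv b q (x + k)) - (\<Sum>b\<in>Basis. (v \<bullet> b) *\<^sub>R partial_deriv b q x)
          = (\<Sum>b\<in>Basis. (v \<bullet> b) *\<^sub>R (partial_deriv b q (x + k) - partial_deriv b q x))"
          by (simp add: sum_subtractf scaleR_diff_right)
        also have "norm \<dots> \<le> (\<Sum>b\<in>Basis. norm v * (L b * norm k))"
        proof (rule sum_norm_le)
          fix b :: 'a assume b: "b \<in> Basis"
          show "norm ((v \<bullet> b) *\<^sub>R (partial_deriv b q (x + k) - partial_deriv b q x)) \<le> norm v * (L b * norm k)"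
            unfolding norm_scaleR using L(2)[OF b, of "x + k" x] Basis_le_norm[OF b, of v]
            by (intro mult_mono) auto
        qed
        finally show "norm ((\<Sum>b\<in>Basis. (v \<bullet> b) *\<^sub>R partial_deriv b q (x + k))
            - (\<Sum>b\<in>Basis. (v \<bullet> b) *\<^sub>R partial_deriv b q x)) \<le> ?C * norm k * norm v"
          by (simp add: sum_distrib_left sum_distrib_right mult_ac)
      qed
    qed auto
    moreover have eq: "(q (y + k - h) - q (y + k)) - (q (y - h) - q y) = ?p (y - h) - ?p y"
      by (simp add: algebra_simps)
    ultimately show ?thesis unfolding eq by (simp add: mult_ac)
  qed
  moreover have "0 < ?C" using L(1) by (intro sum_pos) auto
  ultimately show ?thesis using that by blast
qed

lemma has_derivative_quadratic:
  fixes F :: "'a::real_normed_vector \<Rightarrow> 'b::real_normed_vector"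
  assumes "bounded_linear D" and C: "\<And>k. norm (F (y + k) - F y - D k) \<le> C * (norm k)\<^sup>2"
  shows "(F has_derivative D) (at y)"
  unfolding has_derivative_at
proof (intro conjI assms(1))
  have "norm (norm (F (y + k) - F y - D k) / norm k) \<le> C * norm k" if "k \<noteq> 0" for k
  proof -
    have "0 < norm k" using that by simp
    moreover have "norm (F (y + k) - F y - D k) \<le> C * norm k * norm k"
      using C[of k] unfolding power2_eq_square mult.assoc .
    ultimately have "norm (F (y + k) - F y - D k) / norm k \<le> C * norm k" by (rule mult_imp_div_pos_le)
    then show ?thesis by simp
  qed
  then have "\<forall>\<^sub>F k in at 0. norm (norm (F (y + k) - F y - D k) / norm k) \<le> C * norm k"
    by (auto simp: eventually_at_filter)
  moreover have "((\<lambda>k::'a. C * norm k) \<longlongrightarrow> 0) (at 0)"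
    by (intro tendsto_mult_right_zero tendsto_norm_zero tendsto_ident_at)
  ultimately show "(\<lambda>k. norm (F (y + k) - F y - D k) / norm k) \<midarrow>0\<rightarrow> 0"
    by (rule Lim_null_comparison)
qed

lemma test_function_locally_integrable:
  fixes f :: "'a::euclidean_space \<Rightarrow> 'b::euclidean_space"
  shows "test_function f \<Longrightarrow> locally_integrable f"
  by (rule locally_integrable_continuous[OF test_function_continuous])

definition Lipschitz_away :: "'a::euclidean_space \<Rightarrow> ('a \<Rightarrow> 'b::real_normed_vector) \<Rightarrow> bool"
  where "Lipschitz_away x f \<longleftrightarrow> (\<forall>\<rho>>0. \<forall>R. \<exists>L. \<forall>y z. \<rho> \<le> norm (y - x) \<longrightarrow> norm y \<le> R \<longrightarrow>
    \<rho> \<le> norm (z - x) \<longrightarrow> norm z \<le> R \<longrightarrow> norm (f y - f z) \<le> L * norm (y - z))"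

lemma Lipschitz_awayD:
  assumes "Lipschitz_away x f" "0 < \<rho>"
  obtains L where "0 \<le> L" "\<And>y z. \<rho> \<le> norm (y - x) \<Longrightarrow> norm y \<le> R \<Longrightarrow>
    \<rho> \<le> norm (z - x) \<Longrightarrow> norm z \<le> R \<Longrightarrow> norm (f y - f z) \<le> L * norm (y - z)"
proof -
  obtain L where L: "\<And>y z. \<rho> \<le> norm (y - x) \<Longrightarrow> norm y \<le> R \<Longrightarrow>
    \<rho> \<le> norm (z - x) \<Longrightarrow> norm z \<le> R \<Longrightarrow> norm (f y - f z) \<le> L * norm (y - z)"
    using assms unfolding Lipschitz_away_def by meson
  have "norm (f y - f z) \<le> \<bar>L\<bar> * norm (y - z)" if "\<rho> \<le> norm (y - x)" "norm y \<le> R"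
    "\<rho> \<le> norm (z - x)" "norm z \<le> R" for y z
    using L[OF that] by (rule order_trans) (intro mult_right_mono, auto)
  then show ?thesis using that[of "\<bar>L\<bar>"] by auto
qed

lemma test_function_Lipschitz_away: 
  assumes "test_function f"
  shows "Lipschitz_away x f"
proof -
  obtain L where "\<And>x y. norm (f x - f y) \<le> L * norm (x - y)"
    by (rule test_function_Lipschitz[OF assms]) blast
  then show ?thesis unfolding Lipschitz_away_def by (intro allI impI exI[of _ L])
qed

lemma center_bump:
  fixes x :: "'a::euclidean_space"
  assumes "plateau \<eta> \<sigma> \<tau>" "0 < \<rho>"
  obtains a :: "'a \<Rightarrow> real" and t where "test_function a" "0 < t" "\<And>y. norm (y - x) \<le> t \<Longrightarrow> a y = 1"
    "\<And>y. \<rho> \<le> norm (y - x) \<Longrightarrow> a y = 0"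
proof -
  obtain \<kappa> where \<kappa>: "1 < \<kappa>" and bump: "\<And>(x::'a) \<rho>. 0 < \<rho> \<Longrightarrow> \<exists>\<phi> :: 'a \<Rightarrow> real. test_function \<phi> \<and>
    (\<forall>y. norm (y - x) \<le> \<rho> \<longrightarrow> \<phi> y = 1) \<and> (\<forall>y. \<kappa> * \<rho> < norm (y - x) \<longrightarrow> \<phi> y = 0)"
    using bump_exists[OF assms(1)] by blast
  \<comment> \<open>The factor 2 places the support within \<open>\<kappa> * t = \<rho> / 2\<close>,
    strictly below \<rho>, so that \<open>a\<close> is already 0 at distance exactly \<rho>.\<close>
  define t where "t = \<rho> / (2 * \<kappa>)"
  have t: "0 < t" "\<kappa> * t < \<rho>" using \<kappa> assms(2) by (auto simp: t_def)
  obtain a :: "'a \<Rightarrow> real" where a: "test_function a" "\<And>y. norm (y - x) \<le> t \<Longrightarrow> a y = 1"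
    "\<And>y. \<kappa> * t < norm (y - x) \<Longrightarrow> a y = 0" using bump[OF t(1), of x] by blast
  have "a y = 0" if "\<rho> \<le> norm (y - x)" for y using a(3)[of y] that t(2) by simp
  then show ?thesis using that[of a t] a(1,2) t(1) by blast
qed

text \<open>A wide bump around the origin times one minus a small bump around \<open>x\<close>. The
  maximum with 1 in the proof provides a positive radius for every \<open>R\<close>.\<close>

lemma annulus_cutoff:
  fixes x :: "'a::euclidean_space"
  assumes "plateau \<eta> \<sigma> \<tau>" "0 < \<rho>"
  obtains \<xi> :: "'a \<Rightarrow> real" and t where "test_function \<xi>" "0 < t"
    "\<And>y. norm (y - x) \<le> t \<Longrightarrow> \<xi> y = 0" "\<And>y. \<rho> \<le> norm (y - x) \<Longrightarrow> norm y \<le> R \<Longrightarrow> \<xi> y = 1"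
proof -
  obtain a :: "'a \<Rightarrow> real" and t where a: "test_function a" and t: "0 < t"
    and a1: "\<And>y. norm (y - x) \<le> t \<Longrightarrow> a y = 1" and a0: "\<And>y. \<rho> \<le> norm (y - x) \<Longrightarrow> a y = 0"
    by (rule center_bump[OF assms]) blast
  have "0 < max 1 R" by simp
  then obtain b :: "'a \<Rightarrow> real" where b: "test_function b" "\<And>y. norm (y - 0) \<le> max 1 R \<Longrightarrow> b y = 1"
    using bump_exists[OF assms(1), where 'a = 'a] by metis
  define \<xi> where "\<xi> y = b y * (1 + (- 1) * a y)" for y
  have "smooth_on UNIV (\<lambda>y. 1 + (- 1) * a y)"
    using a unfolding test_function_iff by (intro smooth_on_add smooth_on_mult smooth_on_const) auto
  then have "test_function \<xi>"
    unfolding \<xi>_def[abs_def] using b(1) test_function_scaleR_left[of b "\<lambda>y. 1 + (- 1) * a y"] by simp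
  moreover have "\<xi> y = 0" if "norm (y - x) \<le> t" for y using a1[OF that] by (simp add: \<xi>_def)
  moreover have "\<xi> y = 1" if "\<rho> \<le> norm (y - x)" "norm y \<le> R" for y
    using a0[of y] b(2)[of y] that by (simp add: \<xi>_def)
  ultimately show ?thesis using that t by blast
qed

text \<open>Multiplication by the annulus cut-off makes the function vanish identically near
  \<open>x\<close>, whatever \<open>f\<close> does there. Smoothness on the punctured space and on a
  ball around \<open>x\<close> then gives smoothness everywhere.\<close>

lemma smooth_away_cutoff:
  fixes f :: "'a::euclidean_space \<Rightarrow> 'b::real_normed_vector"
  assumes "plateau \<eta> \<sigma> \<tau>" "smooth_on (- {x}) f" "0 < \<rho>"
  obtains g where "test_function g" "\<And>y. \<rho> \<le> norm (y - x) \<Longrightarrow> norm y \<le> R \<Longrightarrow> f y = g y"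
proof -
  obtain \<xi> :: "'a \<Rightarrow> real" and t where \<xi>: "test_function \<xi>" "0 < t"
    "\<And>y. norm (y - x) \<le> t \<Longrightarrow> \<xi> y = 0" "\<And>y. \<rho> \<le> norm (y - x) \<Longrightarrow> norm y \<le> R \<Longrightarrow> \<xi> y = 1"
    by (rule annulus_cutoff[OF assms(1,3)]) blast
  have "smooth_on (- {x} \<union> ball x t) (\<lambda>y. \<xi> y *\<^sub>R f y)"
  proof (rule smooth_on_Un)
    show "smooth_on (- {x}) (\<lambda>y. \<xi> y *\<^sub>R f y)"
      using \<xi>(1) assms(2) smooth_on_subset[of UNIV \<xi> "- {x}"] unfolding test_function_iff
      by (intro smooth_on_scaleR) auto
    show "smooth_on (ball x t) (\<lambda>y. \<xi> y *\<^sub>R f y)"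
    proof (rule smooth_on_cong)
      show "smooth_on (ball x t) (\<lambda>_. 0 :: 'b)" by (rule smooth_on_const) simp
      show "0 = \<xi> y *\<^sub>R f y" if "y \<in> ball x t" for y
        using \<xi>(3)[of y] that by (simp add: dist_norm norm_minus_commute)
    qed simp
  qed auto
  moreover have "- {x} \<union> ball x t = UNIV" using \<xi>(2) by auto
  moreover have "bounded {y. \<xi> y *\<^sub>R f y \<noteq> 0}"
    using \<xi>(1) unfolding test_function_iff by (auto elim: bounded_subset)
  ultimately have "test_function (\<lambda>y. \<xi> y *\<^sub>R f y)" by (simp add: test_function_iff)
  then show ?thesis using that \<xi>(4) by simp
qed

lemma smooth_Lipschitz_away:
  fixes f :: "'a::euclidean_space \<Rightarrow> 'b::real_normed_vector"
  assumes "plateau \<eta> \<sigma> \<tau>" "smooth_on (- {x}) f"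
  shows "Lipschitz_away x f"
  unfolding Lipschitz_away_def
proof (intro allI impI)
  fix \<rho> R :: real assume "0 < \<rho>"
  then obtain g where g: "test_function g" "\<And>y. \<rho> \<le> norm (y - x) \<Longrightarrow> norm y \<le> R \<Longrightarrow> f y = g y"
    using smooth_away_cutoff[OF assms] by metis
  obtain L where "\<And>y z. norm (g y - g z) \<le> L * norm (y - z)"
    by (rule test_function_Lipschitz[OF g(1)]) blast
  then show "\<exists>L. \<forall>y z. \<rho> \<le> norm (y - x) \<longrightarrow> norm y \<le> R \<longrightarrow>
      \<rho> \<le> norm (z - x) \<longrightarrow> norm z \<le> R \<longrightarrow> norm (f y - f z) \<le> L * norm (y - z)"
    using g(2) by (intro exI[of _ L]) auto
qed

context kernel_product
begin

lemma test_trunc_tendsto: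
  assumes "test_function f"
  shows "((\<lambda>r. trunc r f y) \<longlongrightarrow> tlim f y) (at_right 0)"
proof -
  obtain L where L: "\<And>x y. norm (f x - f y) \<le> L * norm (x - y)"
    by (rule test_function_Lipschitz[OF assms]) blast
  show ?thesis
    by (rule trunc_tendsto[OF test_function_locally_integrable[OF assms] delta_pos L])
qed

lemma test_trunc_bound:
  assumes "test_function f"
  obtains L where "\<And>r y. 0 < r \<Longrightarrow> r \<le> \<delta> \<Longrightarrow> norm (trunc r f y - tlim f y) \<le> L * moment r"
proof -
  obtain L where L: "\<And>x y. norm (f x - f y) \<le> L * norm (x - y)"
    by (rule test_function_Lipschitz[OF assms]) blast
  show ?thesis
    by (rule that[of L])
       (rule trunc_tlim_bound[OF test_function_locally_integrable[OF assms] delta_pos L])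
qed

lemma integral_near_shift:
  assumes f: "f \<in> borel_measurable lebesgue"
  shows "(LINT z|lebesgue. pr (f z - f y) (K (y - z))) = (LINT h|lebesgue. pr (f (y - h) - f y) (K h))"
proof -
  have "(\<lambda>z. pr (f z - f y) (K (y - z))) \<in> borel_measurable lebesgue"
    using Kn_shift_measurable[of \<delta> y] unfolding Kn_delta
    by (intro pr_measurable borel_measurable_diff f borel_measurable_const)
  from integral_lebesgue_reflect[OF this, of y] show ?thesis by simp
qed

text \<open>A global Lipschitz constant permits \<open>\<rho> = \<delta>\<close>. In the variable
  \<open>h\<close> the kernel is fixed and only the field is translated with \<open>y\<close>, which
  is the form in which the integral can be differentiated.\<close>

lemma test_tlim_eq:
  assumes "test_function f"
  shows "integrable lebesgue (\<lambda>h. pr (f (y - h) - f y) (K h))"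
    and "tlim f y = (LINT h|lebesgue. pr (f (y - h) - f y) (K h))"
proof -
  obtain L where L: "0 < L" "\<And>x y. norm (f x - f y) \<le> L * norm (x - y)"
    using test_function_Lipschitz[OF assms] by blast
  note li = test_function_locally_integrable[OF assms]
  note m = locally_integrable_measurable[OF li]
  show "tlim f y = (LINT h|lebesgue. pr (f (y - h) - f y) (K h))"
    using tlim_eq[OF li delta_pos L(2)] integral_near_shift[OF m]
    by (simp add: trunc_delta Kn_delta)
  have "integrable lebesgue (\<lambda>z. pr (f z - f y) (Kn \<delta> (y - z)))"
    using near_integrable(1)[OF m L(2)] .
  from integrable_lebesgue_reflect[OF this, of y]
  show "integrable lebesgue (\<lambda>h. pr (f (y - h) - f y) (K h))" by (simp add: Kn_delta)
qed

text \<open>Differentiation under the singular integral. The first-order Taylor remainder, in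
  \<open>k\<close>, of the difference \<open>f (y - h) - f y\<close> is at most a constant times
  \<open>norm h * (norm k)\<^sup>2\<close>; integrated against \<open>K\<close> it stays finite by
  the moment condition and leaves a remainder quadratic in \<open>k\<close>.\<close>

lemma test_tlim_has_derivative:
  assumes f: "test_function f"
  shows "(tlim f has_derivative (\<lambda>k. \<Sum>b\<in>Basis. (k \<bullet> b) *\<^sub>R tlim (partial_deriv b f) y)) (at y)"
proof -
  note pd = test_function_partial_deriv[OF f]
  have "\<exists>C>0. \<forall>y h k. norm ((partial_deriv b f (y + k - h) - partial_deriv b f (y + k))
      - (partial_deriv b f (y - h) - partial_deriv b f y)) \<le> C * norm h * norm k" if "b \<in> Basis" for b
    using second_difference_bound[OF pd[OF that]] by metis
  then obtain C where C: "\<And>b. b \<in> Basis \<Longrightarrow> 0 < C b" "\<And>b y h k. b \<in> Basis \<Longrightarrow>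
      norm ((partial_deriv b f (y + k - h) - partial_deriv b f (y + k))
      - (partial_deriv b f (y - h) - partial_deriv b f y)) \<le> C b * norm h * norm k" by metis
  let ?C = "\<Sum>b\<in>Basis. C b"
  have C0: "0 \<le> ?C" using C(1) by (intro sum_nonneg) (auto simp: less_imp_le)
  let ?D = "\<lambda>k. \<Sum>b\<in>Basis. (k \<bullet> b) *\<^sub>R tlim (partial_deriv b f) y"
  let ?\<Delta> = "\<lambda>k h. (f (y + k - h) - f (y + k)) - (f (y - h) - f y)
      - (\<Sum>b\<in>Basis. (k \<bullet> b) *\<^sub>R (partial_deriv b f (y - h) - partial_deriv b f y))"
  have \<Delta>: "norm (?\<Delta> k h) \<le> norm k * (?C * norm h * norm k)" for k h
  proof -
    let ?g = "\<lambda>x. f (x - h) - f x"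
    let ?g' = "\<lambda>x v. \<Sum>b\<in>Basis. (v \<bullet> b) *\<^sub>R (partial_deriv b f (x - h) - partial_deriv b f x)"
    have dg: "(?g has_derivative ?g' x) (at x within S)" for x S
    proof -
      have df: "(f has_derivative (\<lambda>v. \<Sum>b\<in>Basis. (v \<bullet> b) *\<^sub>R partial_deriv b f z)) (at z)" for z
        using f smooth_on_imp_differentiable_at unfolding test_function_iff
        by (intro has_derivative_partials) auto
      have "((\<lambda>x. f (x - h)) has_derivative (\<lambda>v. \<Sum>b\<in>Basis. (v \<bullet> b) *\<^sub>R partial_deriv b f (x - h))) (at x)"
        by (rule has_derivative_compose[OF _ df]) (auto intro!: derivative_eq_intros)
      from has_derivative_at_withinI[OF has_derivative_diff[OF this df]]
      show ?thesis by (simp add: sum_subtractf scaleR_diff_right)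
    qed
    \<comment> \<open>The error of linearising \<open>?g\<close> on the segment from
      \<open>y\<close> to \<open>y + k\<close> is \<open>norm k\<close> times the oscillation of its
      derivative over \<open>cball y (norm k)\<close>, and that oscillation is a second difference
      of partial derivatives of \<open>f\<close>.\<close>
    have "norm (?g (y + k) - ?g y - ?g' y (y + k - y)) \<le> norm (y + k - y) * (?C * norm h * norm k)"
    proof (rule differentiable_bound_linearization)
      show "y + t *\<^sub>R (y + k - y) \<in> cball y (norm k)" if "t \<in> {0..1}" for t
        using that by (auto simp: dist_norm mult_left_le_one_le)
      show "(?g has_derivative ?g' x) (at x within cball y (norm k))" if "x \<in> cball y (norm k)" for x
        by (rule dg)
      show "onorm (?g' x - ?g' y) \<le> ?C * norm h * norm k" if x: "x \<in> cball y (norm k)" for x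
      proof (rule onorm_le)
        fix v :: 'a
        have eq: "(?g' x - ?g' y) v = (\<Sum>b\<in>Basis. (v \<bullet> b) *\<^sub>R
          ((partial_deriv b f (y + (x - y) - h) - partial_deriv b f (y + (x - y)))
            - (partial_deriv b f (y - h) - partial_deriv b f y)))"
          by (simp add: sum_subtractf scaleR_diff_right fun_diff_def)
        have "norm ((?g' x - ?g' y) v) \<le> (\<Sum>b\<in>Basis. norm v * (C b * norm h * norm k))"
          unfolding eq
        proof (rule sum_norm_le)
          fix b :: 'a assume b: "b \<in> Basis"
          have "norm ((partial_deriv b f (y + (x - y) - h) - partial_deriv b f (y + (x - y)))
            - (partial_deriv b f (y - h) - partial_deriv b f y)) \<le> C b * norm h * norm (x - y)"
            by (rule C(2)[OF b])
          also have "\<dots> \<le> C b * norm h * norm k"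
            using x C(1)[OF b] by (intro mult_left_mono) (auto simp: dist_norm norm_minus_commute)
          finally show "norm ((v \<bullet> b) *\<^sub>R
              ((partial_deriv b f (y + (x - y) - h) - partial_deriv b f (y + (x - y)))
              - (partial_deriv b f (y - h) - partial_deriv b f y))) \<le> norm v * (C b * norm h * norm k)"
            unfolding norm_scaleR using Basis_le_norm[OF b, of v] by (intro mult_mono) auto
        qed
        also have "\<dots> = ?C * norm h * norm k * norm v"
          by (simp add: sum_distrib_left sum_distrib_right mult_ac)
        finally show "norm ((?g' x - ?g' y) v) \<le> ?C * norm h * norm k * norm v" .
      qed
    qed simp
    then show ?thesis by simp
  qed
  show ?thesis
  proof (rule has_derivative_quadratic)
    show "bounded_linear ?D"
      by (auto intro!: bounded_linear_sum bounded_linear_scaleR_const bounded_linear_inner_left)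
    fix k
    note i = test_tlim_eq(1)[OF f] test_tlim_eq(1)[OF pd]
    have ib: "integrable lebesgue (\<lambda>h. \<Sum>b\<in>Basis. (k \<bullet> b) *\<^sub>R pr (partial_deriv b f (y - h) - partial_deriv b f y) (K h))"
      using i(2) by (intro Bochner_Integration.integrable_sum integrable_scaleR_right) auto
    have pt: "pr (?\<Delta> k h) (K h) = pr (f (y + k - h) - f (y + k)) (K h) - pr (f (y - h) - f y) (K h)
        - (\<Sum>b\<in>Basis. (k \<bullet> b) *\<^sub>R pr (partial_deriv b f (y - h) - partial_deriv b f y) (K h))" for h
      by (simp add: diff_left sum_left scaleR_left)
    have "?D k = (LINT h|lebesgue. (\<Sum>b\<in>Basis. (k \<bullet> b) *\<^sub>R pr (partial_deriv b f (y - h) - partial_deriv b f y) (K h)))"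
      using i(2) by (subst Bochner_Integration.integral_sum) (auto simp: test_tlim_eq(2)[OF pd])
    then have eq: "tlim f (y + k) - tlim f y - ?D k = (LINT h|lebesgue. pr (?\<Delta> k h) (K h))"
      unfolding pt test_tlim_eq(2)[OF f]
      using i(1)[of "y + k"] i(1)[of y] ib by (simp del: Bochner_Integration.integral_sum)
    have "norm (tlim f (y + k) - tlim f y - ?D k)
        \<le> (LINT h|lebesgue. (?C * (norm k)\<^sup>2) * (norm h * norm (K h)))"
      unfolding eq
    proof (rule Bochner_Integration.integral_norm_bound_integral)
      show "integrable lebesgue (\<lambda>h. pr (?\<Delta> k h) (K h))"
        unfolding pt using i(1)[of "y + k"] i(1)[of y] ib by (intro Bochner_Integration.integrable_diff)
      show "integrable lebesgue (\<lambda>h. (?C * (norm k)\<^sup>2) * (norm h * norm (K h)))"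
        using K_moment by (rule integrable_mult_right)
      fix h
      have "norm (pr (?\<Delta> k h) (K h)) \<le> norm (?\<Delta> k h) * norm (K h)" by (rule norm_pr)
      also have "\<dots> \<le> norm k * (?C * norm h * norm k) * norm (K h)"
        using \<Delta> by (rule mult_right_mono) simp
      finally show "norm (pr (?\<Delta> k h) (K h)) \<le> (?C * (norm k)\<^sup>2) * (norm h * norm (K h))"
        by (simp add: power2_eq_square mult_ac)
    qed
    also have "\<dots> = (?C * (norm k)\<^sup>2) * (LINT h|lebesgue. norm h * norm (K h))"
      by (rule integral_mult_right_zero)
    also have "\<dots> = (?C * (LINT h|lebesgue. norm h * norm (K h))) * (norm k)\<^sup>2" by (simp only: mult_ac)
    finally show "norm (tlim f (y + k) - tlim f y - ?D k)
        \<le> (?C * (LINT h|lebesgue. norm h * norm (K h))) * (norm k)\<^sup>2" .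
  qed
qed

lemma trunc_support:
  assumes "\<And>x. R \<le> norm x \<Longrightarrow> f x = 0" "R + \<delta> \<le> norm y"
  shows "trunc r f y = 0"
proof -
  have "trunc r f y = trunc r (\<lambda>_. 0) y"
  proof (rule trunc_local)
    fix z assume "norm (z - y) < \<delta>"
    then show "f z = 0" using assms norm_triangle_ineq[of "y - z" z] by (simp add: norm_minus_commute)
  qed
  then show ?thesis by (simp add: trunc_def zero_left)
qed

lemma test_tlim_support:
  assumes "test_function f" "\<And>x. R \<le> norm x \<Longrightarrow> f x = 0" "R + \<delta> \<le> norm y"
  shows "tlim f y = 0"
proof -
  have "trunc r f y = 0" for r using assms(2,3) by (rule trunc_support)
  then show ?thesis unfolding tlim_def by (intro tendsto_Lim) auto
qed

text \<open>Partial derivatives commute with \<open>tlim\<close>, so the functions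
  \<open>tlim f\<close> with \<open>f\<close> a test function form an invariant class for the
  coinduction. The support grows by at most \<delta>.\<close>

lemma test_function_tlim:
  assumes f: "test_function f"
  shows "test_function (tlim f)"
proof -
  obtain R where R: "0 < R" "\<And>x. R \<le> norm x \<Longrightarrow> f x = 0" using test_function_support[OF f] by blast
  have "bounded {y. tlim f y \<noteq> 0}"
    by (rule bounded_supportI[OF test_tlim_support[OF f R(2)]])
  moreover have "smooth_on UNIV (tlim f)"
  proof (rule smooth_on_coinduct[where P = "\<lambda>g. \<exists>f. test_function f \<and> g = tlim f"])
    fix g :: "'a \<Rightarrow> 'c"
    assume "\<exists>f. test_function f \<and> g = tlim f"
    then obtain f where f: "test_function f" and g: "g = tlim f" by blast
    note d = test_tlim_has_derivative[OF f]
    have "partial_deriv b g y = tlim (partial_deriv b f) y" if "b \<in> Basis" for b y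
      unfolding g partial_deriv_eq[OF d] using that
      by (simp add: inner_Basis if_distrib[of "\<lambda>t. t *\<^sub>R _"] cong: if_cong)
    moreover have "g differentiable_on UNIV"
      unfolding g differentiable_on_eq_differentiable_at[OF open_UNIV] using d differentiableI by blast
    ultimately show "g differentiable_on UNIV \<and> (\<forall>b\<in>Basis. \<exists>h. (\<exists>f. test_function f \<and> h = tlim f) \<and>
        (\<forall>y\<in>UNIV. partial_deriv b g y = h y))"
      using test_function_partial_deriv[OF f] by blast
  qed (use f in auto)
  ultimately show ?thesis by (simp add: test_function_iff)
qed

lemma test_tlim_reflect:
  assumes f: "test_function f"
  shows "tlim (\<lambda>z. f (x - z)) y = - tlim f (x - y)"
proof -
  have m: "f \<in> borel_measurable lebesgue"
    using f by (intro locally_integrable_measurable test_function_locally_integrable)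
  have "((\<lambda>r. trunc r f (x - y)) \<longlongrightarrow> tlim f (x - y)) (at_right 0)"
    by (rule test_trunc_tendsto[OF f])
  then have "((\<lambda>r. trunc r (\<lambda>z. f (x - z)) y) \<longlongrightarrow> - tlim f (x - y)) (at_right 0)"
    unfolding trunc_reflect[OF m] by (rule tendsto_minus)
  then show ?thesis unfolding tlim_def[of "\<lambda>z. f (x - z)"] by (intro tendsto_Lim) auto
qed

text \<open>The truncations and their limit vanish outside one common ball and converge uniformly,
  so the weight \<open>g\<close> may be any locally integrable function. This is what allows a
  singular factor once the truncation sits on a test function.\<close>

lemma integral_test_tendsto:
  assumes f: "test_function f" and g: "locally_integrable g"
  shows "integrable lebesgue (\<lambda>y. g y \<bullet> tlim f y)"
    and "((\<lambda>r. LINT y|lebesgue. g y \<bullet> trunc r f y) \<longlongrightarrow> (LINT y|lebesgue. g y \<bullet> tlim f y)) (at_right 0)"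
proof -
  obtain R where R: "0 < R" "\<And>x. R \<le> norm x \<Longrightarrow> f x = 0" using test_function_support[OF f] by blast
  let ?A = "cball (0::'a) (R + \<delta>)"
  obtain L where L: "\<And>r y. 0 < r \<Longrightarrow> r \<le> \<delta> \<Longrightarrow> norm (trunc r f y - tlim f y) \<le> L * moment r"
    by (rule test_trunc_bound[OF f]) blast
  note li = test_function_locally_integrable[OF f]
  have A: "?A \<in> sets lebesgue" "bounded ?A" by auto
  have out: "trunc r f y = 0" "tlim f y = 0" if "y \<notin> ?A" for r y
    using that by (auto intro!: trunc_support[OF R(2)] test_tlim_support[OF f R(2)])
  have eq: "indicator ?A y *\<^sub>R (g y \<bullet> trunc r f y) = g y \<bullet> trunc r f y"
    "indicator ?A y *\<^sub>R (g y \<bullet> tlim f y) = g y \<bullet> tlim f y" for r y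
    by (cases "y \<in> ?A"; simp add: out del: mem_cball mem_cball_0)+
  note * = tendsto_integral_inner_uniform[of ?A g "\<lambda>r. trunc r f" \<delta> "\<lambda>r. L * moment r" "tlim f"]
  have "set_integrable lebesgue ?A (\<lambda>y. g y \<bullet> tlim f y) \<and>
    ((\<lambda>r. LINT y:?A|lebesgue. g y \<bullet> trunc r f y) \<longlongrightarrow> (LINT y:?A|lebesgue. g y \<bullet> tlim f y)) (at_right 0)"
    using A L delta_pos set_integrable_locally[OF g A(2,1)]
      trunc_measurable[OF locally_integrable_measurable[OF li]] trunc_bounded_on[OF li _ A(2)]
      tendsto_mult_right_zero[OF moment_tendsto, of L]
    by (intro conjI *(2,3)) auto
  then show "integrable lebesgue (\<lambda>y. g y \<bullet> tlim f y)"
    and "((\<lambda>r. LINT y|lebesgue. g y \<bullet> trunc r f y) \<longlongrightarrow> (LINT y|lebesgue. g y \<bullet> tlim f y)) (at_right 0)"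
    unfolding set_integrable_def set_lebesgue_integral_def eq by auto
qed

lemma Lipschitz_away_trunc:
  assumes f: "locally_integrable f" and lip: "Lipschitz_away x f" and "0 < \<rho>"
  obtains L where "0 \<le> L" "\<And>y r. \<rho> \<le> norm (y - x) \<Longrightarrow> norm y \<le> R \<Longrightarrow> 0 < r \<Longrightarrow> r \<le> \<rho> / 2 \<Longrightarrow>
      norm (trunc r f y - tlim f y) \<le> L * moment r"
    "\<And>y z. \<rho> \<le> norm (y - x) \<Longrightarrow> norm y \<le> R \<Longrightarrow> norm (z - y) < \<rho> / 2 \<Longrightarrow>
      norm (f z - f y) \<le> L * norm (z - y)"
proof -
  \<comment> \<open>The distance is halved and the radius enlarged so that the region contains the
    ball of radius \<open>\<rho> / 2\<close> around every point \<open>y\<close> considered.\<close>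
  obtain L where L: "0 \<le> L" "\<And>y z. \<rho> / 2 \<le> norm (y - x) \<Longrightarrow> norm y \<le> R + \<rho> \<Longrightarrow>
    \<rho> / 2 \<le> norm (z - x) \<Longrightarrow> norm z \<le> R + \<rho> \<Longrightarrow> norm (f y - f z) \<le> L * norm (y - z)"
    using Lipschitz_awayD[OF lip, of "\<rho> / 2" "R + \<rho>"] \<open>0 < \<rho>\<close> by auto
  have near: "norm (f z - f y) \<le> L * norm (z - y)"
    if "\<rho> \<le> norm (y - x)" "norm y \<le> R" "norm (z - y) < \<rho> / 2" for y z
  proof (rule L(2))
    have "y - x = (y - z) + (z - x)" by simp
    then show "\<rho> / 2 \<le> norm (z - x)"
      using that norm_triangle_ineq[of "y - z" "z - x"] by (simp add: norm_minus_commute)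
    show "norm z \<le> R + \<rho>" using that norm_triangle_ineq[of "z - y" y] \<open>0 < \<rho>\<close> by simp
  qed (use that \<open>0 < \<rho>\<close> in auto)
  have "0 < \<rho> / 2" using \<open>0 < \<rho>\<close> by simp
  show ?thesis
    by (rule that[OF L(1)])
       (auto intro!: trunc_tlim_bound[OF f \<open>0 < \<rho> / 2\<close>] near)
qed

text \<open>The counterpart of \<open>integral_test_tendsto\<close>: the truncation sits on a field
  that may be singular at \<open>x\<close>, and the outer integration keeps a positive distance from
  \<open>x\<close>.\<close>

lemma integral_away_tendsto:
  assumes f: "locally_integrable f" and lip: "Lipschitz_away x f"
    and A: "bounded A" "A \<in> sets lebesgue" and "0 < \<rho>" and away: "\<And>y. y \<in> A \<Longrightarrow> \<rho> \<le> norm (y - x)"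
    and g: "set_integrable lebesgue A g"
  shows "set_integrable lebesgue A (\<lambda>y. g y \<bullet> tlim f y)"
    and "0 < r \<Longrightarrow> set_integrable lebesgue A (\<lambda>y. g y \<bullet> trunc r f y)"
    and "((\<lambda>r. LINT y:A|lebesgue. g y \<bullet> trunc r f y) \<longlongrightarrow> (LINT y:A|lebesgue. g y \<bullet> tlim f y)) (at_right 0)"
proof -
  obtain R where R: "\<And>y. y \<in> A \<Longrightarrow> norm y \<le> R" using A(1) unfolding bounded_iff by blast
  obtain L where L: "\<And>y r. \<rho> \<le> norm (y - x) \<Longrightarrow> norm y \<le> R \<Longrightarrow> 0 < r \<Longrightarrow> r \<le> \<rho> / 2 \<Longrightarrow>
      norm (trunc r f y - tlim f y) \<le> L * moment r"
    using Lipschitz_away_trunc[OF f lip \<open>0 < \<rho>\<close>, of R] by metis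
  note * = tendsto_integral_inner_uniform[of A g "\<lambda>r. trunc r f" "\<rho> / 2" "\<lambda>r. L * moment r" "tlim f"]
  show "set_integrable lebesgue A (\<lambda>y. g y \<bullet> tlim f y)"
    and "0 < r \<Longrightarrow> set_integrable lebesgue A (\<lambda>y. g y \<bullet> trunc r f y)"
    and "((\<lambda>r. LINT y:A|lebesgue. g y \<bullet> trunc r f y) \<longlongrightarrow> (LINT y:A|lebesgue. g y \<bullet> tlim f y)) (at_right 0)"
    using A g L R away \<open>0 < \<rho>\<close> trunc_measurable[OF locally_integrable_measurable[OF f]]
      trunc_bounded_on[OF f _ A(1)] tendsto_mult_right_zero[OF moment_tendsto, of L]
    by (auto intro!: *)
qed

text \<open>The field vanishes within distance \<rho> of each point of \<open>Y\<close>, so only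
  kernel values outside the ball of radius \<rho> enter. The regularity comes from the kernel, and
  of \<open>f\<close> only its integral over a large ball is used.\<close>

lemma far_trunc_Lipschitz:
  assumes f: "locally_integrable f" and Y: "bounded Y" and "0 < \<rho>"
    and far: "\<And>y z. y \<in> Y \<Longrightarrow> norm (z - y) < \<rho> \<Longrightarrow> f z = 0"
  obtains L where "0 \<le> L" "\<And>y y'. y \<in> Y \<Longrightarrow> y' \<in> Y \<Longrightarrow>
    norm (trunc \<rho> f y - trunc \<rho> f y') \<le> L * norm (y - y')"
proof -
  obtain R where R: "\<And>y. y \<in> Y \<Longrightarrow> norm y \<le> R" using Y unfolding bounded_iff by blast
  obtain M where M: "\<And>h h'. \<rho> \<le> norm h \<Longrightarrow> \<rho> \<le> norm h' \<Longrightarrow> norm (K h - K h') \<le> M * norm (h - h')"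
    using K_Lipschitz[OF \<open>0 < \<rho>\<close>] by blast
  let ?B = "cball (0::'a) (R + \<delta>)"
  have fi: "integrable lebesgue (\<lambda>z. norm (indicator ?B z *\<^sub>R f z))"
    using f unfolding locally_integrable_def set_integrable_def by (intro integrable_norm) simp
  let ?I = "LINT z|lebesgue. norm (indicator ?B z *\<^sub>R f z)"
  have "norm (trunc \<rho> f y - trunc \<rho> f y') \<le> (\<bar>M\<bar> * ?I) * norm (y - y')" if y: "y \<in> Y" "y' \<in> Y" for y y'
  proof -
    have i: "integrable lebesgue (\<lambda>z. pr (f z) (Kt \<rho> (u - z)))" for u
      using f \<open>0 < \<rho>\<close> by (rule trunc_integrable)
    have "trunc \<rho> f y - trunc \<rho> f y' = (LINT z|lebesgue. pr (f z) (Kt \<rho> (y - z)) - pr (f z) (Kt \<rho> (y' - z)))"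
      unfolding trunc_def using i by simp
    also have "norm \<dots> \<le> (LINT z|lebesgue. (\<bar>M\<bar> * norm (y - y')) * norm (indicator ?B z *\<^sub>R f z))"
    proof (rule Bochner_Integration.integral_norm_bound_integral)
      show "integrable lebesgue (\<lambda>z. pr (f z) (Kt \<rho> (y - z)) - pr (f z) (Kt \<rho> (y' - z)))" using i by simp
      show "integrable lebesgue (\<lambda>z. (\<bar>M\<bar> * norm (y - y')) * norm (indicator ?B z *\<^sub>R f z))"
        using fi by (rule integrable_mult_right)
      fix z
      show "norm (pr (f z) (Kt \<rho> (y - z)) - pr (f z) (Kt \<rho> (y' - z)))
          \<le> (\<bar>M\<bar> * norm (y - y')) * norm (indicator ?B z *\<^sub>R f z)"
      proof (cases "f z = 0 \<or> z \<notin> ?B")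
        case True
        have "Kt \<rho> (u - z) = 0" if "z \<notin> ?B" "u \<in> Y" for u
        proof -
          have "\<delta> \<le> norm (u - z)" using that R[OF that(2)] norm_triangle_ineq[of "z - u" u]
            by (simp add: norm_minus_commute)
          then show ?thesis by (rule Kt_support)
        qed
        then show ?thesis using True y by (auto simp: zero_left zero_right)
      next
        case False
        then have d: "\<rho> \<le> norm (y - z)" "\<rho> \<le> norm (y' - z)"
          using far[OF y(1), of z] far[OF y(2), of z] by (auto simp: norm_minus_commute not_less[symmetric])
        then have kt: "Kt \<rho> (y - z) - Kt \<rho> (y' - z) = K (y - z) - K (y' - z)"
          by (simp add: Kt_def indicator_def)
        have "norm (pr (f z) (Kt \<rho> (y - z)) - pr (f z) (Kt \<rho> (y' - z))) = norm (pr (f z) (K (y - z) - K (y' - z)))"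
          by (simp add: diff_right[symmetric] kt)
        also have "\<dots> \<le> norm (f z) * norm (K (y - z) - K (y' - z))" by (rule norm_pr)
        also have "\<dots> \<le> norm (f z) * (\<bar>M\<bar> * norm (y - y'))"
        proof (rule mult_left_mono)
          have "norm (K (y - z) - K (y' - z)) \<le> M * norm (y - y')" using M[OF d] by simp
          also have "\<dots> \<le> \<bar>M\<bar> * norm (y - y')" by (intro mult_right_mono) auto
          finally show "norm (K (y - z) - K (y' - z)) \<le> \<bar>M\<bar> * norm (y - y')" .
        qed simp
        finally show ?thesis using False by (simp add: mult.commute)
      qed
    qed
    also have "\<dots> = (\<bar>M\<bar> * norm (y - y')) * ?I" by (rule integral_mult_right_zero)
    also have "\<dots> = (\<bar>M\<bar> * ?I) * norm (y - y')" by (simp only: mult_ac)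
    finally show ?thesis .
  qed
  moreover have "0 \<le> \<bar>M\<bar> * ?I" by (intro mult_nonneg_nonneg integral_nonneg_AE) auto
  ultimately show ?thesis using that by blast
qed

text \<open>In a region off \<open>x\<close> the field is a test function \<open>g\<close> plus a
  rest \<open>f2\<close> that vanishes near each point of the region. The limit for \<open>g\<close>
  is a test function, hence Lipschitz; for \<open>f2\<close> the truncation is eventually constant
  in \<open>r\<close> and inherits its regularity from the kernel, in spite of the singularity of
  \<open>f\<close> at \<open>x\<close>.\<close>

lemma tlim_Lipschitz_away:
  assumes \<eta>: "plateau \<eta> \<sigma> \<tau>" and f: "locally_integrable f" and smooth: "smooth_on (- {x}) f"
  shows "Lipschitz_away x (tlim f)"
  unfolding Lipschitz_away_def
proof (intro allI impI)
  fix \<rho> R :: real assume \<rho>: "0 < \<rho>"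
  let ?Y = "{y. \<rho> \<le> norm (y - x) \<and> norm y \<le> R}"
  have Y: "bounded ?Y" by (rule boundedI[of _ R]) auto
  obtain g where g: "test_function g"
    "\<And>y. \<rho> / 2 \<le> norm (y - x) \<Longrightarrow> norm y \<le> R + \<rho> \<Longrightarrow> f y = g y"
    using smooth_away_cutoff[OF \<eta> smooth, of "\<rho> / 2" "R + \<rho>"] \<rho> by auto
  define f2 where "f2 z = f z - g z" for z
  have gi: "locally_integrable g" using g(1) by (rule test_function_locally_integrable)
  have f2i: "locally_integrable f2"
    using f gi unfolding locally_integrable_def f2_def[abs_def] by (auto intro: set_integral_diff)
  have "0 < \<rho> / 2" using \<rho> by simp
  have far: "f2 z = 0" if "y \<in> ?Y" "norm (z - y) < \<rho> / 2" for y z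
  proof -
    have "\<rho> / 2 \<le> norm (z - x)"
      using that norm_triangle_ineq[of "y - z" "z - x"] by (simp add: norm_minus_commute)
    moreover have "norm z \<le> R + \<rho>" using that norm_triangle_ineq[of "z - y" y] \<rho> by simp
    ultimately show ?thesis using g(2) by (simp add: f2_def)
  qed
  obtain L where L: "\<And>y y'. y \<in> ?Y \<Longrightarrow> y' \<in> ?Y \<Longrightarrow>
      norm (trunc (\<rho> / 2) f2 y - trunc (\<rho> / 2) f2 y') \<le> L * norm (y - y')"
    by (rule far_trunc_Lipschitz[OF f2i Y \<open>0 < \<rho> / 2\<close>]) (use far in blast)+
  obtain M where M: "\<And>y y'. norm (tlim g y - tlim g y') \<le> M * norm (y - y')"
    by (rule test_function_Lipschitz[OF test_function_tlim[OF g(1)]]) blast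
  have eq: "tlim f y = tlim g y + trunc (\<rho> / 2) f2 y" if y: "y \<in> ?Y" for y
  proof -
    have split: "trunc r f y = trunc r g y + trunc (\<rho> / 2) f2 y" if r: "0 < r" "r \<le> \<rho> / 2" for r
    proof -
      have "trunc r f y = (LINT z|lebesgue. pr (g z) (Kt r (y - z)) + pr (f2 z) (Kt r (y - z)))"
        unfolding trunc_def by (simp add: f2_def add_left[symmetric])
      also have "\<dots> = trunc r g y + trunc r f2 y"
        unfolding trunc_def using trunc_integrable[OF gi r(1)] trunc_integrable[OF f2i r(1)] by simp
      \<comment> \<open>Lowering the radius from \<open>\<rho> / 2\<close> to \<open>r\<close> only
        adds points at which \<open>f2\<close> is 0.\<close>
      also have "trunc r f2 y = trunc (\<rho> / 2) f2 y"
        unfolding trunc_def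
      proof (intro Bochner_Integration.integral_cong refl)
        fix z
        show "pr (f2 z) (Kt r (y - z)) = pr (f2 z) (Kt (\<rho> / 2) (y - z))"
        proof (cases "norm (z - y) < \<rho> / 2")
          case True
          then show ?thesis using far[OF y] by (simp add: zero_left)
        next
          case False
          then show ?thesis using r by (simp add: Kt_def indicator_def norm_minus_commute)
        qed
      qed
      finally show ?thesis .
    qed
    have "((\<lambda>r. trunc r g y) \<longlongrightarrow> tlim g y) (at_right 0)" by (rule test_trunc_tendsto[OF g(1)])
    then have "((\<lambda>r. trunc r g y + trunc (\<rho> / 2) f2 y) \<longlongrightarrow> tlim g y + trunc (\<rho> / 2) f2 y) (at_right 0)"
      by (intro tendsto_add tendsto_const)
    moreover have "\<forall>\<^sub>F r in at_right 0. trunc r g y + trunc (\<rho> / 2) f2 y = trunc r f y"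
      unfolding eventually_at_right_field using split \<open>0 < \<rho> / 2\<close> by (auto intro!: exI[of _ "\<rho> / 2"])
    ultimately have "((\<lambda>r. trunc r f y) \<longlongrightarrow> tlim g y + trunc (\<rho> / 2) f2 y) (at_right 0)"
      using tendsto_cong by fast
    then show ?thesis unfolding tlim_def[of f] by (intro tendsto_Lim) auto
  qed
  have "norm (tlim f y - tlim f z) \<le> (M + L) * norm (y - z)" if "y \<in> ?Y" "z \<in> ?Y" for y z
  proof -
    have "tlim f y - tlim f z = (tlim g y - tlim g z) + (trunc (\<rho> / 2) f2 y - trunc (\<rho> / 2) f2 z)"
      by (simp add: eq[OF that(1)] eq[OF that(2)])
    then have "norm (tlim f y - tlim f z) \<le> M * norm (y - z) + L * norm (y - z)"
      using norm_triangle_mono[OF M L[OF that]] by simp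
    then show ?thesis by (simp add: distrib_right)
  qed
  then show "\<exists>L. \<forall>y z. \<rho> \<le> norm (y - x) \<longrightarrow> norm y \<le> R \<longrightarrow> \<rho> \<le> norm (z - x) \<longrightarrow> norm z \<le> R \<longrightarrow>
      norm (tlim f y - tlim f z) \<le> L * norm (y - z)" by auto
qed

end

text \<open>The fundamental lemma for functions that may fail to be integrable at \<open>x\<close>.
  A cut-off \<open>\<xi>\<close> vanishing near \<open>x\<close> makes \<open>\<xi> y * h y\<close>
  integrable, and \<open>\<xi>\<close> times any test function is again admissible. Countably many
  cut-offs exhaust the complement of the null set \<open>{x}\<close>.\<close>

lemma AE_zero_away:
  fixes h :: "'a::euclidean_space \<Rightarrow> real"
  assumes \<eta>: "plateau \<eta> \<sigma> \<tau>"
    and int: "\<And>\<xi> t. test_function \<xi> \<Longrightarrow> 0 < t \<Longrightarrow> (\<And>y. norm (y - x) \<le> t \<Longrightarrow> \<xi> y = 0) \<Longrightarrow>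
      integrable lebesgue (\<lambda>y. \<xi> y * h y)"
    and zero: "\<And>\<xi> t. test_function \<xi> \<Longrightarrow> 0 < t \<Longrightarrow> (\<And>y. norm (y - x) \<le> t \<Longrightarrow> \<xi> y = 0) \<Longrightarrow>
      (LINT y|lebesgue. \<xi> y * h y) = 0"
  shows "AE y in lebesgue. h y = 0"
proof -
  have "AE y in lebesgue. inverse (real (Suc n)) \<le> norm (y - x) \<longrightarrow> norm y \<le> real n \<longrightarrow> h y = 0" for n
  proof -
    have "0 < inverse (real (Suc n))" by simp
    then obtain \<xi> :: "'a \<Rightarrow> real" and t where \<xi>: "test_function \<xi>" "0 < t"
      "\<And>y. norm (y - x) \<le> t \<Longrightarrow> \<xi> y = 0"
      "\<And>y. inverse (real (Suc n)) \<le> norm (y - x) \<Longrightarrow> norm y \<le> real n \<Longrightarrow> \<xi> y = 1"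
      by (rule annulus_cutoff[OF \<eta>]) blast
    have "AE y in lebesgue. \<xi> y * h y = 0"
    proof (rule AE_zero_of_test_functions[OF \<eta>])
      show "integrable lebesgue (\<lambda>y. \<xi> y * h y)" by (rule int[OF \<xi>(1-3)])
      fix \<phi> :: "'a \<Rightarrow> real" assume "test_function \<phi>"
      then have "test_function (\<lambda>y. \<xi> y * \<phi> y)"
        using \<xi>(1) unfolding test_function_iff[of \<xi>] by (intro test_function_mult) auto
      then have "(LINT y|lebesgue. (\<xi> y * \<phi> y) * h y) = 0"
        by (rule zero[OF _ \<xi>(2)]) (simp add: \<xi>(3))
      then show "(LINT y|lebesgue. \<phi> y * (\<xi> y * h y)) = 0" by (simp add: mult_ac)
    qed
    then show ?thesis by eventually_elim (use \<xi>(4) in force)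
  qed
  then have "AE y in lebesgue. \<forall>n. inverse (real (Suc n)) \<le> norm (y - x) \<longrightarrow> norm y \<le> real n \<longrightarrow> h y = 0"
    by (simp add: AE_all_countable)
  moreover have "AE y in lebesgue. y \<noteq> x"
    using AE_not_in[of "{x}" lebesgue] by (simp add: null_sets_completionI finite_imp_null_set_lborel)
  ultimately show ?thesis
  proof eventually_elim
    case (elim y)
    obtain m where m: "inverse (real (Suc m)) < norm (y - x)"
      using reals_Archimedean[of "norm (y - x)"] elim(2) by auto
    obtain k where k: "norm y \<le> real k" using real_arch_simple by blast
    \<comment> \<open>One index controls both the distance from \<open>x\<close> and the norm, so it
      is taken as the larger of the two indices found.\<close>
    have "inverse (real (Suc (max m k))) \<le> inverse (real (Suc m))" by (intro le_imp_inverse_le) auto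
    then have "inverse (real (Suc (max m k))) \<le> norm (y - x)" using m by linarith
    moreover have "norm y \<le> real (max m k)" using k by simp
    ultimately have "inverse (real (Suc (max m k))) \<le> norm (y - x)" "norm y \<le> real (max m k)" by auto
    then show ?case using elim(1)[rule_format, of "max m k"] by blast
  qed
qed

section \<open>Duality between truncated gradients and divergences\<close>

context odd_kernel
begin

sublocale S: kernel_product K \<delta> "(*\<^sub>R) :: real \<Rightarrow> 'a \<Rightarrow> 'a"
  by unfold_locales (auto simp: scaleR_add_left scaleR_add_right intro!: exI[of _ 1])

sublocale V: kernel_product K \<delta> "(\<bullet>) :: 'a \<Rightarrow> 'a \<Rightarrow> real"
  by unfold_locales (auto simp: inner_add_left inner_add_right Cauchy_Schwarz_ineq2 intro!: exI[of _ 1])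

text \<open>At fixed \<open>r\<close> the kernel is bounded, so the double integral converges
  absolutely. Exchanging the roles of \<open>y\<close> and \<open>z\<close> reverses the argument of
  the odd kernel, which accounts for the minus sign.\<close>

lemma fubini_trunc:
  fixes a :: "'a \<Rightarrow> real" and b :: "'a \<Rightarrow> 'a"
  assumes a: "integrable lebesgue a" and b: "integrable lebesgue b" and r: "0 < r"
  shows "(LINT y|lebesgue. a y * V.trunc r b y) = - (LINT z|lebesgue. b z \<bullet> S.trunc r a z)"
proof -
  interpret L: sigma_finite_measure "lebesgue :: 'a measure" by (rule sigma_finite_lebesgue)
  interpret P: pair_sigma_finite "lebesgue :: 'a measure" "lebesgue :: 'a measure" ..
  obtain M where M: "0 < M" "\<And>h. norm (Kt r h) \<le> M" using Kt_bounded[OF r] by blast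
  let ?P = "(lebesgue :: 'a measure) \<Otimes>\<^sub>M (lebesgue :: 'a measure)"
  let ?F = "\<lambda>p. a (fst p) * (b (snd p) \<bullet> Kt r (fst p - snd p))"
  have id: "(\<lambda>z::'a. z) \<in> borel_measurable lebesgue" by (rule measurable_lebesgue_ident)
  have "(\<lambda>p. fst p - snd p) \<in> borel_measurable ?P"
    by (intro borel_measurable_diff measurable_compose[OF measurable_fst id] measurable_compose[OF measurable_snd id])
  then have k: "(\<lambda>p. Kt r (fst p - snd p)) \<in> borel_measurable ?P"
    by (rule borel_measurable_lebesgue_compose[OF Kt_measurable])
  have am: "a \<in> borel_measurable lebesgue" and bm: "b \<in> borel_measurable lebesgue" using a b by auto
  have F: "?F \<in> borel_measurable ?P"
    by (intro borel_measurable_times borel_measurable_inner k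
        measurable_compose[OF measurable_fst am] measurable_compose[OF measurable_snd bm])
  have bl: "locally_integrable b" "locally_integrable a"
    using a b by (auto intro: integrable_imp_locally_integrable)
  have int: "integrable ?P ?F"
  proof (rule P.Fubini_integrable[OF F])
    have bnd: "norm (b z \<bullet> Kt r (y - z)) \<le> M * norm (b z)" for y z
    proof -
      have "norm (b z \<bullet> Kt r (y - z)) \<le> norm (b z) * norm (Kt r (y - z))" by (rule V.norm_pr)
      also have "\<dots> \<le> norm (b z) * M" using M by (intro mult_left_mono) auto
      finally show ?thesis by (simp add: mult.commute)
    qed
    show "AE y in lebesgue. integrable lebesgue (\<lambda>z. ?F (y, z))"
      using V.trunc_integrable[OF bl(1) r] by auto
    have "(\<lambda>y. LINT z|lebesgue. norm (?F (y, z))) \<in> borel_measurable lebesgue"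
      using measurable_compose[OF F borel_measurable_norm] by (intro L.borel_measurable_lebesgue_integral) (simp add: case_prod_beta')
    moreover have "norm (LINT z|lebesgue. norm (?F (y, z))) \<le> norm ((M * (LINT z|lebesgue. norm (b z))) * a y)" for y
    proof -
      have "(LINT z|lebesgue. norm (?F (y, z))) \<le> (LINT z|lebesgue. norm (a y) * (M * norm (b z)))"
      proof (rule integral_mono)
        show "integrable lebesgue (\<lambda>z. norm (?F (y, z)))"
          using V.trunc_integrable[OF bl(1) r] by (intro integrable_norm) auto
        show "integrable lebesgue (\<lambda>z. norm (a y) * (M * norm (b z)))" using b by auto
        show "norm (?F (y, z)) \<le> norm (a y) * (M * norm (b z))" for z
          using bnd[of z y] by (simp only: fst_conv snd_conv norm_mult) (intro mult_left_mono, auto)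
      qed
      then show ?thesis using M(1) by (simp add: abs_mult mult_ac)
    qed
    ultimately show "integrable lebesgue (\<lambda>y. LINT z|lebesgue. norm (?F (y, z)))"
      by (intro Bochner_Integration.integrable_bound[OF integrable_mult_right[OF a, of "M * (LINT z|lebesgue. norm (b z))"]] AE_I2)
  qed
  have "(LINT y|lebesgue. a y * V.trunc r b y) = (LINT y|lebesgue. LINT z|lebesgue. ?F (y, z))"
    unfolding V.trunc_def fst_conv snd_conv integral_mult_right_zero ..
  also have "\<dots> = (LINT z|lebesgue. LINT y|lebesgue. ?F (y, z))"
    using P.Fubini_integral[of "\<lambda>y z. ?F (y, z)"] int by (simp add: case_prod_beta')
  also have "\<dots> = (LINT z|lebesgue. - (b z \<bullet> S.trunc r a z))"
  proof (intro Bochner_Integration.integral_cong refl)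
    fix z
    have "(LINT y|lebesgue. ?F (y, z)) = (LINT y|lebesgue. - (b z \<bullet> (a y *\<^sub>R Kt r (z - y))))"
      unfolding fst_conv snd_conv Kt_minus[of r _ z] inner_minus_right inner_scaleR_right mult_minus_right ..
    also have "\<dots> = - (b z \<bullet> S.trunc r a z)"
    proof -
      have "(LINT y|lebesgue. b z \<bullet> (a y *\<^sub>R Kt r (z - y))) = b z \<bullet> S.trunc r a z"
        unfolding S.trunc_def by (rule integral_inner_right) (rule S.trunc_integrable[OF bl(2) r])
      then show ?thesis by simp
    qed
    finally show "(LINT y|lebesgue. ?F (y, z)) = - (b z \<bullet> S.trunc r a z)" .
  qed
  finally show ?thesis by simp
qed

text \<open>The range \<delta> of the kernel makes local integrability sufficient: as
  \<open>A\<close> contains every point within \<delta> of \<open>B\<close>, cutting a field to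
  \<open>A\<close> is not noticed by a truncated operator evaluated on \<open>B\<close>. The cut to
  \<open>B\<close> is noticed, and therefore stays in the formulas.\<close>

lemma
  fixes a :: "'a \<Rightarrow> real" and b :: "'a \<Rightarrow> 'a"
  assumes a: "locally_integrable a" and b: "locally_integrable b" and r: "0 < r"
    and A: "bounded A" "A \<in> sets lebesgue" and B: "bounded B" "B \<in> sets lebesgue"
    and sub: "\<And>z y. z \<in> B \<Longrightarrow> norm (y - z) < \<delta> \<Longrightarrow> y \<in> A"
  shows fubini_trunc_sets1: "(LINT y:A|lebesgue. a y * V.trunc r (\<lambda>z. indicator B z *\<^sub>R b z) y)
      = - (LINT z:B|lebesgue. b z \<bullet> S.trunc r a z)"
    and fubini_trunc_sets2: "(LINT y:B|lebesgue. a y * V.trunc r b y)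
      = - (LINT z:A|lebesgue. b z \<bullet> S.trunc r (\<lambda>y. indicator B y * a y) z)"
proof -
  have i: "integrable lebesgue (\<lambda>y. indicator A y *\<^sub>R a y)" "integrable lebesgue (\<lambda>y. indicator B y *\<^sub>R a y)"
    "integrable lebesgue (\<lambda>y. indicator A y *\<^sub>R b y)" "integrable lebesgue (\<lambda>y. indicator B y *\<^sub>R b y)"
    using set_integrable_locally[OF a] set_integrable_locally[OF b] A B by (auto simp: set_integrable_def)
  have eqS: "S.trunc r (\<lambda>y. indicator A y *\<^sub>R a y) z = S.trunc r a z" if "z \<in> B" for z
    using sub[OF that] by (intro S.trunc_local) simp
  have eqV: "V.trunc r (\<lambda>y. indicator A y *\<^sub>R b y) z = V.trunc r b z" if "z \<in> B" for z
    using sub[OF that] by (intro V.trunc_local) simp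
  have "(LINT y|lebesgue. (indicator A y *\<^sub>R a y) * V.trunc r (\<lambda>z. indicator B z *\<^sub>R b z) y)
      = - (LINT z|lebesgue. (indicator B z *\<^sub>R b z) \<bullet> S.trunc r (\<lambda>y. indicator A y *\<^sub>R a y) z)"
    using i r by (intro fubini_trunc)
  also have "(\<lambda>z. (indicator B z *\<^sub>R b z) \<bullet> S.trunc r (\<lambda>y. indicator A y *\<^sub>R a y) z)
      = (\<lambda>z. indicator B z *\<^sub>R (b z \<bullet> S.trunc r a z))"
    using eqS by (auto simp: indicator_def)
  finally show "(LINT y:A|lebesgue. a y * V.trunc r (\<lambda>z. indicator B z *\<^sub>R b z) y)
      = - (LINT z:B|lebesgue. b z \<bullet> S.trunc r a z)"
    by (simp add: set_lebesgue_integral_def mult.assoc)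
  have "(LINT y|lebesgue. (indicator B y *\<^sub>R a y) * V.trunc r (\<lambda>z. indicator A z *\<^sub>R b z) y)
      = - (LINT z|lebesgue. (indicator A z *\<^sub>R b z) \<bullet> S.trunc r (\<lambda>y. indicator B y *\<^sub>R a y) z)"
    using i r by (intro fubini_trunc)
  also have "(\<lambda>y. (indicator B y *\<^sub>R a y) * V.trunc r (\<lambda>z. indicator A z *\<^sub>R b z) y)
      = (\<lambda>y. indicator B y *\<^sub>R (a y * V.trunc r b y))"
    using eqV by (auto simp: indicator_def)
  finally show "(LINT y:B|lebesgue. a y * V.trunc r b y)
      = - (LINT z:A|lebesgue. b z \<bullet> S.trunc r (\<lambda>y. indicator B y * a y) z)"
    by (simp add: set_lebesgue_integral_def)
qed

text \<open>For a test function the two domains are the balls of radii \<open>R\<close> and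
  \<open>R + \<delta>\<close>; both integrands vanish outside them, so the integrals extend to the
  whole space.\<close>

lemma
  fixes u f :: "'a \<Rightarrow> real" and \<phi> b :: "'a \<Rightarrow> 'a"
  assumes r: "0 < r"
  shows fubini_test_vector: "test_function \<phi> \<Longrightarrow> locally_integrable u \<Longrightarrow>
      (LINT y|lebesgue. u y * V.trunc r \<phi> y) = - (LINT z|lebesgue. \<phi> z \<bullet> S.trunc r u z)"
    and fubini_test_scalar: "test_function f \<Longrightarrow> locally_integrable b \<Longrightarrow>
      (LINT y|lebesgue. f y * V.trunc r b y) = - (LINT z|lebesgue. b z \<bullet> S.trunc r f z)"
proof -
  have sub: "y \<in> cball 0 (R + \<delta>)" if "z \<in> cball 0 R" "norm (y - z) < \<delta>" for R and y z :: 'a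
    using that norm_triangle_ineq[of "y - z" z] by simp
  show "(LINT y|lebesgue. u y * V.trunc r \<phi> y) = - (LINT z|lebesgue. \<phi> z \<bullet> S.trunc r u z)"
    if \<phi>: "test_function \<phi>" and u: "locally_integrable u"
  proof -
    obtain R where R: "0 < R" "\<And>x. R \<le> norm x \<Longrightarrow> \<phi> x = 0" by (rule test_function_support[OF \<phi>]) blast
    have i: "indicator (cball 0 R) z *\<^sub>R \<phi> z = \<phi> z" for z using R(2)[of z] by (auto simp: indicator_def)
    have "V.trunc r \<phi> y = 0" if "y \<notin> cball 0 (R + \<delta>)" for y
      using that by (intro V.trunc_support[of R] R(2)) auto
    then have o: "indicator (cball 0 (R + \<delta>)) y *\<^sub>R (u y * V.trunc r \<phi> y) = u y * V.trunc r \<phi> y" for y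
      by (auto simp: indicator_def simp del: mem_cball mem_cball_0)
    have o2: "indicator (cball 0 R) z *\<^sub>R (\<phi> z \<bullet> S.trunc r u z) = \<phi> z \<bullet> S.trunc r u z" for z
      using R(2)[of z] by (auto simp: indicator_def)
    have "(LINT y:cball 0 (R + \<delta>)|lebesgue. u y * V.trunc r (\<lambda>z. indicator (cball 0 R) z *\<^sub>R \<phi> z) y)
      = - (LINT z:cball 0 R|lebesgue. \<phi> z \<bullet> S.trunc r u z)"
      by (rule fubini_trunc_sets1[OF u test_function_locally_integrable[OF \<phi>] r]) (use sub[of _ R] in auto)
    then show ?thesis
      by (simp add: i o o2 set_lebesgue_integral_def del: mem_cball mem_cball_0 real_scaleR_def)
  qed
  show "(LINT y|lebesgue. f y * V.trunc r b y) = - (LINT z|lebesgue. b z \<bullet> S.trunc r f z)"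
    if f: "test_function f" and b: "locally_integrable b"
  proof -
    obtain R where R: "0 < R" "\<And>x. R \<le> norm x \<Longrightarrow> f x = 0" by (rule test_function_support[OF f]) blast
    have i: "indicator (cball 0 R) z * f z = f z" for z using R(2)[of z] by (auto simp: indicator_def)
    have "S.trunc r f y = 0" if "y \<notin> cball 0 (R + \<delta>)" for y
      using that by (intro S.trunc_support[of R] R(2)) auto
    then have o: "indicator (cball 0 (R + \<delta>)) y *\<^sub>R (b y \<bullet> S.trunc r f y) = b y \<bullet> S.trunc r f y" for y
      by (auto simp: indicator_def simp del: mem_cball mem_cball_0)
    have o2: "indicator (cball 0 R) z *\<^sub>R (f z * V.trunc r b z) = f z * V.trunc r b z" for z
      using R(2)[of z] by (auto simp: indicator_def)
    have "(LINT y:cball 0 R|lebesgue. f y * V.trunc r b y)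
      = - (LINT z:cball 0 (R + \<delta>)|lebesgue. b z \<bullet> S.trunc r (\<lambda>y. indicator (cball 0 R) y * f y) z)"
      by (rule fubini_trunc_sets2[OF test_function_locally_integrable[OF f] b r]) (use sub[of _ R] in auto)
    then show ?thesis
      by (simp add: i o o2 set_lebesgue_integral_def del: mem_cball mem_cball_0 real_scaleR_def)
  qed
qed

text \<open>Truncated duality holds for every \<open>r\<close>, and both sides have limits: on one
  side the truncation acts on the test field, on the other it acts on \<open>u\<close> over the
  support of the test field, where \<open>u\<close> is Lipschitz.\<close>

lemma integral_by_parts_away:
  fixes u :: "'a \<Rightarrow> real" and \<phi> :: "'a \<Rightarrow> 'a"
  assumes u: "locally_integrable u" "Lipschitz_away x u" and \<phi>: "test_function \<phi>"
    and "0 < \<rho>" and away: "\<And>y. norm (y - x) \<le> \<rho> \<Longrightarrow> \<phi> y = 0"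
  shows "integrable lebesgue (\<lambda>y. \<phi> y \<bullet> S.tlim u y)"
    and "(LINT y|lebesgue. u y * V.tlim \<phi> y) = - (LINT y|lebesgue. \<phi> y \<bullet> S.tlim u y)"
proof -
  obtain R where R: "0 < R" "\<And>x. R \<le> norm x \<Longrightarrow> \<phi> x = 0" by (rule test_function_support[OF \<phi>]) blast
  let ?A = "cball 0 R - ball x \<rho>"
  have A: "bounded ?A" "?A \<in> sets lebesgue" by (auto intro: bounded_subset[of "cball 0 R"])
  have g: "set_integrable lebesgue ?A \<phi>"
    by (rule set_integrable_locally[OF test_function_locally_integrable[OF \<phi>] A])
  have aw: "\<rho> \<le> norm (y - x)" if "y \<in> ?A" for y using that by (auto simp: dist_norm norm_minus_commute)
  have eq: "indicator ?A y *\<^sub>R (\<phi> y \<bullet> c) = \<phi> y \<bullet> c" for y c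
    using R(2)[of y] away[of y] by (cases "y \<in> ?A") (auto simp: dist_norm norm_minus_commute)
  note * = S.integral_away_tendsto[OF u A \<open>0 < \<rho>\<close> aw g]
  show "integrable lebesgue (\<lambda>y. \<phi> y \<bullet> S.tlim u y)"
    using *(1) by (simp add: set_integrable_def eq del: real_scaleR_def)
  have "((\<lambda>r. LINT y|lebesgue. \<phi> y \<bullet> S.trunc r u y) \<longlongrightarrow> (LINT y|lebesgue. \<phi> y \<bullet> S.tlim u y)) (at_right 0)"
    using *(3) by (simp add: set_lebesgue_integral_def eq del: real_scaleR_def)
  from tendsto_minus[OF this]
  have "((\<lambda>r. LINT y|lebesgue. u y * V.trunc r \<phi> y) \<longlongrightarrow> - (LINT y|lebesgue. \<phi> y \<bullet> S.tlim u y)) (at_right 0)"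
    by (rule Lim_transform_eventually)
       (auto simp: eventually_at_right_field fubini_test_vector[OF _ \<phi> u(1)] intro!: exI[of _ 1])
  moreover have "((\<lambda>r. LINT y|lebesgue. u y * V.trunc r \<phi> y) \<longlongrightarrow> (LINT y|lebesgue. u y * V.tlim \<phi> y)) (at_right 0)"
    using V.integral_test_tendsto(2)[OF \<phi> u(1)] by (simp add: inner_real_def)
  ultimately show "(LINT y|lebesgue. u y * V.tlim \<phi> y) = - (LINT y|lebesgue. \<phi> y \<bullet> S.tlim u y)"
    using tendsto_unique trivial_limit_at_right_real by blast
qed

end

section \<open>The Green identity for truncated normal operators\<close>

text \<open>The data of the Green identity in terms of the kernel alone: \<open>-c * S.tlim\<close> is the nonlocal
  gradient, \<open>-c * V.tlim\<close> the nonlocal divergence and \<open>G\<close> a distributional gradient of \<open>\<Psi>\<close>.\<close>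

locale green_data = odd_kernel K \<delta> for K :: "'a::euclidean_space \<Rightarrow> 'a" and \<delta> :: real +
  fixes \<eta> \<sigma> \<tau> c and x :: 'a and \<Psi> :: "'a \<Rightarrow> real" and G :: "'a \<Rightarrow> 'a"
  assumes eta: "plateau \<eta> \<sigma> \<tau>"
    and Psi_int: "locally_integrable \<Psi>" and Psi_smooth: "smooth_on (- {x}) \<Psi>"
    and G_int: "locally_integrable G"
    and G_dist: "\<And>\<phi>. test_function \<phi> \<Longrightarrow>
      (LINT y|lebesgue. G y \<bullet> \<phi> y) = c * (LINT y|lebesgue. \<Psi> y * V.tlim \<phi> y)"
    and fund: "\<And>u. test_function u \<Longrightarrow>
      (LINT y|lebesgue. \<Psi> y * (- c * V.tlim (\<lambda>z. - c *\<^sub>R S.tlim u z) y)) = u x"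
begin

text \<open>The pointwise nonlocal gradient of \<Psi>. Unlike \<open>G\<close> it has known
  regularity off \<open>x\<close>; its value at \<open>x\<close> itself is unspecified, which
  affects only a null set.\<close>

definition H :: "'a \<Rightarrow> 'a"
  where "H y = - c *\<^sub>R S.tlim \<Psi> y"

lemma Psi_Lipschitz: "Lipschitz_away x \<Psi>"
  using eta Psi_smooth by (rule smooth_Lipschitz_away)

lemma H_Lipschitz: "Lipschitz_away x H"
  unfolding Lipschitz_away_def
proof (intro allI impI)
  fix \<rho> R :: real assume "0 < \<rho>"
  obtain L where L: "0 \<le> L" "\<And>y z. \<rho> \<le> norm (y - x) \<Longrightarrow> norm y \<le> R \<Longrightarrow>
    \<rho> \<le> norm (z - x) \<Longrightarrow> norm z \<le> R \<Longrightarrow> norm (S.tlim \<Psi> y - S.tlim \<Psi> z) \<le> L * norm (y - z)"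
    by (rule Lipschitz_awayD[OF S.tlim_Lipschitz_away[OF eta Psi_int Psi_smooth] \<open>0 < \<rho>\<close>]) blast
  have "norm (H y - H z) \<le> (\<bar>c\<bar> * L) * norm (y - z)" if "\<rho> \<le> norm (y - x)" "norm y \<le> R"
    "\<rho> \<le> norm (z - x)" "norm z \<le> R" for y z
  proof -
    have "H y - H z = - c *\<^sub>R (S.tlim \<Psi> y - S.tlim \<Psi> z)" by (simp add: H_def scaleR_diff_right)
    then have "norm (H y - H z) = \<bar>c\<bar> * norm (S.tlim \<Psi> y - S.tlim \<Psi> z)" by simp
    also have "\<dots> \<le> \<bar>c\<bar> * (L * norm (y - z))" using L(2)[OF that] by (intro mult_left_mono) auto
    finally show ?thesis by simp
  qed
  then show "\<exists>L. \<forall>y z. \<rho> \<le> norm (y - x) \<longrightarrow> norm y \<le> R \<longrightarrow> \<rho> \<le> norm (z - x) \<longrightarrow> norm z \<le> R \<longrightarrow>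
      norm (H y - H z) \<le> L * norm (y - z)" by blast
qed

lemma H_by_parts:
  assumes \<phi>: "test_function \<phi>" and "0 < t" "\<And>y. norm (y - x) \<le> t \<Longrightarrow> \<phi> y = 0"
  shows "integrable lebesgue (\<lambda>y. \<phi> y \<bullet> H y)"
    and "(LINT y|lebesgue. \<phi> y \<bullet> H y) = (LINT y|lebesgue. G y \<bullet> \<phi> y)"
proof -
  note * = integral_by_parts_away[OF Psi_int Psi_Lipschitz assms]
  show "integrable lebesgue (\<lambda>y. \<phi> y \<bullet> H y)" using *(1) by (simp add: H_def)
  have "(LINT y|lebesgue. \<phi> y \<bullet> H y) = - c * (LINT y|lebesgue. \<phi> y \<bullet> S.tlim \<Psi> y)"
    by (simp add: H_def)
  also have "\<dots> = c * (LINT y|lebesgue. \<Psi> y * V.tlim \<phi> y)" using *(2) by simp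
  finally show "(LINT y|lebesgue. \<phi> y \<bullet> H y) = (LINT y|lebesgue. G y \<bullet> \<phi> y)"
    using G_dist[OF \<phi>] by simp
qed

lemma test_integrable:
  fixes f g :: "'a \<Rightarrow> 'b::euclidean_space"
  assumes f: "test_function f" and g: "locally_integrable g"
  shows "integrable lebesgue (\<lambda>y. f y \<bullet> g y)"
proof -
  obtain R where R: "0 < R" "\<And>x. R \<le> norm x \<Longrightarrow> f x = 0" by (rule test_function_support[OF f]) blast
  obtain M where M: "0 < M" "\<And>x. norm (f x) \<le> M" by (rule test_function_bounded[OF f]) blast
  have gi: "integrable lebesgue (\<lambda>y. indicator (cball 0 R) y *\<^sub>R g y)"
    using g unfolding locally_integrable_def set_integrable_def by simp
  show ?thesis
  proof (rule Bochner_Integration.integrable_bound)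
    show "integrable lebesgue (\<lambda>y. M *\<^sub>R (indicator (cball 0 R) y *\<^sub>R g y))"
      using gi by (rule integrable_scaleR_right)
    show "(\<lambda>y. f y \<bullet> g y) \<in> borel_measurable lebesgue"
      by (intro borel_measurable_inner locally_integrable_measurable g test_function_locally_integrable f)
    have "norm (f y \<bullet> g y) \<le> norm (M *\<^sub>R (indicator (cball 0 R) y *\<^sub>R g y))" for y
    proof (cases "norm y \<le> R")
      case True
      have "norm (f y \<bullet> g y) \<le> norm (f y) * norm (g y)" by (simp add: Cauchy_Schwarz_ineq2)
      also have "\<dots> \<le> M * norm (g y)" using M by (intro mult_right_mono) auto
      finally show ?thesis using True M(1) by simp
    qed (use R(2)[of y] in simp)
    then show "AE y in lebesgue. norm (f y \<bullet> g y) \<le> norm (M *\<^sub>R (indicator (cball 0 R) y *\<^sub>R g y))" by simp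
  qed
qed

lemma test_function_cutoff_vector:
  "test_function \<xi> \<Longrightarrow> test_function (\<lambda>y. \<xi> y *\<^sub>R (b :: 'a))"
  by (rule test_function_scaleR_left) (simp_all add: smooth_on_const)

text \<open>Against fields vanishing near \<open>x\<close> both functions have the same pairing,
  \<open>G\<close> by its defining property and \<open>H\<close> by integration by parts. Testing
  with a scalar cut-off times a basis vector reduces the claim to components. The gain is mutual:
  \<open>G\<close> acquires regularity off \<open>x\<close>, and \<open>H\<close> acquires
  integrability across \<open>x\<close>.\<close>

lemma G_eq_H: "AE y in lebesgue. G y = H y"
proof -
  have "AE y in lebesgue. (G y - H y) \<bullet> b = 0" for b
  proof (rule AE_zero_away[OF eta])
    fix \<xi> :: "'a \<Rightarrow> real" and t :: real
    assume \<xi>: "test_function \<xi>" and t: "0 < t" "\<And>y. norm (y - x) \<le> t \<Longrightarrow> \<xi> y = 0"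
    note test = test_function_cutoff_vector[OF \<xi>, of b]
    have z: "\<xi> y *\<^sub>R b = 0" if "norm (y - x) \<le> t" for y using t(2)[OF that] by simp
    have *: "integrable lebesgue (\<lambda>y. (\<xi> y *\<^sub>R b) \<bullet> H y)"
      "(LINT y|lebesgue. (\<xi> y *\<^sub>R b) \<bullet> H y) = (LINT y|lebesgue. G y \<bullet> (\<xi> y *\<^sub>R b))"
      by (rule H_by_parts[OF test t(1)], rule z, assumption)+
    have G: "integrable lebesgue (\<lambda>y. (\<xi> y *\<^sub>R b) \<bullet> G y)" using test G_int by (rule test_integrable)
    have eq: "\<xi> y * ((G y - H y) \<bullet> b) = (\<xi> y *\<^sub>R b) \<bullet> G y - (\<xi> y *\<^sub>R b) \<bullet> H y" for y
      by (simp add: inner_diff_left inner_commute[of b] algebra_simps)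
    show "integrable lebesgue (\<lambda>y. \<xi> y * ((G y - H y) \<bullet> b))"
      unfolding eq using G *(1) by (rule Bochner_Integration.integrable_diff)
    have "(LINT y|lebesgue. \<xi> y * ((G y - H y) \<bullet> b))
        = (LINT y|lebesgue. (\<xi> y *\<^sub>R b) \<bullet> G y) - (LINT y|lebesgue. (\<xi> y *\<^sub>R b) \<bullet> H y)"
      unfolding eq by (rule Bochner_Integration.integral_diff[OF G *(1)])
    also have "\<dots> = 0"
      unfolding *(2) inner_commute[of "G _" "\<xi> _ *\<^sub>R b"] by (rule diff_self)
    finally show "(LINT y|lebesgue. \<xi> y * ((G y - H y) \<bullet> b)) = 0" .
  qed
  then have "AE y in lebesgue. \<forall>b\<in>Basis. (G y - H y) \<bullet> b = 0"
    by (intro AE_finite_allI finite_Basis)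
  then show ?thesis
  proof eventually_elim
    case (elim y)
    show ?case
    proof (rule euclidean_eqI)
      show "G y \<bullet> b = H y \<bullet> b" if "b \<in> Basis" for b
        using elim that by (simp add: inner_diff_left)
    qed
  qed
qed

lemma H_measurable: "H \<in> borel_measurable lebesgue"
  using locally_integrable_measurable[OF G_int] G_eq_H by (rule borel_measurable_AE)

lemma H_int: "locally_integrable H"
  unfolding locally_integrable_def set_integrable_def
proof (intro allI impI)
  fix C :: "'a set" assume C: "compact C"
  then have Cm: "(indicator C :: 'a \<Rightarrow> real) \<in> borel_measurable lebesgue"
    by (intro borel_measurable_indicator fmeasurableD lmeasurable_compact)
  have "integrable lebesgue (\<lambda>y. indicator C y *\<^sub>R G y)"
    using G_int C unfolding locally_integrable_def set_integrable_def by blast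
  then show "integrable lebesgue (\<lambda>y. indicator C y *\<^sub>R H y)"
  proof (rule integrable_cong_AE_imp)
    show "(\<lambda>y. indicator C y *\<^sub>R H y) \<in> borel_measurable lebesgue"
      using Cm H_measurable by (rule borel_measurable_scaleR)
    show "AE y in lebesgue. indicator C y *\<^sub>R G y = indicator C y *\<^sub>R H y"
      using G_eq_H by eventually_elim simp
  qed
qed

text \<open>Unlike \<open>H_by_parts\<close>, this covers test fields that do not vanish near
  \<open>x\<close>; across the singularity it is inherited from \<open>G\<close>.\<close>

lemma H_dist:
  assumes "test_function \<phi>"
  shows "(LINT y|lebesgue. H y \<bullet> \<phi> y) = c * (LINT y|lebesgue. \<Psi> y * V.tlim \<phi> y)"
proof -
  have m: "\<phi> \<in> borel_measurable lebesgue"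
    by (intro locally_integrable_measurable test_function_locally_integrable assms)
  have "(LINT y|lebesgue. H y \<bullet> \<phi> y) = (LINT y|lebesgue. G y \<bullet> \<phi> y)"
  proof (rule integral_cong_AE)
    show "AE y in lebesgue. H y \<bullet> \<phi> y = G y \<bullet> \<phi> y" using G_eq_H by eventually_elim simp
  qed (intro borel_measurable_inner H_measurable m locally_integrable_measurable[OF G_int])+
  then show ?thesis using G_dist[OF assms] by simp
qed

definition grad :: "('a \<Rightarrow> real) \<Rightarrow> 'a \<Rightarrow> 'a"
  where "grad u y = - c *\<^sub>R S.tlim u y"

lemma test_grad:
  assumes "test_function u"
  shows "test_function (grad u)"
  unfolding grad_def[abs_def]
  by (rule test_function_scaleR[OF smooth_on_const S.test_function_tlim[OF assms]]) simp

text \<open>The weak form of the statement that the nonlocal divergence of \<open>H\<close> is the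
  Dirac mass at \<open>x\<close>, the divergence being minus the adjoint of the gradient.\<close>

lemma H_grad:
  assumes "test_function u"
  shows "(LINT y|lebesgue. H y \<bullet> grad u y) = - u x"
proof -
  have eq: "(\<lambda>z. - c *\<^sub>R S.tlim u z) = grad u" by (simp add: grad_def fun_eq_iff)
  have "u x = (LINT y|lebesgue. \<Psi> y * (- c * V.tlim (grad u) y))"
    using fund[OF assms] unfolding eq by (rule sym)
  also have "\<dots> = - c * (LINT y|lebesgue. \<Psi> y * V.tlim (grad u) y)"
    unfolding mult.left_commute[of "\<Psi> _"] by (rule integral_mult_right_zero)
  also have "\<dots> = - (LINT y|lebesgue. H y \<bullet> grad u y)"
    unfolding H_dist[OF test_grad[OF assms]] by (rule mult_minus_left)
  finally show ?thesis by simp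
qed

text \<open>Test functions that vanish near \<open>x\<close> do not see the Dirac mass, so the
  pointwise divergence of \<open>H\<close> integrates to 0 against all of them. Keeping the factor
  \<open>c\<close> spares a division.\<close>

lemma div_H: "AE y in lebesgue. c * V.tlim H y = 0"
proof (rule AE_zero_away[OF eta])
  fix \<xi> :: "'a \<Rightarrow> real" and t :: real
  assume \<xi>: "test_function \<xi>" and t: "0 < t" "\<And>y. norm (y - x) \<le> t \<Longrightarrow> \<xi> y = 0"
  obtain R where R: "0 < R" "\<And>x. R \<le> norm x \<Longrightarrow> \<xi> x = 0" by (rule test_function_support[OF \<xi>]) blast
  let ?A = "cball 0 R - ball x t"
  have A: "bounded ?A" "?A \<in> sets lebesgue" by (auto intro: bounded_subset[of "cball 0 R"])
  have g: "set_integrable lebesgue ?A \<xi>"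
    by (rule set_integrable_locally[OF test_function_locally_integrable[OF \<xi>] A])
  have aw: "t \<le> norm (y - x)" if "y \<in> ?A" for y using that by (auto simp: dist_norm norm_minus_commute)
  have eq: "indicator ?A y *\<^sub>R (\<xi> y * d) = \<xi> y * d" for y d
    using R(2)[of y] t(2)[of y] by (cases "y \<in> ?A") (auto simp: dist_norm norm_minus_commute)
  note * = V.integral_away_tendsto[OF H_int H_Lipschitz A t(1) aw g]
  have "integrable lebesgue (\<lambda>y. \<xi> y * V.tlim H y)"
    using *(1) by (simp add: set_integrable_def eq del: real_scaleR_def)
  then have "integrable lebesgue (\<lambda>y. c * (\<xi> y * V.tlim H y))" by (rule integrable_mult_right)
  then show "integrable lebesgue (\<lambda>y. \<xi> y * (c * V.tlim H y))" by (simp add: mult_ac)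
  have "((\<lambda>r. LINT y|lebesgue. \<xi> y * V.trunc r H y) \<longlongrightarrow> (LINT y|lebesgue. \<xi> y * V.tlim H y)) (at_right 0)"
    using *(3) by (simp add: set_lebesgue_integral_def eq del: real_scaleR_def)
  moreover have "((\<lambda>r. LINT y|lebesgue. \<xi> y * V.trunc r H y) \<longlongrightarrow> - (LINT y|lebesgue. H y \<bullet> S.tlim \<xi> y)) (at_right 0)"
    by (rule Lim_transform_eventually[OF tendsto_minus[OF S.integral_test_tendsto(2)[OF \<xi> H_int]]])
       (auto simp: eventually_at_right_field fubini_test_scalar[OF _ \<xi> H_int] intro!: exI[of _ 1])
  ultimately have "(LINT y|lebesgue. \<xi> y * V.tlim H y) = - (LINT y|lebesgue. H y \<bullet> S.tlim \<xi> y)"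
    using tendsto_unique trivial_limit_at_right_real by blast
  then have "(LINT y|lebesgue. \<xi> y * (c * V.tlim H y)) = (LINT y|lebesgue. H y \<bullet> grad \<xi> y)"
    by (simp add: grad_def mult.left_commute)
  also have "\<dots> = 0" unfolding H_grad[OF \<xi>] using t by simp
  finally show "(LINT y|lebesgue. \<xi> y * (c * V.tlim H y)) = 0" .
qed

lemma locally_integrable_restrict:
  fixes f :: "'a \<Rightarrow> 'b::euclidean_space"
  assumes "locally_integrable f" "A \<in> sets lebesgue"
  shows "locally_integrable (\<lambda>y. indicator A y *\<^sub>R f y)"
  unfolding locally_integrable_def set_integrable_def
proof (intro allI impI)
  fix C :: "'a set" assume C: "compact C"
  then have "integrable lebesgue (\<lambda>y. indicator C y *\<^sub>R f y)"
    using assms(1) unfolding locally_integrable_def set_integrable_def by blast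
  from integrable_mult_indicator[OF assms(2) this]
  show "integrable lebesgue (\<lambda>y. indicator C y *\<^sub>R indicator A y *\<^sub>R f y)"
    by (simp add: mult.commute)
qed

text \<open>The domain of integration of the normal operator is moved into the field, as a factor
  \<open>indicator \<Omega>\<close>, so that the duality of truncated operators applies to
  it.\<close>

definition normal :: "'a set \<Rightarrow> real \<Rightarrow> ('a \<Rightarrow> 'a) \<Rightarrow> 'a \<Rightarrow> real"
  where "normal \<Omega> r \<phi> y = c * V.trunc r (\<lambda>z. indicator \<Omega> z *\<^sub>R \<phi> z) y"

lemma normal_integrable:
  assumes \<phi>: "locally_integrable \<phi>" and u: "locally_integrable u" and r: "0 < r"
    and \<Omega>: "bounded \<Omega>" "\<Omega> \<in> sets lebesgue" and A: "bounded A" "A \<in> sets lebesgue"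
  shows "set_integrable lebesgue A (\<lambda>y. u y * normal \<Omega> r \<phi> y)"
proof -
  have i: "integrable lebesgue (\<lambda>z. indicator \<Omega> z *\<^sub>R \<phi> z)"
    using set_integrable_locally[OF \<phi> \<Omega>] by (simp add: set_integrable_def)
  obtain M where M: "\<And>y. norm (V.trunc r (\<lambda>z. indicator \<Omega> z *\<^sub>R \<phi> z) y) \<le> M"
    using V.trunc_bounded[OF i r] by blast
  have ui: "integrable lebesgue (\<lambda>y. indicator A y *\<^sub>R u y)"
    using set_integrable_locally[OF u A] by (simp add: set_integrable_def)
  have "integrable lebesgue (\<lambda>y. (indicator A y *\<^sub>R u y) *\<^sub>R (c * V.trunc r (\<lambda>z. indicator \<Omega> z *\<^sub>R \<phi> z) y))"
  proof (rule Bochner_Integration.integrable_bound)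
    show "integrable lebesgue (\<lambda>y. (\<bar>c\<bar> * M) * (indicator A y *\<^sub>R u y))" using ui by (rule integrable_mult_right)
    show "(\<lambda>y. (indicator A y *\<^sub>R u y) *\<^sub>R (c * V.trunc r (\<lambda>z. indicator \<Omega> z *\<^sub>R \<phi> z) y)) \<in> borel_measurable lebesgue"
      by (rule borel_measurable_scaleR[OF borel_measurable_integrable[OF ui]
            borel_measurable_times[OF borel_measurable_const V.trunc_measurable[OF borel_measurable_integrable[OF i]]]])
    have "norm (t *\<^sub>R (c * V.trunc r (\<lambda>z. indicator \<Omega> z *\<^sub>R \<phi> z) y)) \<le> norm ((\<bar>c\<bar> * M) * t)" for y t
    proof -
      have "\<bar>V.trunc r (\<lambda>z. indicator \<Omega> z *\<^sub>R \<phi> z) y\<bar> \<le> \<bar>M\<bar>" using M[of y] by simp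
      then have "\<bar>t\<bar> * \<bar>c\<bar> * \<bar>V.trunc r (\<lambda>z. indicator \<Omega> z *\<^sub>R \<phi> z) y\<bar> \<le> \<bar>t\<bar> * \<bar>c\<bar> * \<bar>M\<bar>"
        by (intro mult_left_mono) auto
      then show ?thesis by (simp add: abs_mult mult_ac)
    qed
    then show "AE y in lebesgue. norm ((indicator A y *\<^sub>R u y) *\<^sub>R (c * V.trunc r (\<lambda>z. indicator \<Omega> z *\<^sub>R \<phi> z) y))
        \<le> norm ((\<bar>c\<bar> * M) * (indicator A y *\<^sub>R u y))" by blast
  qed
  then show ?thesis by (simp add: set_integrable_def normal_def mult.assoc)
qed

end

lemma (in kernel_product) trunc_locally_integrable:
  assumes f: "locally_integrable f" and r: "0 < r"
  shows "locally_integrable (trunc r f)"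
  unfolding locally_integrable_def
proof (intro allI impI)
  fix C :: "'a set" assume C: "compact C"
  then have Cs: "C \<in> sets lebesgue" by (intro fmeasurableD lmeasurable_compact)
  obtain M where M: "\<And>y. y \<in> C \<Longrightarrow> norm (trunc r f y) \<le> M"
    using trunc_bounded_on[OF f r compact_imp_bounded[OF C]] by blast
  show "set_integrable lebesgue C (trunc r f)"
    unfolding set_integrable_def
  proof (rule Bochner_Integration.integrable_bound)
    show "integrable lebesgue (\<lambda>y. M * indicator C y)"
      using lmeasurable_compact[OF C] by (intro integrable_mult_right) (simp add: lmeasurable_iff_integrable)
    show "(\<lambda>y. indicator C y *\<^sub>R trunc r f y) \<in> borel_measurable lebesgue"
      by (intro borel_measurable_scaleR borel_measurable_indicator Cs
          trunc_measurable locally_integrable_measurable f)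
    have "norm (indicator C y *\<^sub>R trunc r f y) \<le> norm (M * indicator C y)" for y
      using M[of y] by (cases "y \<in> C") auto
    then show "AE y in lebesgue. norm (indicator C y *\<^sub>R trunc r f y) \<le> norm (M * indicator C y)" by simp
  qed
qed

context green_data
begin

text \<open>Where \<open>a\<close> is 1 the second integrand is 0, so its domain can avoid a ball
  around \<open>x\<close>; where \<open>a\<close> is supported lies inside \<open>A\<close>, so the
  first integral runs over the whole space and can be paired with a distribution.\<close>

lemma split_at_center:
  fixes f T :: "'a \<Rightarrow> 'b::euclidean_space"
  assumes a: "\<And>y. norm (y - x) \<le> t \<Longrightarrow> a y = (1::real)" "\<And>y. \<rho> \<le> norm (y - x) \<Longrightarrow> a y = 0"
    and A: "ball x \<rho> \<subseteq> A"
    and i1: "integrable lebesgue (\<lambda>y. (a y *\<^sub>R f y) \<bullet> T y)"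
    and i2: "set_integrable lebesgue (A - ball x t) (\<lambda>y. ((1 - a y) *\<^sub>R f y) \<bullet> T y)"
  shows "(LINT y:A|lebesgue. f y \<bullet> T y)
    = (LINT y|lebesgue. (a y *\<^sub>R f y) \<bullet> T y) + (LINT y:A - ball x t|lebesgue. ((1 - a y) *\<^sub>R f y) \<bullet> T y)"
proof -
  have "indicator A y *\<^sub>R (f y \<bullet> T y)
      = (a y *\<^sub>R f y) \<bullet> T y + indicator (A - ball x t) y *\<^sub>R (((1 - a y) *\<^sub>R f y) \<bullet> T y)" for y
  proof (cases "y \<in> A")
    case True
    then show ?thesis using a(1)[of y] by (cases "y \<in> ball x t") (auto simp: dist_norm norm_minus_commute algebra_simps)
  next
    case False
    then have "\<rho> \<le> norm (y - x)" using A by (auto simp: dist_norm norm_minus_commute subset_iff not_less[symmetric])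
    then show ?thesis using False a(2)[of y] by simp
  qed
  then show ?thesis
    unfolding set_lebesgue_integral_def
    using Bochner_Integration.integral_add[OF i1 i2[unfolded set_integrable_def]] by simp
qed

lemma test_function_one_minus:
  fixes f :: "'a \<Rightarrow> 'b::real_normed_vector" and a :: "'a \<Rightarrow> real"
  assumes "test_function a" "test_function f"
  shows "test_function (\<lambda>y. (1 - a y) *\<^sub>R f y)"
proof (rule test_function_scaleR[OF _ assms(2)])
  have "smooth_on UNIV (\<lambda>y. 1 + (- 1) * a y)"
    using assms(1) unfolding test_function_iff by (intro smooth_on_add smooth_on_mult smooth_on_const) auto
  then show "smooth_on UNIV (\<lambda>y. 1 - a y)" by simp
qed

text \<open>Fubini first rewrites the integral over \<open>A\<close> as one over \<Omega> with the
  truncation on \<Psi>, which removes the indicator from the field. The part \<open>a\<close> times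
  \<phi> is sent back by duality, so that a test field carries the truncation, and its limit is
  identified by \<open>H_dist\<close>; the part \<open>1 - a\<close> times \<phi> meets \<Psi> only
  away from \<open>x\<close>, where truncations converge to the pointwise gradient.\<close>

lemma normal_limit_Psi:
  assumes \<phi>: "test_function \<phi>"
    and \<Omega>: "bounded \<Omega>" "\<Omega> \<in> sets lebesgue" and A: "bounded A" "A \<in> sets lebesgue"
    and sub: "\<And>z y. z \<in> \<Omega> \<Longrightarrow> norm (y - z) < \<delta> \<Longrightarrow> y \<in> A"
    and \<rho>: "0 < \<rho>" "ball x \<rho> \<subseteq> \<Omega>"
  shows "((\<lambda>r. LINT y:A|lebesgue. \<Psi> y * normal \<Omega> r \<phi> y) \<longlongrightarrow> (LINT z:\<Omega>|lebesgue. \<phi> z \<bullet> H z)) (at_right 0)"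
proof -
  obtain a :: "'a \<Rightarrow> real" and t where a: "test_function a" and t: "0 < t" and a1: "\<And>y. norm (y - x) \<le> t \<Longrightarrow> a y = 1"
    and a0: "\<And>y. \<rho> \<le> norm (y - x) \<Longrightarrow> a y = 0"
    by (rule center_bump[OF eta \<rho>(1)]) blast
  have smooth_a: "smooth_on UNIV a" using a by (simp add: test_function_iff)
  note a\<phi> = test_function_scaleR[OF smooth_a \<phi>]
  note b\<phi> = test_function_one_minus[OF a \<phi>]
  let ?B = "\<Omega> - ball x t"
  have B: "bounded ?B" "?B \<in> sets lebesgue" using \<Omega> by (auto intro: bounded_subset)
  have aw: "t \<le> norm (y - x)" if "y \<in> ?B" for y using that by (auto simp: dist_norm norm_minus_commute)
  note away = S.integral_away_tendsto[OF Psi_int Psi_Lipschitz B t aw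
      set_integrable_locally[OF test_function_locally_integrable[OF b\<phi>] B]]
  have split: "(LINT z:\<Omega>|lebesgue. \<phi> z \<bullet> S.trunc r \<Psi> z)
      = - (LINT y|lebesgue. \<Psi> y * V.trunc r (\<lambda>y. a y *\<^sub>R \<phi> y) y)
        + (LINT z:?B|lebesgue. ((1 - a z) *\<^sub>R \<phi> z) \<bullet> S.trunc r \<Psi> z)" if r: "0 < r" for r
    unfolding fubini_test_vector[OF r a\<phi> Psi_int] minus_minus
  proof (rule split_at_center[OF a1 a0 \<rho>(2)])
    show "integrable lebesgue (\<lambda>z. (a z *\<^sub>R \<phi> z) \<bullet> S.trunc r \<Psi> z)"
      by (rule test_integrable[OF a\<phi> S.trunc_locally_integrable[OF Psi_int r]])
    show "set_integrable lebesgue ?B (\<lambda>z. ((1 - a z) *\<^sub>R \<phi> z) \<bullet> S.trunc r \<Psi> z)"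
      by (rule away(2)) (use r in auto)
  qed
  have eq: "(LINT y:A|lebesgue. \<Psi> y * normal \<Omega> r \<phi> y)
      = c * (LINT y|lebesgue. \<Psi> y * V.trunc r (\<lambda>y. a y *\<^sub>R \<phi> y) y)
        + (- c) * (LINT z:?B|lebesgue. ((1 - a z) *\<^sub>R \<phi> z) \<bullet> S.trunc r \<Psi> z)" if r: "0 < r" for r
  proof -
    have "(LINT y:A|lebesgue. \<Psi> y * normal \<Omega> r \<phi> y)
        = c * (LINT y:A|lebesgue. \<Psi> y * V.trunc r (\<lambda>z. indicator \<Omega> z *\<^sub>R \<phi> z) y)"
      unfolding normal_def mult.left_commute[of "\<Psi> _"] by (rule set_integral_mult_right)
    also have "(LINT y:A|lebesgue. \<Psi> y * V.trunc r (\<lambda>z. indicator \<Omega> z *\<^sub>R \<phi> z) y)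
        = - (LINT z:\<Omega>|lebesgue. \<phi> z \<bullet> S.trunc r \<Psi> z)"
      by (rule fubini_trunc_sets1[OF Psi_int test_function_locally_integrable[OF \<phi>] r A \<Omega> sub])
    finally show ?thesis unfolding split[OF r] by (simp add: algebra_simps)
  qed
  have 1: "((\<lambda>r. LINT y|lebesgue. \<Psi> y * V.trunc r (\<lambda>y. a y *\<^sub>R \<phi> y) y)
      \<longlongrightarrow> (LINT y|lebesgue. \<Psi> y * V.tlim (\<lambda>y. a y *\<^sub>R \<phi> y) y)) (at_right 0)"
    using V.integral_test_tendsto(2)[OF a\<phi> Psi_int] by (simp only: inner_real_def)
  have 2: "((\<lambda>r. LINT z:?B|lebesgue. ((1 - a z) *\<^sub>R \<phi> z) \<bullet> S.trunc r \<Psi> z)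
      \<longlongrightarrow> (LINT z:?B|lebesgue. ((1 - a z) *\<^sub>R \<phi> z) \<bullet> S.tlim \<Psi> z)) (at_right 0)"
    by (rule away(3))
  have "((\<lambda>r. LINT y:A|lebesgue. \<Psi> y * normal \<Omega> r \<phi> y)
      \<longlongrightarrow> c * (LINT y|lebesgue. \<Psi> y * V.tlim (\<lambda>y. a y *\<^sub>R \<phi> y) y)
        + (- c) * (LINT z:?B|lebesgue. ((1 - a z) *\<^sub>R \<phi> z) \<bullet> S.tlim \<Psi> z)) (at_right 0)"
    by (rule Lim_transform_eventually[OF tendsto_add[OF tendsto_mult_left[OF 1] tendsto_mult_left[OF 2]]])
       (auto simp: eventually_at_right_field eq intro!: exI[of _ 1])
  moreover have "c * (LINT y|lebesgue. \<Psi> y * V.tlim (\<lambda>y. a y *\<^sub>R \<phi> y) y)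
        + (- c) * (LINT z:?B|lebesgue. ((1 - a z) *\<^sub>R \<phi> z) \<bullet> S.tlim \<Psi> z) = (LINT z:\<Omega>|lebesgue. \<phi> z \<bullet> H z)"
  proof -
    have h: "((1 - a z) *\<^sub>R \<phi> z) \<bullet> H z = (- c) * (((1 - a z) *\<^sub>R \<phi> z) \<bullet> S.tlim \<Psi> z)" for z by (simp add: H_def)
    have "(LINT z:\<Omega>|lebesgue. \<phi> z \<bullet> H z) = (LINT y|lebesgue. (a y *\<^sub>R \<phi> y) \<bullet> H y)
      + (LINT z:?B|lebesgue. ((1 - a z) *\<^sub>R \<phi> z) \<bullet> H z)"
    proof (rule split_at_center[OF a1 a0 \<rho>(2)])
      show "integrable lebesgue (\<lambda>y. (a y *\<^sub>R \<phi> y) \<bullet> H y)" by (rule test_integrable[OF a\<phi> H_int])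
      show "set_integrable lebesgue ?B (\<lambda>z. ((1 - a z) *\<^sub>R \<phi> z) \<bullet> H z)"
        unfolding h by (rule set_integrable_mult_right) (rule away(1))
    qed
    also have "(LINT y|lebesgue. (a y *\<^sub>R \<phi> y) \<bullet> H y) = c * (LINT y|lebesgue. \<Psi> y * V.tlim (\<lambda>y. a y *\<^sub>R \<phi> y) y)"
      using H_dist[OF a\<phi>] by (simp only: inner_commute)
    also have "(LINT z:?B|lebesgue. ((1 - a z) *\<^sub>R \<phi> z) \<bullet> H z)
        = (- c) * (LINT z:?B|lebesgue. ((1 - a z) *\<^sub>R \<phi> z) \<bullet> S.tlim \<Psi> z)"
      unfolding h by (rule set_integral_mult_right)
    finally show ?thesis by (rule sym)
  qed
  ultimately show ?thesis by simp
qed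

text \<open>On \<open>I\<close> the kernel does not reach outside \<Omega>, so the indicator drops
  out and \<open>normal\<close> is minus a truncated divergence of \<open>H\<close>. The part
  \<open>a\<close> times \<open>v\<close> is dualised to the gradient of a test function and yields
  the Dirac mass through \<open>H_grad\<close>; the other part tends to an integral of the
  divergence of \<open>H\<close> away from \<open>x\<close>, which is 0 almost everywhere.\<close>

lemma normal_limit_H:
  assumes v: "test_function v"
    and I: "bounded I" "I \<in> sets lebesgue"
    and sub: "\<And>y z. y \<in> I \<Longrightarrow> norm (z - y) < \<delta> \<Longrightarrow> z \<in> \<Omega>"
    and \<rho>: "0 < \<rho>" "ball x \<rho> \<subseteq> I"
  shows "((\<lambda>r. LINT y:I|lebesgue. v y * normal \<Omega> r H y) \<longlongrightarrow> - v x) (at_right 0)"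
proof -
  obtain a :: "'a \<Rightarrow> real" and t where a: "test_function a" and t: "0 < t" and a1: "\<And>y. norm (y - x) \<le> t \<Longrightarrow> a y = 1"
    and a0: "\<And>y. \<rho> \<le> norm (y - x) \<Longrightarrow> a y = 0"
    by (rule center_bump[OF eta \<rho>(1)]) blast
  have smooth_a: "smooth_on UNIV a" using a by (simp add: test_function_iff)
  note av = test_function_scaleR[OF smooth_a v]
  note bv = test_function_one_minus[OF a v]
  let ?B = "I - ball x t"
  have B: "bounded ?B" "?B \<in> sets lebesgue" using I by (auto intro: bounded_subset)
  have aw: "t \<le> norm (y - x)" if "y \<in> ?B" for y using that by (auto simp: dist_norm norm_minus_commute)
  note away = V.integral_away_tendsto[OF H_int H_Lipschitz B t aw
      set_integrable_locally[OF test_function_locally_integrable[OF bv] B]]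
  have split: "(LINT y:I|lebesgue. v y \<bullet> V.trunc r H y)
      = - (LINT z|lebesgue. H z \<bullet> S.trunc r (\<lambda>y. a y *\<^sub>R v y) z)
        + (LINT y:?B|lebesgue. ((1 - a y) *\<^sub>R v y) \<bullet> V.trunc r H y)" if r: "0 < r" for r
  proof -
    have "(LINT y:I|lebesgue. v y \<bullet> V.trunc r H y) = (LINT y|lebesgue. (a y *\<^sub>R v y) \<bullet> V.trunc r H y)
        + (LINT y:?B|lebesgue. ((1 - a y) *\<^sub>R v y) \<bullet> V.trunc r H y)"
    proof (rule split_at_center[OF a1 a0 \<rho>(2)])
      show "integrable lebesgue (\<lambda>y. (a y *\<^sub>R v y) \<bullet> V.trunc r H y)"
        by (rule test_integrable[OF av V.trunc_locally_integrable[OF H_int r]])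
      show "set_integrable lebesgue ?B (\<lambda>y. ((1 - a y) *\<^sub>R v y) \<bullet> V.trunc r H y)"
        by (rule away(2)) (use r in auto)
    qed
    also have "(LINT y|lebesgue. (a y *\<^sub>R v y) \<bullet> V.trunc r H y)
        = - (LINT z|lebesgue. H z \<bullet> S.trunc r (\<lambda>y. a y *\<^sub>R v y) z)"
      using fubini_test_scalar[OF r av H_int] by (simp only: inner_real_def)
    finally show ?thesis .
  qed
  have eq: "(LINT y:I|lebesgue. v y * normal \<Omega> r H y)
      = (- c) * (LINT z|lebesgue. H z \<bullet> S.trunc r (\<lambda>y. a y *\<^sub>R v y) z)
        + c * (LINT y:?B|lebesgue. ((1 - a y) *\<^sub>R v y) \<bullet> V.trunc r H y)" if r: "0 < r" for r
  proof -
    have "(LINT y:I|lebesgue. v y * normal \<Omega> r H y) = (LINT y:I|lebesgue. c * (v y \<bullet> V.trunc r H y))"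
      unfolding set_lebesgue_integral_def
    proof (intro Bochner_Integration.integral_cong refl)
      fix y
      have "V.trunc r (\<lambda>z. indicator \<Omega> z *\<^sub>R H z) y = V.trunc r H y" if "y \<in> I"
        using sub[OF that] by (intro V.trunc_local) simp
      then show "indicator I y *\<^sub>R (v y * normal \<Omega> r H y) = indicator I y *\<^sub>R (c * (v y \<bullet> V.trunc r H y))"
        by (cases "y \<in> I") (auto simp: normal_def)
    qed
    also have "\<dots> = c * (LINT y:I|lebesgue. v y \<bullet> V.trunc r H y)" by (rule set_integral_mult_right)
    finally show ?thesis unfolding split[OF r] by (simp add: algebra_simps)
  qed
  have 1: "((\<lambda>r. LINT z|lebesgue. H z \<bullet> S.trunc r (\<lambda>y. a y *\<^sub>R v y) z)
      \<longlongrightarrow> (LINT z|lebesgue. H z \<bullet> S.tlim (\<lambda>y. a y *\<^sub>R v y) z)) (at_right 0)"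
    by (rule S.integral_test_tendsto(2)[OF av H_int])
  have 2: "((\<lambda>r. LINT y:?B|lebesgue. ((1 - a y) *\<^sub>R v y) \<bullet> V.trunc r H y)
      \<longlongrightarrow> (LINT y:?B|lebesgue. ((1 - a y) *\<^sub>R v y) \<bullet> V.tlim H y)) (at_right 0)"
    by (rule away(3))
  have lim: "((\<lambda>r. LINT y:I|lebesgue. v y * normal \<Omega> r H y)
      \<longlongrightarrow> (- c) * (LINT z|lebesgue. H z \<bullet> S.tlim (\<lambda>y. a y *\<^sub>R v y) z)
        + c * (LINT y:?B|lebesgue. ((1 - a y) *\<^sub>R v y) \<bullet> V.tlim H y)) (at_right 0)"
    by (rule Lim_transform_eventually[OF tendsto_add[OF tendsto_mult_left[OF 1] tendsto_mult_left[OF 2]]])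
       (auto simp: eventually_at_right_field eq intro!: exI[of _ 1])
  have far: "c * (LINT y:?B|lebesgue. ((1 - a y) *\<^sub>R v y) \<bullet> V.tlim H y) = 0"
  proof -
    have "c * (LINT y:?B|lebesgue. ((1 - a y) *\<^sub>R v y) \<bullet> V.tlim H y)
        = (LINT y:?B|lebesgue. c * (((1 - a y) *\<^sub>R v y) \<bullet> V.tlim H y))"
      by (rule set_integral_mult_right[symmetric])
    also have "\<dots> = 0"
      unfolding set_lebesgue_integral_def
    proof (rule integral_eq_zero_AE)
      show "AE y in lebesgue. indicator ?B y *\<^sub>R (c * (((1 - a y) *\<^sub>R v y) \<bullet> V.tlim H y)) = 0"
        using div_H by eventually_elim (simp add: mult.left_commute[of c])
    qed
    finally show ?thesis .
  qed
  have near: "(- c) * (LINT z|lebesgue. H z \<bullet> S.tlim (\<lambda>y. a y *\<^sub>R v y) z) = - v x"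
  proof -
    have "(- c) * (LINT z|lebesgue. H z \<bullet> S.tlim (\<lambda>y. a y *\<^sub>R v y) z)
        = (LINT z|lebesgue. H z \<bullet> grad (\<lambda>y. a y *\<^sub>R v y) z)"
      unfolding grad_def inner_scaleR_right by (rule integral_mult_right_zero[symmetric])
    also have "\<dots> = - (a x *\<^sub>R v x)" by (rule H_grad[OF av])
    finally show ?thesis using a1[of x] t by simp
  qed
  show ?thesis using lim unfolding far near by simp
qed

text \<open>\<open>A\<close> and \<open>I\<close> stand for the outer and the inner set of \<Omega>.
  Their geometry enters through the two inclusions at range \<delta> and a ball around
  \<open>x\<close> inside \<open>I\<close>.\<close>

theorem green_limit:
  assumes v: "test_function v"
    and \<Omega>: "bounded \<Omega>" "\<Omega> \<in> sets lebesgue" and A: "bounded A" "A \<in> sets lebesgue"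
    and I: "I \<in> sets lebesgue"
    and subA: "\<And>z y. z \<in> \<Omega> \<Longrightarrow> norm (y - z) < \<delta> \<Longrightarrow> y \<in> A"
    and subI: "\<And>y z. y \<in> I \<Longrightarrow> norm (z - y) < \<delta> \<Longrightarrow> z \<in> \<Omega>"
    and \<rho>: "0 < \<rho>" "ball x \<rho> \<subseteq> I"
  shows "set_integrable lebesgue I (\<lambda>y. \<Psi> y * (- c * V.tlim (grad v) y))"
    and "0 < r \<Longrightarrow> set_integrable lebesgue (A - I) (\<lambda>y. \<Psi> y * normal \<Omega> r (grad v) y - v y * normal \<Omega> r H y)"
    and "((\<lambda>r. LINT y:A - I|lebesgue. \<Psi> y * normal \<Omega> r (grad v) y - v y * normal \<Omega> r H y)
      \<longlongrightarrow> (LINT y:I|lebesgue. \<Psi> y * (- c * V.tlim (grad v) y)) - v x) (at_right 0)"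
proof -
  have I\<Omega>: "I \<subseteq> \<Omega>" using subI delta_pos by auto
  have \<Omega>A: "\<Omega> \<subseteq> A" using subA delta_pos by auto
  have Ib: "bounded I" using \<Omega>(1) I\<Omega> by (rule bounded_subset)
  have \<rho>\<Omega>: "ball x \<rho> \<subseteq> \<Omega>" using \<rho>(2) I\<Omega> by blast
  note Dv = test_grad[OF v]
  note li = test_function_locally_integrable[OF Dv] test_function_locally_integrable[OF v]
  let ?f = "\<lambda>r y. \<Psi> y * normal \<Omega> r (grad v) y" and ?g = "\<lambda>r y. v y * normal \<Omega> r H y"
  have int: "set_integrable lebesgue B (?f r)" "set_integrable lebesgue B (?g r)"
    if "bounded B" "B \<in> sets lebesgue" "0 < r" for B r
    using that by (auto intro!: normal_integrable li H_int Psi_int \<Omega>)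
  have AI: "bounded (A - I)" "A - I \<in> sets lebesgue" using A I by (auto intro: bounded_subset)
  show "set_integrable lebesgue (A - I) (\<lambda>y. ?f r y - ?g r y)" if "0 < r"
    using int[OF AI that] by (rule set_integral_diff(1))
  have f1: "((\<lambda>r. LINT y:A|lebesgue. ?f r y) \<longlongrightarrow> (LINT z:\<Omega>|lebesgue. grad v z \<bullet> H z)) (at_right 0)"
    by (rule normal_limit_Psi[OF Dv \<Omega> A subA \<rho>(1) \<rho>\<Omega>])
  \<comment> \<open>No cut-off at \<open>x\<close> is required here: Fubini puts the truncation on
    the test function \<open>v\<close>, and \<open>H\<close>, restricted to \<Omega>, is the merely
    integrable weight.\<close>
  have g1: "((\<lambda>r. LINT y:A|lebesgue. ?g r y) \<longlongrightarrow> (LINT z:\<Omega>|lebesgue. grad v z \<bullet> H z)) (at_right 0)"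
  proof -
    have H\<Omega>: "locally_integrable (\<lambda>z. indicator \<Omega> z *\<^sub>R H z)" by (rule locally_integrable_restrict[OF H_int \<Omega>(2)])
    have lim: "((\<lambda>r. (- c) * (LINT z|lebesgue. (indicator \<Omega> z *\<^sub>R H z) \<bullet> S.trunc r v z))
        \<longlongrightarrow> (- c) * (LINT z|lebesgue. (indicator \<Omega> z *\<^sub>R H z) \<bullet> S.tlim v z)) (at_right 0)"
      by (rule tendsto_mult_left[OF S.integral_test_tendsto(2)[OF v H\<Omega>]])
    have eq: "(- c) * (LINT z|lebesgue. (indicator \<Omega> z *\<^sub>R H z) \<bullet> S.trunc r v z) = (LINT y:A|lebesgue. ?g r y)"
      if r: "0 < r" for r
    proof -
      have "(LINT y:A|lebesgue. ?g r y) = c * (LINT y:A|lebesgue. v y * V.trunc r (\<lambda>z. indicator \<Omega> z *\<^sub>R H z) y)"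
        unfolding normal_def mult.left_commute[of "v _"] by (rule set_integral_mult_right)
      also have "(LINT y:A|lebesgue. v y * V.trunc r (\<lambda>z. indicator \<Omega> z *\<^sub>R H z) y)
          = - (LINT z:\<Omega>|lebesgue. H z \<bullet> S.trunc r v z)"
        by (rule fubini_trunc_sets1[OF li(2) H_int r A \<Omega> subA])
      finally show ?thesis by (simp add: set_lebesgue_integral_def)
    qed
    have l: "(- c) * (LINT z|lebesgue. (indicator \<Omega> z *\<^sub>R H z) \<bullet> S.tlim v z)
        = (LINT z:\<Omega>|lebesgue. grad v z \<bullet> H z)"
      unfolding set_lebesgue_integral_def grad_def integral_mult_right_zero[symmetric]
      by (intro Bochner_Integration.integral_cong refl) (simp add: inner_commute)
    show ?thesis
      by (rule Lim_transform_eventually[OF lim[unfolded l]])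
        (use eq in \<open>force simp: eventually_at_right_field intro: exI[of _ 1]\<close>)
  qed
  have Psi_I: "locally_integrable (\<lambda>y. indicator I y *\<^sub>R \<Psi> y)" by (rule locally_integrable_restrict[OF Psi_int I])
  note f2' = V.integral_test_tendsto[OF Dv Psi_I]
  have "integrable lebesgue (\<lambda>y. (- c) * ((indicator I y *\<^sub>R \<Psi> y) \<bullet> V.tlim (grad v) y))"
    using f2'(1) by (rule integrable_mult_right)
  then show "set_integrable lebesgue I (\<lambda>y. \<Psi> y * (- c * V.tlim (grad v) y))"
    by (simp add: set_integrable_def mult_ac)
  \<comment> \<open>On \<open>I\<close> the indicator is invisible and the truncation acts on the
    test field \<open>grad v\<close>, so the singular \<Psi> only serves as an integrable
    weight.\<close>
  have f2: "((\<lambda>r. LINT y:I|lebesgue. ?f r y) \<longlongrightarrow> - (LINT y:I|lebesgue. \<Psi> y * (- c * V.tlim (grad v) y))) (at_right 0)"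
  proof -
    have "(LINT y:I|lebesgue. ?f r y) = c * (LINT y|lebesgue. (indicator I y *\<^sub>R \<Psi> y) \<bullet> V.trunc r (grad v) y)" for r
      unfolding set_lebesgue_integral_def integral_mult_right_zero[symmetric]
    proof (intro Bochner_Integration.integral_cong refl)
      fix y
      have "V.trunc r (\<lambda>z. indicator \<Omega> z *\<^sub>R grad v z) y = V.trunc r (grad v) y" if "y \<in> I"
        using subI[OF that] by (intro V.trunc_local) simp
      then show "indicator I y *\<^sub>R ?f r y = c * ((indicator I y *\<^sub>R \<Psi> y) \<bullet> V.trunc r (grad v) y)"
        by (cases "y \<in> I") (auto simp: normal_def)
    qed
    moreover have "- (LINT y:I|lebesgue. \<Psi> y * (- c * V.tlim (grad v) y))
        = c * (LINT y|lebesgue. (indicator I y *\<^sub>R \<Psi> y) \<bullet> V.tlim (grad v) y)"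
      unfolding set_lebesgue_integral_def integral_mult_right_zero[symmetric] Bochner_Integration.integral_minus[symmetric]
      by (intro Bochner_Integration.integral_cong refl) simp
    ultimately show ?thesis using tendsto_mult_left[OF f2'(2), of c] by simp
  qed
  have g2: "((\<lambda>r. LINT y:I|lebesgue. ?g r y) \<longlongrightarrow> - v x) (at_right 0)"
    by (rule normal_limit_H[OF v Ib I subI \<rho>])
  have diff: "(LINT y:A - I|lebesgue. ?f r y - ?g r y)
      = ((LINT y:A|lebesgue. ?f r y) - (LINT y:A|lebesgue. ?g r y)) - ((LINT y:I|lebesgue. ?f r y) - (LINT y:I|lebesgue. ?g r y))"
    if r: "0 < r" for r
  proof -
    have "(LINT y:(A - I) \<union> I|lebesgue. h y) = (LINT y:A - I|lebesgue. h y) + (LINT y:I|lebesgue. h y)"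
      if "set_integrable lebesgue (A - I) h" "set_integrable lebesgue I h" for h :: "'a \<Rightarrow> real"
      using that by (intro set_integral_Un) auto
    moreover have "(A - I) \<union> I = A" using I\<Omega> \<Omega>A by blast
    moreover have "(LINT y:A - I|lebesgue. ?f r y - ?g r y) = (LINT y:A - I|lebesgue. ?f r y) - (LINT y:A - I|lebesgue. ?g r y)"
      using int[OF AI r] by (rule set_integral_diff(2))
    ultimately show ?thesis using int[OF AI r] int[OF Ib I r] by (simp add: algebra_simps)
  qed
  \<comment> \<open>Both integrals over \<open>A\<close> tend to the pairing of
    \<open>grad v\<close> with \<open>H\<close> over \<Omega> and cancel. The double signs stem from
    \<open>normal\<close> being minus a divergence on \<open>I\<close>.\<close>
  have "((\<lambda>r. ((LINT y:A|lebesgue. ?f r y) - (LINT y:A|lebesgue. ?g r y)) - ((LINT y:I|lebesgue. ?f r y) - (LINT y:I|lebesgue. ?g r y)))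
      \<longlongrightarrow> ((LINT z:\<Omega>|lebesgue. grad v z \<bullet> H z) - (LINT z:\<Omega>|lebesgue. grad v z \<bullet> H z))
        - (- (LINT y:I|lebesgue. \<Psi> y * (- c * V.tlim (grad v) y)) - (- v x))) (at_right 0)"
    by (intro tendsto_diff f1 g1 f2 g2)
  then have "((\<lambda>r. ((LINT y:A|lebesgue. ?f r y) - (LINT y:A|lebesgue. ?g r y)) - ((LINT y:I|lebesgue. ?f r y) - (LINT y:I|lebesgue. ?g r y)))
      \<longlongrightarrow> (LINT y:I|lebesgue. \<Psi> y * (- c * V.tlim (grad v) y)) - v x) (at_right 0)" by simp
  then show "((\<lambda>r. LINT y:A - I|lebesgue. ?f r y - ?g r y)
      \<longlongrightarrow> (LINT y:I|lebesgue. \<Psi> y * (- c * V.tlim (grad v) y)) - v x) (at_right 0)"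
    by (rule Lim_transform_eventually) (auto simp: eventually_at_right_field diff intro!: exI[of _ 1])
qed

end

section \<open>Dominated convergence on the collar under finite nonlocal perimeter\<close>

lemma Lipschitz_away_bounded:
  fixes f :: "'a::euclidean_space \<Rightarrow> 'b::real_normed_vector"
  assumes "Lipschitz_away x f" "0 < \<rho>"
  obtains B where "0 \<le> B" "\<And>y. \<rho> \<le> norm (y - x) \<Longrightarrow> norm y \<le> R \<Longrightarrow> norm (f y) \<le> B"
proof -
  obtain L where L: "0 \<le> L" "\<And>y z. \<rho> \<le> norm (y - x) \<Longrightarrow> norm y \<le> R \<Longrightarrow>
    \<rho> \<le> norm (z - x) \<Longrightarrow> norm z \<le> R \<Longrightarrow> norm (f y - f z) \<le> L * norm (y - z)"
    by (rule Lipschitz_awayD[OF assms]) blast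
  show ?thesis
  proof (cases "\<exists>y0. \<rho> \<le> norm (y0 - x) \<and> norm y0 \<le> R")
    case True
    then obtain y0 where y0: "\<rho> \<le> norm (y0 - x)" "norm y0 \<le> R" by blast
    have R: "0 \<le> R" using y0(2) norm_ge_zero order_trans by blast
    have "norm (f y) \<le> norm (f y0) + L * (2 * R)" if y: "\<rho> \<le> norm (y - x)" "norm y \<le> R" for y
    proof -
      have "norm (y - y0) \<le> 2 * R" using y(2) y0(2) norm_triangle_ineq4[of y y0] by simp
      then have "norm (f y - f y0) \<le> L * (2 * R)"
        using L(2)[OF y y0] mult_left_mono[OF _ L(1)] order_trans by blast
      then show ?thesis using norm_triangle_ineq2[of "f y" "f y0"] by simp
    qed
    moreover have "0 \<le> norm (f y0) + L * (2 * R)" using L(1) R by simp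
    ultimately show ?thesis using that by blast
  next
    case False
    then show ?thesis using that[of 0] by auto
  qed
qed

text \<open>A version of the truncation limit for fields that are not Lipschitz, such as a field cut
  off at the frontier of \<Omega>. An integrable majorant of the difference times the near kernel
  replaces the Lipschitz bound, and the resulting estimate is uniform in \<open>r\<close>.\<close>

lemma (in kernel_product) trunc_dominated:
  assumes f: "locally_integrable f" and \<rho>: "0 < \<rho>" and h: "integrable lebesgue h"
    and dom: "\<And>z. norm (f z - f y) * norm (Kn \<rho> (y - z)) \<le> h z"
  shows "((\<lambda>r. trunc r f y) \<longlongrightarrow> tlim f y) (at_right 0)"
    and "0 < r \<Longrightarrow> r \<le> \<rho> \<Longrightarrow> norm (trunc r f y) \<le> norm (trunc \<rho> f y) + (LINT z|lebesgue. h z)"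
proof -
  let ?q = "\<lambda>z. pr (f z - f y) (Kn \<rho> (y - z))"
  have qh: "norm (?q z) \<le> h z" for z using norm_pr dom by (rule order_trans)
  have m: "f \<in> borel_measurable lebesgue" using f by (rule locally_integrable_measurable)
  have qm: "?q \<in> borel_measurable lebesgue"
    by (intro pr_measurable Kn_shift_measurable borel_measurable_diff m borel_measurable_const)
  have q: "integrable lebesgue ?q"
    using h qm by (rule Bochner_Integration.integrable_bound) (auto intro!: AE_I2 order_trans[OF qh])
  have q': "set_integrable lebesgue UNIV ?q" using q by (simp add: set_integrable_def)
  have k0: "(LINT z|lebesgue. pr (f y) (Kt s (y - z))) = 0" if "0 < s" for s
    using integral_bounded_linear[OF bounded_linear_right Kt_shift_integrable[OF that]]
    by (simp add: Kt_integral_zero zero_right)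
  have k: "integrable lebesgue (\<lambda>z. pr (f y) (Kt s (y - z)))" if "0 < s" for s
    by (rule integrable_bounded_linear[OF bounded_linear_right Kt_shift_integrable[OF that]])
  \<comment> \<open>Oddness allows \<open>f y\<close> to be subtracted in both truncations; their
    difference is then the integral of \<open>?q\<close> outside the ball of radius
    \<open>r\<close>, since \<open>?q\<close> already vanishes beyond \<rho>.\<close>
  have eq: "trunc r f y = trunc \<rho> f y + (LINT z:UNIV - ball y r|lebesgue. ?q z)" if r: "0 < r" "r \<le> \<rho>" for r
  proof -
    have pt: "indicator (UNIV - ball y r) z *\<^sub>R ?q z = (pr (f z) (Kt r (y - z)) - pr (f z) (Kt \<rho> (y - z)))
        - (pr (f y) (Kt r (y - z)) - pr (f y) (Kt \<rho> (y - z)))" for z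
    proof -
      have "indicator (UNIV - ball y r) z *\<^sub>R Kn \<rho> (y - z) = Kt r (y - z) - Kt \<rho> (y - z)"
        using r by (auto simp: Kt_def Kn_def indicator_def dist_norm norm_minus_commute)
      then show ?thesis by (simp only: scaleR_right[symmetric]) (simp add: diff_left diff_right)
    qed
    note i = trunc_integrable[OF f r(1), of y] trunc_integrable[OF f \<rho>, of y]
    have "(LINT z:UNIV - ball y r|lebesgue. ?q z) = (trunc r f y - trunc \<rho> f y) - (0 - 0)"
      unfolding set_lebesgue_integral_def pt trunc_def k0[OF r(1), symmetric]
      using i k[OF r(1)] k[OF \<rho>] by (simp add: k0[OF \<rho>] k0[OF r(1)])
    then show ?thesis by simp
  qed
  have lim: "((\<lambda>r. LINT z:UNIV - ball y r|lebesgue. ?q z) \<longlongrightarrow> (LINT z:UNIV|lebesgue. ?q z)) (at_right 0)"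
    by (rule set_integral_Diff_ball_tendsto[OF _ q']) simp
  have "((\<lambda>r. trunc r f y) \<longlongrightarrow> trunc \<rho> f y + (LINT z:UNIV|lebesgue. ?q z)) (at_right 0)"
  proof (rule Lim_transform_eventually[OF tendsto_add[OF tendsto_const lim]])
    show "\<forall>\<^sub>F r in at_right 0. trunc \<rho> f y + (LINT z:UNIV - ball y r|lebesgue. ?q z) = trunc r f y"
      unfolding eventually_at_right_field
    proof (intro exI[of _ \<rho>] conjI allI impI \<rho>)
      fix r :: real assume "0 < r" "r < \<rho>"
      then show "trunc \<rho> f y + (LINT z:UNIV - ball y r|lebesgue. ?q z) = trunc r f y"
        by (intro eq[symmetric]) auto
    qed
  qed
  moreover from this have "tlim f y = trunc \<rho> f y + (LINT z:UNIV|lebesgue. ?q z)"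
    unfolding tlim_def by (intro tendsto_Lim) auto
  ultimately show "((\<lambda>r. trunc r f y) \<longlongrightarrow> tlim f y) (at_right 0)" by simp
  show "norm (trunc r f y) \<le> norm (trunc \<rho> f y) + (LINT z|lebesgue. h z)" if r: "0 < r" "r \<le> \<rho>"
  proof -
    have "norm (LINT z:UNIV - ball y r|lebesgue. ?q z) \<le> (LINT z|lebesgue. h z)"
      unfolding set_lebesgue_integral_def
    proof (rule Bochner_Integration.integral_norm_bound_integral[OF _ h])
      show "integrable lebesgue (\<lambda>z. indicator (UNIV - ball y r) z *\<^sub>R ?q z)"
        by (rule integrable_mult_indicator[OF _ q]) auto
      show "norm (indicator (UNIV - ball y r) z *\<^sub>R ?q z) \<le> h z" for z
        using qh[of z] order_trans[OF norm_ge_zero qh, of z] by (cases "z \<in> ball y r") simp_all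
    qed
    then show ?thesis
      unfolding eq[OF r] using norm_triangle_ineq[of "trunc \<rho> f y" "LINT z:UNIV - ball y r|lebesgue. ?q z"] by simp
  qed
qed

context odd_kernel
begin

text \<open>Integrated in \<open>z\<close>, this is the kernel mass between \<open>y\<close> and the
  other side of the frontier; integrated in both variables, it is twice the nonlocal perimeter of
  \<Omega>.\<close>

definition jump :: "'a set \<Rightarrow> 'a \<Rightarrow> 'a \<Rightarrow> real"
  where "jump \<Omega> y z = \<bar>indicator \<Omega> y - indicator \<Omega> z\<bar> * norm (K (y - z))"

text \<open>The perimeter only sees pairs with the first point in \<Omega> and the second outside.
  As the norm of an odd kernel is even, adding the same integrand with its variables swapped gives
  \<open>jump\<close>, and Fubini on the product yields both claims.\<close>

lemma jump_integrable:
  assumes \<Omega>: "\<Omega> \<in> sets lebesgue"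
    and fin: "(\<integral>\<^sup>+ y\<in>\<Omega>. (\<integral>\<^sup>+ z\<in>- \<Omega>. ennreal (norm (K (y - z))) \<partial>lebesgue) \<partial>lebesgue) < \<infinity>"
  shows "AE y in lebesgue. integrable lebesgue (jump \<Omega> y)"
    and "integrable lebesgue (\<lambda>y. LINT z|lebesgue. jump \<Omega> y z)"
proof -
  interpret L: sigma_finite_measure "lebesgue :: 'a measure" by (rule sigma_finite_lebesgue)
  interpret P: pair_sigma_finite "lebesgue :: 'a measure" "lebesgue :: 'a measure" ..
  let ?P = "(lebesgue :: 'a measure) \<Otimes>\<^sub>M (lebesgue :: 'a measure)"
  have id: "(\<lambda>z::'a. z) \<in> borel_measurable lebesgue" by (rule measurable_lebesgue_ident)
  have "(\<lambda>p. fst p - snd p) \<in> borel_measurable ?P"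
    by (intro borel_measurable_diff measurable_compose[OF measurable_fst id] measurable_compose[OF measurable_snd id])
  then have km: "(\<lambda>p. K (fst p - snd p)) \<in> borel_measurable ?P"
    by (rule borel_measurable_lebesgue_compose[OF K_measurable])
  have im: "(indicator \<Omega> :: 'a \<Rightarrow> real) \<in> borel_measurable lebesgue"
    using \<Omega> by (rule borel_measurable_indicator)
  note i1 = measurable_compose[OF measurable_fst im] and i2 = measurable_compose[OF measurable_snd im]
  let ?q = "\<lambda>p. indicator \<Omega> (fst p) * (1 - indicator \<Omega> (snd p)) * norm (K (fst p - snd p)) :: real"
  have qm: "?q \<in> borel_measurable ?P"
    using i1 i2 km by (intro borel_measurable_times borel_measurable_diff borel_measurable_const
        measurable_compose[OF km borel_measurable_norm]) auto
  have q0: "0 \<le> ?q p" for p by (auto simp: indicator_def)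
  have "(\<integral>\<^sup>+ p. ennreal (?q p) \<partial>?P) = (\<integral>\<^sup>+ y. \<integral>\<^sup>+ z. ennreal (?q (y, z)) \<partial>lebesgue \<partial>lebesgue)"
    using L.nn_integral_fst[of "\<lambda>p. ennreal (?q p)" lebesgue] qm by simp
  also have "\<dots> = (\<integral>\<^sup>+ y\<in>\<Omega>. (\<integral>\<^sup>+ z\<in>- \<Omega>. ennreal (norm (K (y - z))) \<partial>lebesgue) \<partial>lebesgue)"
  proof (intro nn_integral_cong)
    fix y
    show "(\<integral>\<^sup>+ z. ennreal (?q (y, z)) \<partial>lebesgue)
        = (\<integral>\<^sup>+ z\<in>- \<Omega>. ennreal (norm (K (y - z))) \<partial>lebesgue) * indicator \<Omega> y"
    proof (cases "y \<in> \<Omega>")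
      case True
      then show ?thesis by (auto intro!: nn_integral_cong simp: indicator_def)
    qed simp
  qed
  finally have qfin: "(\<integral>\<^sup>+ p. ennreal (?q p) \<partial>?P) < \<infinity>" using fin by simp
  have qi: "integrable ?P ?q"
    by (rule integrableI_nonneg[OF qm]) (use q0 qfin in auto)
  have "integrable ?P (\<lambda>(y, z). ?q (z, y))"
    using qi by (subst P.integrable_product_swap_iff) (simp add: case_prod_beta')
  then have "integrable ?P (\<lambda>p. ?q p + ?q (snd p, fst p))"
    using qi by (simp add: case_prod_beta')
  moreover have "?q p + ?q (snd p, fst p) = jump \<Omega> (fst p) (snd p)" for p
  proof -
    have "K (snd p - fst p) = - K (fst p - snd p)" using K_odd[of "fst p - snd p"] by simp
    then have "norm (K (snd p - fst p)) = norm (K (fst p - snd p))" by simp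
    then show ?thesis by (auto simp: jump_def indicator_def)
  qed
  ultimately have "integrable ?P (case_prod (jump \<Omega>))" by (simp add: case_prod_beta')
  from P.AE_integrable_fst[OF this] P.integrable_fst[OF this]
  show "AE y in lebesgue. integrable lebesgue (jump \<Omega> y)"
    and "integrable lebesgue (\<lambda>y. LINT z|lebesgue. jump \<Omega> y z)" by auto
qed

text \<open>The oscillation of the restricted field near \<open>y\<close> has two sources: that of
  \<phi>, which is Lipschitz and is paid for by the moment, and the jump of the indicator times the
  size of \<phi>, which is paid for by \<open>jump\<close>. The far part is bounded uniformly in
  \<open>y\<close>. None of the bounds depends on \<open>r\<close>.\<close>

lemma restricted_field_estimate:
  assumes \<phi>: "locally_integrable \<phi>" and lip: "Lipschitz_away x \<phi>"
    and \<Omega>: "bounded \<Omega>" "\<Omega> \<in> sets lebesgue" and \<rho>: "0 < \<rho>"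
  obtains M B where "0 \<le> M" "0 \<le> B"
    "\<And>y. \<rho> \<le> norm (y - x) \<Longrightarrow> norm y \<le> R \<Longrightarrow> integrable lebesgue (jump \<Omega> y) \<Longrightarrow>
      ((\<lambda>r. V.trunc r (\<lambda>z. indicator \<Omega> z *\<^sub>R \<phi> z) y) \<longlongrightarrow> V.tlim (\<lambda>z. indicator \<Omega> z *\<^sub>R \<phi> z) y) (at_right 0)"
    "\<And>y r. \<rho> \<le> norm (y - x) \<Longrightarrow> norm y \<le> R \<Longrightarrow> integrable lebesgue (jump \<Omega> y) \<Longrightarrow> 0 < r \<Longrightarrow> r \<le> \<rho> / 2 \<Longrightarrow>
      \<bar>V.trunc r (\<lambda>z. indicator \<Omega> z *\<^sub>R \<phi> z) y\<bar> \<le> M + B * (LINT z|lebesgue. jump \<Omega> y z)"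
proof -
  let ?f = "\<lambda>z. indicator \<Omega> z *\<^sub>R \<phi> z"
  have fi: "integrable lebesgue ?f" using set_integrable_locally[OF \<phi> \<Omega>] by (simp add: set_integrable_def)
  note fl = integrable_imp_locally_integrable[OF fi]
  have \<rho>2: "0 < \<rho> / 2" using \<rho> by simp
  obtain L where L: "0 \<le> L" "\<And>y z. \<rho> \<le> norm (y - x) \<Longrightarrow> norm y \<le> R \<Longrightarrow> norm (z - y) < \<rho> / 2 \<Longrightarrow>
      norm (\<phi> z - \<phi> y) \<le> L * norm (z - y)"
    by (rule V.Lipschitz_away_trunc[OF \<phi> lip \<rho>]) blast
  obtain B0 where B0: "0 \<le> B0" "\<And>y. \<rho> \<le> norm (y - x) \<Longrightarrow> norm y \<le> R \<Longrightarrow> norm (\<phi> y) \<le> B0"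
    by (rule Lipschitz_away_bounded[OF lip \<rho>]) blast
  obtain M0 where M0: "\<And>y. norm (V.trunc (\<rho> / 2) ?f y) \<le> M0" using V.trunc_bounded[OF fi \<rho>2] by blast
  \<comment> \<open>\<open>B0\<close> bounds \<phi> only on the region off \<open>x\<close>. Points
    within \<open>\<rho> / 2\<close> of it may leave the region, and the Lipschitz estimate adds at
    most \<open>L * (\<rho> / 2)\<close> there.\<close>
  define B where "B = B0 + L * (\<rho> / 2)"
  define h where "h y z = L * (norm (z - y) * norm (Kn (\<rho> / 2) (y - z))) + B * jump \<Omega> y z" for y z
  have B: "0 \<le> B" "B0 \<le> B" using B0(1) L(1) \<rho> by (auto simp: B_def)
  have dom: "norm (?f z - ?f y) * norm (Kn (\<rho> / 2) (y - z)) \<le> h y z"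
    if y: "\<rho> \<le> norm (y - x)" "norm y \<le> R" for y z
  proof (cases "norm (z - y) < \<rho> / 2")
    case True
    have lz: "norm (\<phi> z - \<phi> y) \<le> L * norm (z - y)" using L(2)[OF y True] .
    have "L * norm (z - y) \<le> L * (\<rho> / 2)" using True L(1) by (intro mult_left_mono) auto
    then have bz: "norm (\<phi> z) \<le> B" "norm (\<phi> y) \<le> B"
      using lz B0(2)[OF y] B(2) norm_triangle_ineq2[of "\<phi> z" "\<phi> y"] by (auto simp: B_def)
    have "norm (?f z - ?f y) \<le> L * norm (z - y) + B * \<bar>indicator \<Omega> y - indicator \<Omega> z\<bar>"
      using lz bz mult_nonneg_nonneg[OF L(1) norm_ge_zero[of "z - y"]]
      by (cases "y \<in> \<Omega>"; cases "z \<in> \<Omega>") simp_all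
    then have "norm (?f z - ?f y) * norm (Kn (\<rho> / 2) (y - z))
        \<le> (L * norm (z - y) + B * \<bar>indicator \<Omega> y - indicator \<Omega> z\<bar>) * norm (Kn (\<rho> / 2) (y - z))"
      by (rule mult_right_mono) simp
    also have "\<dots> = L * (norm (z - y) * norm (Kn (\<rho> / 2) (y - z))) + B * (\<bar>indicator \<Omega> y - indicator \<Omega> z\<bar> * norm (Kn (\<rho> / 2) (y - z)))"
      by (simp add: algebra_simps)
    also have "\<dots> \<le> h y z"
      unfolding h_def jump_def using B(1)
      by (intro add_left_mono mult_left_mono) (auto simp: Kn_def indicator_def)
    finally show ?thesis .
  next
    case False
    then have "Kn (\<rho> / 2) (y - z) = 0" by (auto simp: Kn_def indicator_def norm_minus_commute)
    moreover have "0 \<le> B * jump \<Omega> y z" using B(1) by (auto simp: jump_def)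
    ultimately show ?thesis by (simp add: h_def)
  qed
  have hi: "integrable lebesgue (h y)" if "integrable lebesgue (jump \<Omega> y)" for y
    unfolding h_def[abs_def] using that moment_shift_integrable by (intro Bochner_Integration.integrable_add integrable_mult_right)
  have hv: "(LINT z|lebesgue. h y z) = L * moment (\<rho> / 2) + B * (LINT z|lebesgue. jump \<Omega> y z)"
    if "integrable lebesgue (jump \<Omega> y)" for y
    unfolding h_def using that moment_shift_integrable[of y "\<rho> / 2"] by (simp add: moment_shift)
  show ?thesis
  proof (rule that[of "\<bar>M0\<bar> + L * moment (\<rho> / 2)" B])
    show "0 \<le> \<bar>M0\<bar> + L * moment (\<rho> / 2)" using L(1) moment_nonneg by simp
    show "0 \<le> B" by (rule B(1))
    fix y assume y: "\<rho> \<le> norm (y - x)" "norm y \<le> R" and j: "integrable lebesgue (jump \<Omega> y)"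
    note * = V.trunc_dominated[OF fl \<rho>2 hi[OF j] dom[OF y]]
    show "((\<lambda>r. V.trunc r ?f y) \<longlongrightarrow> V.tlim ?f y) (at_right 0)" by (rule *(1))
    fix r :: real assume "0 < r" "r \<le> \<rho> / 2"
    then have "\<bar>V.trunc r ?f y\<bar> \<le> \<bar>V.trunc (\<rho> / 2) ?f y\<bar> + (LINT z|lebesgue. h y z)" using *(2) by simp
    then show "\<bar>V.trunc r ?f y\<bar> \<le> \<bar>M0\<bar> + L * moment (\<rho> / 2) + B * (LINT z|lebesgue. jump \<Omega> y z)"
      using M0[of y] hv[OF j] by simp
  qed
qed

end

context green_data
begin

definition normal_pv :: "'a set \<Rightarrow> ('a \<Rightarrow> 'a) \<Rightarrow> 'a \<Rightarrow> real"
  where "normal_pv \<Omega> \<phi> y = c * V.tlim (\<lambda>z. indicator \<Omega> z *\<^sub>R \<phi> z) y"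

text \<open>The ball around \<open>x\<close> lies in \<open>I\<close>, so on the collar \<Psi> is
  bounded and \<open>H\<close> is Lipschitz and only the jump of the indicator is left to control.
  The truncated integrands are bounded by a constant on the collar plus a multiple of the jump mass,
  which the perimeter makes integrable in \<open>y\<close>.\<close>

theorem green_identity:
  assumes v: "test_function v"
    and \<Omega>: "bounded \<Omega>" "\<Omega> \<in> sets lebesgue" and A: "bounded A" "A \<in> sets lebesgue"
    and I: "I \<in> sets lebesgue"
    and subA: "\<And>z y. z \<in> \<Omega> \<Longrightarrow> norm (y - z) < \<delta> \<Longrightarrow> y \<in> A"
    and subI: "\<And>y z. y \<in> I \<Longrightarrow> norm (z - y) < \<delta> \<Longrightarrow> z \<in> \<Omega>"
    and \<rho>: "0 < \<rho>" "ball x \<rho> \<subseteq> I"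
    and fin: "(\<integral>\<^sup>+ y\<in>\<Omega>. (\<integral>\<^sup>+ z\<in>- \<Omega>. ennreal (norm (K (y - z))) \<partial>lebesgue) \<partial>lebesgue) < \<infinity>"
  shows "AE y in lebesgue. y \<in> A - I \<longrightarrow>
      ((\<lambda>r. V.trunc r (\<lambda>z. indicator \<Omega> z *\<^sub>R grad v z) y) \<longlongrightarrow> V.tlim (\<lambda>z. indicator \<Omega> z *\<^sub>R grad v z) y) (at_right 0) \<and>
      ((\<lambda>r. V.trunc r (\<lambda>z. indicator \<Omega> z *\<^sub>R H z) y) \<longlongrightarrow> V.tlim (\<lambda>z. indicator \<Omega> z *\<^sub>R H z) y) (at_right 0)"
    and "set_integrable lebesgue (A - I) (\<lambda>y. \<Psi> y * normal_pv \<Omega> (grad v) y - v y * normal_pv \<Omega> H y)"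
    and "(LINT y:I|lebesgue. \<Psi> y * (- c * V.tlim (grad v) y)) - v x
      = (LINT y:A - I|lebesgue. \<Psi> y * normal_pv \<Omega> (grad v) y - v y * normal_pv \<Omega> H y)"
proof -
  let ?C = "A - I"
  obtain R where R: "\<And>y. y \<in> A \<Longrightarrow> norm y \<le> R" using A(1) unfolding bounded_iff by blast
  have C: "?C \<in> sets lebesgue" using A I by auto
  have aw: "\<rho> \<le> norm (y - x)" "norm y \<le> R" if "y \<in> ?C" for y
    using that \<rho>(2) R by (auto simp: dist_norm norm_minus_commute subset_iff not_less[symmetric])
  note Dv = test_grad[OF v]
  let ?F = "\<lambda>z. indicator \<Omega> z *\<^sub>R grad v z" and ?G = "\<lambda>z. indicator \<Omega> z *\<^sub>R H z"
  let ?J = "\<lambda>y. LINT z|lebesgue. jump \<Omega> y z"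
  note J = jump_integrable[OF \<Omega>(2) fin]
  obtain M1 B1 where M1: "0 \<le> M1" "0 \<le> B1"
    "\<And>y. \<rho> \<le> norm (y - x) \<Longrightarrow> norm y \<le> R \<Longrightarrow> integrable lebesgue (jump \<Omega> y) \<Longrightarrow>
      ((\<lambda>r. V.trunc r ?F y) \<longlongrightarrow> V.tlim ?F y) (at_right 0)"
    "\<And>y r. \<rho> \<le> norm (y - x) \<Longrightarrow> norm y \<le> R \<Longrightarrow> integrable lebesgue (jump \<Omega> y) \<Longrightarrow> 0 < r \<Longrightarrow> r \<le> \<rho> / 2 \<Longrightarrow>
      \<bar>V.trunc r ?F y\<bar> \<le> M1 + B1 * ?J y"
    by (rule restricted_field_estimate[OF test_function_locally_integrable[OF Dv]
          test_function_Lipschitz_away[OF Dv] \<Omega> \<rho>(1)]) blast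
  obtain M2 B2 where M2: "0 \<le> M2" "0 \<le> B2"
    "\<And>y. \<rho> \<le> norm (y - x) \<Longrightarrow> norm y \<le> R \<Longrightarrow> integrable lebesgue (jump \<Omega> y) \<Longrightarrow>
      ((\<lambda>r. V.trunc r ?G y) \<longlongrightarrow> V.tlim ?G y) (at_right 0)"
    "\<And>y r. \<rho> \<le> norm (y - x) \<Longrightarrow> norm y \<le> R \<Longrightarrow> integrable lebesgue (jump \<Omega> y) \<Longrightarrow> 0 < r \<Longrightarrow> r \<le> \<rho> / 2 \<Longrightarrow>
      \<bar>V.trunc r ?G y\<bar> \<le> M2 + B2 * ?J y"
    by (rule restricted_field_estimate[OF H_int H_Lipschitz \<Omega> \<rho>(1)]) blast
  obtain B3 where B3: "0 \<le> B3" "\<And>y. \<rho> \<le> norm (y - x) \<Longrightarrow> norm y \<le> R \<Longrightarrow> norm (\<Psi> y) \<le> B3"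
    by (rule Lipschitz_away_bounded[OF Psi_Lipschitz \<rho>(1)]) blast
  obtain B4 where B4: "0 < B4" "\<And>y. norm (v y) \<le> B4" by (rule test_function_bounded[OF v]) blast
  show lim: "AE y in lebesgue. y \<in> ?C \<longrightarrow>
      ((\<lambda>r. V.trunc r ?F y) \<longlongrightarrow> V.tlim ?F y) (at_right 0) \<and> ((\<lambda>r. V.trunc r ?G y) \<longlongrightarrow> V.tlim ?G y) (at_right 0)"
    using J(1) by eventually_elim (use M1(3) M2(3) aw in blast)
  \<comment> \<open>Every member of the sequence stays within \<open>\<rho> / 2\<close>, the range
    in which the uniform estimates are valid.\<close>
  define \<epsilon> where "\<epsilon> n = \<rho> / 2 * inverse (real (Suc n))" for n
  have \<epsilon>: "0 < \<epsilon> n" "\<epsilon> n \<le> \<rho> / 2" for n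
  proof -
    show "0 < \<epsilon> n" using \<rho>(1) by (simp add: \<epsilon>_def)
    have "inverse (real (Suc n)) \<le> 1" by (simp add: inverse_le_1_iff)
    then show "\<epsilon> n \<le> \<rho> / 2" unfolding \<epsilon>_def using \<rho>(1) by (intro mult_left_le) auto
  qed
  have \<epsilon>0: "filterlim \<epsilon> (at_right 0) sequentially"
    unfolding filterlim_at
  proof (intro conjI)
    show "\<forall>\<^sub>F n in sequentially. \<epsilon> n \<in> {0<..} \<and> \<epsilon> n \<noteq> 0" using \<epsilon>(1) by (simp add: less_imp_neq[symmetric])
    show "\<epsilon> \<longlonglongrightarrow> 0" unfolding \<epsilon>_def[abs_def]
      by (rule tendsto_mult_right_zero[OF LIMSEQ_inverse_real_of_nat])
  qed
  define U where "U r y = \<Psi> y * normal \<Omega> r (grad v) y - v y * normal \<Omega> r H y" for r y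
  define U0 where "U0 y = \<Psi> y * normal_pv \<Omega> (grad v) y - v y * normal_pv \<Omega> H y" for y
  have "set_integrable lebesgue ?C (\<lambda>y. U (\<epsilon> n) y)" for n
    unfolding U_def by (rule green_limit(2)[OF v \<Omega> A I _ _ \<rho> \<epsilon>(1)]) (use subA subI in blast)+
  then have Ui: "integrable lebesgue (\<lambda>y. indicator ?C y *\<^sub>R U (\<epsilon> n) y)" for n
    unfolding set_integrable_def .
  have gl: "((\<lambda>r. LINT y:?C|lebesgue. U r y)
      \<longlongrightarrow> (LINT y:I|lebesgue. \<Psi> y * (- c * V.tlim (grad v) y)) - v x) (at_right 0)"
    unfolding U_def by (rule green_limit(3)[OF v \<Omega> A I _ _ \<rho>]) (use subA subI in blast)+
  have conv: "AE y in lebesgue. (\<lambda>n. indicator ?C y *\<^sub>R U (\<epsilon> n) y) \<longlonglongrightarrow> indicator ?C y *\<^sub>R U0 y"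
    using lim
  proof eventually_elim
    case (elim y)
    show ?case
    proof (cases "y \<in> ?C")
      case True
      have t: "(\<lambda>n. V.trunc (\<epsilon> n) ?F y) \<longlonglongrightarrow> V.tlim ?F y" "(\<lambda>n. V.trunc (\<epsilon> n) ?G y) \<longlonglongrightarrow> V.tlim ?G y"
        using elim True by (auto intro: filterlim_compose[OF _ \<epsilon>0])
      show ?thesis unfolding U_def U0_def normal_def normal_pv_def
        by (intro tendsto_scaleR tendsto_diff tendsto_mult tendsto_const t)
    qed simp
  qed
  let ?w = "\<lambda>y. indicator ?C y * (B3 * (\<bar>c\<bar> * M1) + B4 * (\<bar>c\<bar> * M2)) + (B3 * (\<bar>c\<bar> * B1) + B4 * (\<bar>c\<bar> * B2)) * ?J y"
  have w: "integrable lebesgue ?w"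
  proof (intro Bochner_Integration.integrable_add integrable_mult_right J(2) integrable_mult_left)
    have "?C \<in> lmeasurable" using A(1) C by (intro bounded_set_imp_lmeasurable bounded_subset[OF A(1)]) auto
    then show "integrable lebesgue (indicator ?C :: 'a \<Rightarrow> real)" by (simp add: lmeasurable_iff_integrable)
  qed
  have bound: "AE y in lebesgue. norm (indicator ?C y *\<^sub>R U (\<epsilon> n) y) \<le> ?w y" for n
    using J(1)
  proof eventually_elim
    case (elim y)
    have J0: "0 \<le> ?J y" by (rule integral_nonneg_AE) (simp add: jump_def)
    show ?case
    proof (cases "y \<in> ?C")
      case True
      note a = aw[OF True]
      have "\<bar>\<Psi> y * (c * V.trunc (\<epsilon> n) ?F y)\<bar> \<le> B3 * (\<bar>c\<bar> * (M1 + B1 * ?J y))"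
        unfolding abs_mult using B3(2)[OF a] M1(4)[OF a elim \<epsilon>] by (intro mult_mono) (auto simp: B3)
      moreover have "\<bar>v y * (c * V.trunc (\<epsilon> n) ?G y)\<bar> \<le> B4 * (\<bar>c\<bar> * (M2 + B2 * ?J y))"
        unfolding abs_mult using B4 M2(4)[OF a elim \<epsilon>] by (intro mult_mono) (auto simp: less_imp_le)
      ultimately have "\<bar>U (\<epsilon> n) y\<bar> \<le> B3 * (\<bar>c\<bar> * (M1 + B1 * ?J y)) + B4 * (\<bar>c\<bar> * (M2 + B2 * ?J y))"
        unfolding U_def normal_def by linarith
      then show ?thesis using True by (simp add: algebra_simps)
    next
      case False
      then show ?thesis using J0 B3(1) B4(1) M1(2) M2(2) by simp
    qed
  qed
  \<comment> \<open>The principal values are defined by \<open>Lim\<close> at each point separately;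
    their measurability comes from agreeing almost everywhere with a limit of measurable
    truncations.\<close>
  have U0m: "(\<lambda>y. indicator ?C y *\<^sub>R U0 y) \<in> borel_measurable lebesgue"
  proof (rule borel_measurable_AE)
    show "(\<lambda>y. lim (\<lambda>n. indicator ?C y *\<^sub>R U (\<epsilon> n) y)) \<in> borel_measurable lebesgue"
      using Ui by (intro borel_measurable_lim_metric borel_measurable_integrable)
    show "AE y in lebesgue. lim (\<lambda>n. indicator ?C y *\<^sub>R U (\<epsilon> n) y) = indicator ?C y *\<^sub>R U0 y"
      using conv by eventually_elim (rule limI)
  qed
  note dct = U0m borel_measurable_integrable[OF Ui] w conv bound
  show "set_integrable lebesgue ?C (\<lambda>y. \<Psi> y * normal_pv \<Omega> (grad v) y - v y * normal_pv \<Omega> H y)"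
    unfolding set_integrable_def U0_def[symmetric] by (rule integrable_dominated_convergence[OF dct])
  have "(\<lambda>n. LINT y|lebesgue. indicator ?C y *\<^sub>R U (\<epsilon> n) y) \<longlonglongrightarrow> (LINT y|lebesgue. indicator ?C y *\<^sub>R U0 y)"
    by (rule integral_dominated_convergence[OF dct])
  moreover have "(\<lambda>n. LINT y:?C|lebesgue. U (\<epsilon> n) y)
      \<longlonglongrightarrow> (LINT y:I|lebesgue. \<Psi> y * (- c * V.tlim (grad v) y)) - v x"
    by (rule filterlim_compose[OF gl \<epsilon>0])
  ultimately show "(LINT y:I|lebesgue. \<Psi> y * (- c * V.tlim (grad v) y)) - v x
      = (LINT y:?C|lebesgue. \<Psi> y * normal_pv \<Omega> (grad v) y - v y * normal_pv \<Omega> H y)"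
    unfolding set_lebesgue_integral_def U0_def[symmetric] using LIMSEQ_unique by blast
qed

end

subsection \<open>The truncated Riesz kernel\<close>

text \<open>On the dyadic shell between \<open>r (Suc k)\<close> and \<open>r k\<close> the function
  is at most \<open>c k\<close>, and the shell lies in the ball of radius \<open>r k\<close>. The
  products of bound and volume form a geometric series of ratio \<open>2 powr (q - n)\<close>, which
  is below 1 exactly when the exponent is below the dimension.\<close>

lemma integrable_riesz_dyadic:
  fixes q :: real
  assumes "0 < \<delta>" "0 \<le> q" "q < real DIM('a::euclidean_space)"
  shows "integrable lebesgue (\<lambda>h::'a. indicator (ball 0 \<delta>) h * norm h powr (- q))"
proof -
  let ?n = "DIM('a)"
  define x where "x = 2 powr (q - ?n)"
  have x: "0 < x" "x < 1" using assms(3) by (auto simp: x_def intro: powr_less_one)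
  \<comment> \<open>The term for \<open>k = 0\<close>: the bound \<open>c 0\<close> times the volume
    of the ball of radius \<delta>.\<close>
  define D where "D = (\<delta> / 2) powr (- q) * (unit_ball_vol ?n * \<delta> ^ ?n)"
  define r where "r k = \<delta> * (1 / 2) ^ k" for k :: nat
  have r: "0 < r k" for k using assms(1) by (simp add: r_def)
  define c where "c k = (r (Suc k)) powr (- q)" for k
  have cr: "c k * (unit_ball_vol ?n * r k ^ ?n) = D * x ^ k" for k
  proof -
    have half: "(1 / 2) ^ k = 2 powr (- real k)"
      by (simp add: powr_minus powr_realpow power_one_over inverse_eq_divide)
    then have rS: "r (Suc k) = (\<delta> / 2) * 2 powr (- real k)" by (simp add: r_def)
    have "c k = (\<delta> / 2) powr (- q) * (2 powr (- real k)) powr (- q)"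
      unfolding c_def rS by (rule powr_mult)
    also have "(2 powr (- real k)) powr (- q) = 2 powr (real k * q)" by (simp add: powr_powr)
    finally have 1: "c k = (\<delta> / 2) powr (- q) * 2 powr (real k * q)" .
    have "r k ^ ?n = \<delta> ^ ?n * (2 powr (- real k)) ^ ?n"
      unfolding r_def half by (rule power_mult_distrib)
    also have "(2 powr (- real k)) ^ ?n = (2 powr (- real k)) powr real ?n"
      by (rule powr_realpow[symmetric]) simp
    also have "\<dots> = 2 powr (- (real k * ?n))" unfolding powr_powr by simp
    finally have "r k ^ ?n = \<delta> ^ ?n * 2 powr (- (real k * ?n))" .
    moreover have "2 powr (real k * q) * 2 powr (- (real k * ?n)) = x ^ k"
    proof -
      have "x ^ k = x powr real k" using x(1) by (rule powr_realpow[symmetric])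
      also have "\<dots> = 2 powr ((q - ?n) * real k)" unfolding x_def by (rule powr_powr)
      also have "(q - ?n) * real k = real k * q + - (real k * ?n)" by (simp add: algebra_simps)
      finally show ?thesis by (simp only: powr_add)
    qed
    ultimately show ?thesis unfolding 1 D_def by (simp add: mult_ac)
  qed
  have pt: "ennreal (indicator (ball 0 \<delta>) h * norm h powr (- q))
      \<le> (\<Sum>k. ennreal (c k) * indicator (ball 0 (r k)) h)" for h :: 'a
  proof (cases "h = 0 \<or> \<delta> \<le> norm h")
    case False
    \<comment> \<open>The least such index selects the shell containing \<open>h\<close>: its inner
      radius is at most \<open>norm h\<close>, and minimality, or \<open>norm h < \<delta>\<close>
      for index 0, gives the outer bound.\<close>
    define k where "k = (LEAST k. r (Suc k) \<le> norm h)"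
    have "(\<lambda>k. \<delta> * (1 / 2) ^ k) \<longlonglongrightarrow> \<delta> * 0"
      by (intro tendsto_mult tendsto_const LIMSEQ_realpow_zero) auto
    then have "\<forall>\<^sub>F k in sequentially. r k < norm h"
      unfolding r_def using False by (intro order_tendstoD(2)) auto
    then obtain m where "r m < norm h" unfolding eventually_sequentially by blast
    moreover have "r (Suc m) \<le> r m" using assms(1) by (simp add: r_def)
    ultimately have ex: "r (Suc m) \<le> norm h" by simp
    have k1: "r (Suc k) \<le> norm h" unfolding k_def using ex by (rule LeastI)
    have k2: "norm h < r k"
    proof (cases k)
      case 0
      then show ?thesis using False by (simp add: r_def)
    next
      case (Suc j)
      then have "\<not> r (Suc j) \<le> norm h" using not_less_Least[of j "\<lambda>k. r (Suc k) \<le> norm h"] k_def by simp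
      then show ?thesis using Suc by simp
    qed
    have "norm h powr (- q) \<le> c k"
      unfolding c_def using k1 r[of "Suc k"] assms(2) by (intro powr_mono2') auto
    then have "ennreal (indicator (ball 0 \<delta>) h * norm h powr (- q)) \<le> ennreal (c k) * indicator (ball 0 (r k)) h"
      using k2 by (simp add: indicator_def ennreal_leI)
    also have "\<dots> \<le> (\<Sum>k. ennreal (c k) * indicator (ball 0 (r k)) h)"
    proof -
      define e where "e k = ennreal (c k) * indicator (ball 0 (r k)) h" for k
      have "e k \<le> suminf e" using sum_le_suminf[of e "{k}"] by simp
      then show ?thesis unfolding e_def .
    qed
    finally show ?thesis .
  qed (auto simp: indicator_def)
  have "(\<integral>\<^sup>+ h. ennreal (indicator (ball 0 \<delta>) h * norm h powr (- q)) \<partial>(lebesgue :: 'a measure))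
      \<le> (\<integral>\<^sup>+ h. (\<Sum>k. ennreal (c k) * indicator (ball 0 (r k)) h) \<partial>(lebesgue :: 'a measure))"
    by (rule nn_integral_mono) (rule pt)
  also have "\<dots> = (\<Sum>k. \<integral>\<^sup>+ h. ennreal (c k) * indicator (ball 0 (r k)) h \<partial>(lebesgue :: 'a measure))"
  proof (rule nn_integral_suminf)
    fix k
    have [measurable]: "ball (0::'a) (r k) \<in> sets lebesgue" by simp
    show "(\<lambda>h. ennreal (c k) * indicator (ball 0 (r k)) h) \<in> borel_measurable (lebesgue :: 'a measure)"
      by measurable
  qed
  also have "\<dots> = (\<Sum>k. ennreal (D * x ^ k))"
  proof (rule arg_cong[where f = suminf], rule ext)
    fix k
    have "(\<integral>\<^sup>+ h. ennreal (c k) * indicator (ball 0 (r k)) h \<partial>(lebesgue :: 'a measure))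
        = ennreal (c k) * emeasure lborel (ball (0::'a) (r k))"
      by (subst nn_integral_cmult_indicator) auto
    also have "\<dots> = ennreal (c k * (unit_ball_vol ?n * r k ^ ?n))"
      using r[of k] by (simp add: emeasure_ball ennreal_mult' c_def)
    finally show "(\<integral>\<^sup>+ h. ennreal (c k) * indicator (ball 0 (r k)) h \<partial>(lebesgue :: 'a measure)) = ennreal (D * x ^ k)"
      unfolding cr .
  qed
  also have "\<dots> < \<infinity>"
  proof -
    have "summable (\<lambda>k. D * x ^ k)" using x by (intro summable_mult summable_geometric) auto
    moreover have "0 \<le> D * x ^ k" for k using x assms(1) by (simp add: D_def)
    ultimately show ?thesis by (subst suminf_ennreal2) auto
  qed
  finally have fin: "(\<integral>\<^sup>+ h. ennreal (indicator (ball 0 \<delta>) h * norm h powr (- q)) \<partial>(lebesgue :: 'a measure)) < \<infinity>" .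
  show ?thesis
  proof (rule integrableI_nonneg[OF _ _ fin])
    have [measurable]: "ball (0::'a) \<delta> \<in> sets borel" by simp
    show "(\<lambda>h::'a. indicator (ball 0 \<delta>) h * norm h powr (- q)) \<in> borel_measurable lebesgue"
      by (rule measurable_completion) measurable
  qed (simp add: indicator_def)
qed

text \<open>On the compact interval from \<rho> to \<delta> the quotient has a bounded derivative.
  Beyond \<delta> it is 0, its value at \<delta>, so it factors through the map
  \<open>min t \<delta>\<close>, which does not increase distances.\<close>

lemma radial_profile_Lipschitz:
  fixes g w :: "real \<Rightarrow> real" and \<rho> \<delta> p :: real
  assumes g: "smooth_on UNIV g" and w: "\<And>t. 0 \<le> t \<Longrightarrow> w t = g t" "\<And>t. \<delta> \<le> t \<Longrightarrow> w t = 0"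
    and "0 < \<rho>" "\<rho> < \<delta>"
  obtains L where "0 \<le> L"
    "\<And>t u. \<rho> \<le> t \<Longrightarrow> \<rho> \<le> u \<Longrightarrow> \<bar>w t / t powr p - w u / u powr p\<bar> \<le> L * \<bar>t - u\<bar>"
proof -
  let ?F = "\<lambda>t::real. g t * t powr (- p)"
  let ?F' = "\<lambda>t::real. partial_deriv 1 g t * t powr (- p) + g t * (- p * t powr (- p - 1))"
  have dg: "(g has_real_derivative partial_deriv 1 g t) (at t)" for t
  proof -
    have "(g has_derivative (\<lambda>k. k *\<^sub>R partial_deriv 1 g t)) (at t)"
      using has_derivative_partials[OF smooth_on_imp_differentiable_at[OF g, of t]] by simp
    then show ?thesis unfolding has_field_derivative_def by (simp add: mult_commute_abs)
  qed
  have dF: "(?F has_real_derivative ?F' t) (at t within {\<rho>..\<delta>})" if "t \<in> {\<rho>..\<delta>}" for t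
  proof -
    have "0 < t" using that \<open>0 < \<rho>\<close> by simp
    then show ?thesis
      by (auto intro!: derivative_eq_intros DERIV_subset[OF dg] simp: field_simps powr_diff)
  qed
  have "continuous_on {\<rho>..\<delta>} ?F'"
    using \<open>0 < \<rho>\<close> smooth_on_continuous_on[OF g] smooth_on_continuous_on[OF smooth_on_partial_deriv[OF g, of 1]]
    by (intro continuous_intros) (auto intro: continuous_on_subset)
  then have "compact (?F' ` {\<rho>..\<delta>})" by (intro compact_continuous_image) auto
  then have "bounded (?F' ` {\<rho>..\<delta>})" by (rule compact_imp_bounded)
  then obtain L where "\<forall>v\<in>?F' ` {\<rho>..\<delta>}. norm v \<le> L" unfolding bounded_iff by (rule exE)
  then have L: "norm (?F' t) \<le> L" if "t \<in> {\<rho>..\<delta>}" for t using that by (rule bspec[OF _ imageI])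
  have lip: "\<bar>?F t - ?F u\<bar> \<le> \<bar>L\<bar> * \<bar>t - u\<bar>" if "t \<in> {\<rho>..\<delta>}" "u \<in> {\<rho>..\<delta>}" for t u
  proof -
    have "norm (?F t - ?F u) \<le> \<bar>L\<bar> * norm (t - u)"
    proof (rule field_differentiable_bound[OF _ dF _ that])
      show "norm (?F' z) \<le> \<bar>L\<bar>" if "z \<in> {\<rho>..\<delta>}" for z using L[OF that] by simp
    qed auto
    then show ?thesis by simp
  qed
  have k: "w t / t powr p = ?F (min t \<delta>)" if "\<rho> \<le> t" for t
  proof (cases "t \<le> \<delta>")
    case True
    then show ?thesis using that \<open>0 < \<rho>\<close> w(1)[of t] by (simp add: powr_minus divide_inverse)
  next
    case False
    then show ?thesis using w(1)[of \<delta>] w(2)[of \<delta>] w(2)[of t] assms(4,5) by simp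
  qed
  have "\<bar>w t / t powr p - w u / u powr p\<bar> \<le> \<bar>L\<bar> * \<bar>t - u\<bar>" if "\<rho> \<le> t" "\<rho> \<le> u" for t u
  proof -
    have "\<bar>w t / t powr p - w u / u powr p\<bar> \<le> \<bar>L\<bar> * \<bar>min t \<delta> - min u \<delta>\<bar>"
      unfolding k[OF that(1)] k[OF that(2)] using that \<open>\<rho> < \<delta>\<close> by (intro lip) auto
    also have "\<dots> \<le> \<bar>L\<bar> * \<bar>t - u\<bar>" by (intro mult_left_mono) (auto simp: min_def)
    finally show ?thesis .
  qed
  then show ?thesis using that[of "\<bar>L\<bar>"] by simp
qed

text \<open>The decisive condition is the moment: \<open>norm h * norm (K h)\<close> is at most
  \<open>a\<^sub>0\<close> times the power of \<open>norm h\<close> with exponent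
  \<open>- (n + s - 1)\<close>, and \<open>n + s - 1\<close> is below the dimension because
  \<open>s < 1\<close>. The other conditions follow from boundedness and smoothness of the radial
  profile off the origin.\<close>

lemma odd_kernel_nl_kernel:
  assumes s: "0 < s" "s < 1" and \<delta>: "0 < \<delta>" and w: "cutoff_profile \<delta> b\<^sub>0 a\<^sub>0 w"
  shows "odd_kernel (nl_kernel s w :: 'a::euclidean_space \<Rightarrow> 'a) \<delta>"
proof -
  obtain g where g: "smooth_on UNIV g" "\<And>t. 0 \<le> t \<Longrightarrow> w t = g t"
    and w0: "\<And>t. 0 \<le> t \<Longrightarrow> 0 \<le> w t" and wa: "\<And>t. 0 \<le> t \<Longrightarrow> w t \<le> a\<^sub>0"
    and wd: "\<And>t. \<delta> \<le> t \<Longrightarrow> w t = 0" and a: "0 < a\<^sub>0"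
    by (rule cutoff_profileD[OF w \<delta>]) blast
  let ?p = "real DIM('a) + s + 1"
  let ?k = "\<lambda>t. w t / t powr ?p"
  let ?K = "nl_kernel s w :: 'a \<Rightarrow> 'a"
  have K: "?K h = ?k (norm h) *\<^sub>R h" for h by (simp add: nl_kernel_def)
  have supp: "?K h = 0" if "\<delta> \<le> norm h" for h using wd[OF that] by (simp add: K)
  have kb: "\<bar>?k t\<bar> \<le> a\<^sub>0 / \<rho> powr ?p" if "0 < \<rho>" "\<rho> \<le> t" for \<rho> t
  proof -
    have "\<rho> powr ?p \<le> t powr ?p" using that s by (intro powr_mono2) auto
    then show ?thesis using w0[of t] wa[of t] a that by (auto intro!: frac_le)
  qed
  have gm: "g \<in> borel_measurable borel"
    by (rule borel_measurable_continuous_onI[OF smooth_on_continuous_on[OF g(1)]])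
  have Kg: "?K = (\<lambda>h. (g (norm h) / norm h powr ?p) *\<^sub>R h)" using g(2) by (simp add: K fun_eq_iff)
  have gm': "(\<lambda>h::'a. g (norm h)) \<in> borel_measurable borel"
    by (rule measurable_compose[OF borel_measurable_norm gm]) 
  have Km: "?K \<in> borel_measurable borel"
    unfolding Kg using gm' by measurable
  show ?thesis
  proof
    show "0 < \<delta>" by (rule \<delta>)
    show "?K \<in> borel_measurable borel" by (rule Km)
    show "?K (- h) = - ?K h" for h by (simp add: K)
    show "?K h = 0" if "\<delta> \<le> norm h" for h by (rule supp[OF that])
    show "\<exists>M. \<forall>h. \<rho> \<le> norm h \<longrightarrow> norm (?K h) \<le> M" if \<rho>: "0 < \<rho>" for \<rho>
    proof (intro exI[of _ "a\<^sub>0 / \<rho> powr ?p * \<delta>"] allI impI)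
      fix h :: 'a assume h: "\<rho> \<le> norm h"
      show "norm (?K h) \<le> a\<^sub>0 / \<rho> powr ?p * \<delta>"
      proof (cases "\<delta> \<le> norm h")
        case True
        then show ?thesis using supp a \<delta> by simp
      next
        case False
        have "norm (?K h) = \<bar>?k (norm h)\<bar> * norm h" by (simp add: K)
        also have "\<dots> \<le> a\<^sub>0 / \<rho> powr ?p * \<delta>"
          using kb[OF \<rho> h] False a by (intro mult_mono) auto
        finally show ?thesis .
      qed
    qed
    show "\<exists>L. \<forall>h h'. \<rho> \<le> norm h \<longrightarrow> \<rho> \<le> norm h' \<longrightarrow> norm (?K h - ?K h') \<le> L * norm (h - h')"
      if \<rho>: "0 < \<rho>" for \<rho>
    proof (cases "\<rho> < \<delta>")
      case False
      then show ?thesis using supp by (intro exI[of _ 0]) auto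
    next
      case True
      obtain L where L: "0 \<le> L" "\<And>t u. \<rho> \<le> t \<Longrightarrow> \<rho> \<le> u \<Longrightarrow> \<bar>?k t - ?k u\<bar> \<le> L * \<bar>t - u\<bar>"
        by (rule radial_profile_Lipschitz[OF g wd \<rho> True]) blast+
      \<comment> \<open>The product rule for a radial factor times \<open>h\<close>: the first
        summand bounds the factor itself, the second is its Lipschitz constant times the length of
        \<open>h'\<close>. The latter requires \<open>norm h' \<le> \<delta>\<close>; if both points
        lie beyond \<delta>, both kernel values vanish.\<close>
      let ?M = "a\<^sub>0 / \<rho> powr ?p + L * \<delta>"
      have M0: "0 \<le> ?M" using a L(1) \<delta> by simp
      have main: "norm (?K h - ?K h') \<le> ?M * norm (h - h')"
        if h: "\<rho> \<le> norm h" "\<rho> \<le> norm h'" "norm h' \<le> \<delta>" for h h' :: 'a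
      proof -
        have "?K h - ?K h' = ?k (norm h) *\<^sub>R (h - h') + (?k (norm h) - ?k (norm h')) *\<^sub>R h'"
          by (simp add: K algebra_simps)
        then have "norm (?K h - ?K h') \<le> norm (?k (norm h) *\<^sub>R (h - h')) + norm ((?k (norm h) - ?k (norm h')) *\<^sub>R h')"
          by (simp only: norm_triangle_ineq)
        also have "\<dots> = \<bar>?k (norm h)\<bar> * norm (h - h') + \<bar>?k (norm h) - ?k (norm h')\<bar> * norm h'" by simp
        also have "\<dots> \<le> a\<^sub>0 / \<rho> powr ?p * norm (h - h') + (L * norm (h - h')) * \<delta>"
        proof (intro add_mono mult_right_mono kb[OF \<rho> h(1)] mult_mono)
          have "\<bar>?k (norm h) - ?k (norm h')\<bar> \<le> L * \<bar>norm h - norm h'\<bar>" using h by (intro L(2))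
          also have "\<dots> \<le> L * norm (h - h')" using L(1) norm_triangle_ineq3 by (intro mult_left_mono) auto
          finally show "\<bar>?k (norm h) - ?k (norm h')\<bar> \<le> L * norm (h - h')" .
        qed (use h L(1) in auto)
        finally show ?thesis by (simp add: algebra_simps)
      qed
      have "norm (?K h - ?K h') \<le> ?M * norm (h - h')" if h: "\<rho> \<le> norm h" "\<rho> \<le> norm h'" for h h' :: 'a
      proof (cases "norm h' \<le> \<delta>")
        case True
        then show ?thesis using main h by blast
      next
        case outside: False
        show ?thesis
        proof (cases "norm h \<le> \<delta>")
          case True
          then show ?thesis using main[of h' h] h by (simp add: norm_minus_commute)
        next
          case False
          then show ?thesis using outside supp[of h] supp[of h'] M0 by simp
        qed
      qed
      then show ?thesis by blast
    qed
    show "integrable lebesgue (\<lambda>h. norm h * norm (?K h))"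
    proof (rule Bochner_Integration.integrable_bound)
      show "integrable lebesgue (\<lambda>h::'a. a\<^sub>0 * (indicator (ball 0 \<delta>) h * norm h powr (- (real DIM('a) + s - 1))))"
      proof (intro integrable_mult_right integrable_riesz_dyadic)
        have "1 \<le> real DIM('a)" using DIM_positive[where 'a='a] by linarith
        then show "0 \<le> real DIM('a) + s - 1" using s by linarith
      qed (use s \<delta> in auto)
      show "(\<lambda>h. norm h * norm (?K h)) \<in> borel_measurable lebesgue"
        by (rule measurable_completion) (use Km in measurable)
      have le: "norm h * norm (?K h) \<le> a\<^sub>0 * (indicator (ball 0 \<delta>) h * norm h powr (- (real DIM('a) + s - 1)))" for h :: 'a
      proof (cases "h = 0 \<or> \<delta> \<le> norm h")
        case True
        then show ?thesis using supp[of h] a by (auto simp: K)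
      next
        case False
        then have h: "0 < norm h" "norm h < \<delta>" by auto
        have "norm h * norm (?K h) = w (norm h) * (norm h powr 2 / norm h powr ?p)"
          using w0[of "norm h"] h by (simp add: K powr_numeral power2_eq_square)
        also have "norm h powr 2 / norm h powr ?p = norm h powr (2 - ?p)" by (rule powr_diff[symmetric])
        also have "2 - ?p = - (real DIM('a) + s - 1)" by simp
        also have "w (norm h) * norm h powr (- (real DIM('a) + s - 1)) \<le> a\<^sub>0 * norm h powr (- (real DIM('a) + s - 1))"
          using wa[of "norm h"] by (intro mult_right_mono) auto
        finally show ?thesis using h by simp
      qed
      have "norm (norm h * norm (?K h))
          \<le> norm (a\<^sub>0 * (indicator (ball 0 \<delta>) h * norm h powr (- (real DIM('a) + s - 1))))" for h :: 'a
      proof -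
        have "norm (norm h * norm (?K h)) = norm h * norm (?K h)" by simp
        also note le
        also note abs_ge_self
        finally show ?thesis unfolding real_norm_def .
      qed
      then show "AE h in lebesgue. norm (norm h * norm (?K h))
          \<le> norm (a\<^sub>0 * (indicator (ball 0 \<delta>) h * norm h powr (- (real DIM('a) + s - 1))))" by (rule AE_I2)
    qed
  qed
qed

subsection \<open>The Green identity\<close>

lemma locally_integrable_reflect:
  fixes f :: "'a::euclidean_space \<Rightarrow> 'b::euclidean_space"
  assumes "locally_integrable f"
  shows "locally_integrable (\<lambda>y. f (x - y))"
  unfolding locally_integrable_def
proof (intro allI impI)
  fix C :: "'a set" assume C: "compact C"
  have "compact ((\<lambda>y. x - y) ` C)" using C by (intro compact_continuous_image continuous_intros)
  then have "integrable lebesgue (\<lambda>y. indicator ((\<lambda>y. x - y) ` C) y *\<^sub>R f y)"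
    using assms unfolding locally_integrable_def set_integrable_def by blast
  from integrable_lebesgue_reflect[OF this, of x]
  have "integrable lebesgue (\<lambda>y. indicator ((\<lambda>y. x - y) ` C) (x - y) *\<^sub>R f (x - y))" .
  moreover have "indicator ((\<lambda>y. x - y) ` C) (x - y) = (indicator C y :: real)" for y
    by (auto simp: indicator_def)
  ultimately show "set_integrable lebesgue C (\<lambda>y. f (x - y))" by (simp add: set_integrable_def)
qed

lemma locally_integrable_tempered:
  fixes f :: "'a::euclidean_space \<Rightarrow> real"
  assumes "integrable lebesgue (\<lambda>x. f x / (1 + norm x) ^ N)"
  shows "locally_integrable f"
  unfolding locally_integrable_def
proof (intro allI impI)
  fix C :: "'a set" assume C: "compact C"
  then obtain R where R: "\<And>x. x \<in> C \<Longrightarrow> norm x \<le> R" using compact_imp_bounded bounded_iff by metis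
  let ?h = "\<lambda>x. f x / (1 + norm x) ^ N" and ?p = "\<lambda>x::'a. (1 + norm x) ^ N"
  have pos: "0 < ?p x" for x by (intro zero_less_power add_pos_nonneg) auto
  have pm: "?p \<in> borel_measurable lebesgue" by (intro measurable_completion) measurable
  have hm: "?h \<in> borel_measurable lebesgue" using assms by auto
  have eq: "f x = ?p x * ?h x" for x
    unfolding times_divide_eq_right
    by (rule nonzero_mult_div_cancel_left[OF less_imp_neq[OF pos, symmetric], symmetric])
  have fm: "f \<in> borel_measurable lebesgue"
  proof -
    have "(\<lambda>x. ?p x * ?h x) = f" by (rule ext) (rule eq[symmetric])
    then show ?thesis using borel_measurable_times[OF pm hm] by simp
  qed
  have Cm: "C \<in> sets lebesgue" using C by (intro fmeasurableD lmeasurable_compact)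
  show "set_integrable lebesgue C f"
    unfolding set_integrable_def
  proof (rule Bochner_Integration.integrable_bound)
    show "integrable lebesgue (\<lambda>x. (1 + \<bar>R\<bar>) ^ N * ?h x)" using assms by (rule integrable_mult_right)
    show "(\<lambda>x. indicator C x *\<^sub>R f x) \<in> borel_measurable lebesgue"
      by (intro borel_measurable_scaleR borel_measurable_indicator Cm fm)
    have "norm (indicator C x *\<^sub>R f x) \<le> norm ((1 + \<bar>R\<bar>) ^ N * ?h x)" for x
    proof (cases "x \<in> C")
      case True
      have "?p x \<le> (1 + \<bar>R\<bar>) ^ N" using R[OF True] by (intro power_mono) auto
      then have "?p x * \<bar>?h x\<bar> \<le> (1 + \<bar>R\<bar>) ^ N * \<bar>?h x\<bar>" by (intro mult_right_mono) auto
      moreover have "\<bar>f x\<bar> = ?p x * \<bar>?h x\<bar>"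
        using arg_cong[OF eq[of x], of abs] unfolding abs_mult abs_of_pos[OF pos] .
      moreover have "\<bar>(1 + \<bar>R\<bar>) ^ N * ?h x\<bar> = (1 + \<bar>R\<bar>) ^ N * \<bar>?h x\<bar>" by (simp add: abs_mult)
      ultimately have "\<bar>f x\<bar> \<le> \<bar>(1 + \<bar>R\<bar>) ^ N * ?h x\<bar>" by (simp only:)
      then show ?thesis using True by (simp only: indicator_simps scaleR_one real_norm_def)
    qed simp
    then show "AE x in lebesgue. norm (indicator C x *\<^sub>R f x) \<le> norm ((1 + \<bar>R\<bar>) ^ N * ?h x)" by simp
  qed
qed

lemma open_inner_set:
  fixes \<Omega> :: "'a::euclidean_space set"
  assumes "open \<Omega>"
  shows "open (inner_set \<delta> \<Omega>)"
proof -
  have "open {x. \<delta> < infdist x (frontier \<Omega>)}" by (intro open_Collect_less continuous_intros)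
  moreover have "inner_set \<delta> \<Omega> = \<Omega> \<inter> {x. \<delta> < infdist x (frontier \<Omega>)}" by (auto simp: inner_set_def)
  ultimately show ?thesis using assms by auto
qed

text \<open>A ball is connected, so if it contained a point outside \<Omega> it would meet the
  frontier, closer to its centre than the inner set allows.\<close>

lemma inner_set_ball:
  fixes \<Omega> :: "'a::euclidean_space set"
  assumes y: "y \<in> inner_set \<delta> \<Omega>" and "norm (z - y) < \<delta>"
  shows "z \<in> \<Omega>"
proof (rule ccontr)
  assume "z \<notin> \<Omega>"
  moreover have "z \<in> ball y \<delta>" "y \<in> ball y \<delta>"
    using assms by (auto simp: dist_norm norm_minus_commute intro: le_less_trans[OF norm_ge_zero])
  moreover have "y \<in> \<Omega>" using y by (auto simp: inner_set_def)
  ultimately have "ball y \<delta> \<inter> frontier \<Omega> \<noteq> {}"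
    by (intro connected_Int_frontier[OF convex_connected[OF convex_ball]]) blast+
  then obtain u where u: "u \<in> frontier \<Omega>" "dist y u < \<delta>" by auto
  have "infdist y (frontier \<Omega>) \<le> dist y u" using u(1) by (rule infdist_le)
  then show False using y u(2) by (auto simp: inner_set_def)
qed

lemma outer_setI: "z \<in> \<Omega> \<Longrightarrow> norm (y - z) < \<delta> \<Longrightarrow> y \<in> outer_set \<delta> \<Omega>"
proof -
  assume "z \<in> \<Omega>" "norm (y - z) < \<delta>"
  then have "y = z + (y - z)" "z \<in> \<Omega>" "y - z \<in> ball 0 \<delta>" by auto
  then show ?thesis unfolding outer_set_def by blast
qed

lemma open_outer_set: "open (outer_set \<delta> (\<Omega> :: 'a::euclidean_space set))"
proof -
  have "outer_set \<delta> \<Omega> = (\<Union>x\<in>\<Omega>. ball x \<delta>)"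
    by (auto simp: outer_set_def dist_norm norm_minus_commute) (metis add_diff_cancel_left' add.commute diff_add_cancel)
  then show ?thesis by auto
qed

lemma bounded_outer_set: "bounded \<Omega> \<Longrightarrow> bounded (outer_set \<delta> (\<Omega> :: 'a::euclidean_space set))"
proof -
  assume "bounded \<Omega>"
  then have "bounded ((\<lambda>(x, y). x + y) ` (\<Omega> \<times> ball 0 \<delta>))" by (intro bounded_plus) auto
  moreover have "outer_set \<delta> \<Omega> = (\<lambda>(x, y). x + y) ` (\<Omega> \<times> ball 0 \<delta>)"
    unfolding outer_set_def by (auto simp del: mem_ball mem_ball_0)
  ultimately show ?thesis by simp
qed

section \<open>The nonlocal operators in terms of the abstract kernel\<close>

context kernel_product
begin

lemma set_integral_trunc:
  "(LINT z:\<Omega> - ball y r|lebesgue. pr (f z) (K (y - z))) = trunc r (\<lambda>z. indicator \<Omega> z *\<^sub>R f z) y"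
  unfolding trunc_def set_lebesgue_integral_def
  by (intro Bochner_Integration.integral_cong refl)
     (auto simp: Kt_def indicator_def dist_norm norm_minus_commute zero_left zero_right)

lemma set_integrable_trunc:
  assumes "locally_integrable (\<lambda>z. indicator \<Omega> z *\<^sub>R f z)" "0 < r"
  shows "set_integrable lebesgue (\<Omega> - ball y r) (\<lambda>z. pr (f z) (K (y - z)))"
proof -
  have "indicator (\<Omega> - ball y r) z *\<^sub>R pr (f z) (K (y - z)) = pr (indicator \<Omega> z *\<^sub>R f z) (Kt r (y - z))" for z
    by (auto simp: Kt_def indicator_def dist_norm norm_minus_commute zero_left zero_right)
  then show ?thesis using trunc_integrable[OF assms, of y] by (simp add: set_integrable_def)
qed

lemma test_tlim_minus:
  assumes f: "test_function f"
  shows "tlim (\<lambda>z. - f z) y = - tlim f y"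
proof -
  have mf: "test_function (\<lambda>z. - f z)"
    by (rule test_function_linear[OF f]) (rule bounded_linear_minus[OF bounded_linear_ident])
  have "tlim (\<lambda>z. - f z) y = (LINT h|lebesgue. pr (- f (y - h) - - f y) (K h))"
    by (rule test_tlim_eq(2)[OF mf])
  also have "\<dots> = (LINT h|lebesgue. - pr (f (y - h) - f y) (K h))"
  proof (intro Bochner_Integration.integral_cong refl)
    fix h
    have "- f (y - h) - - f y = - (f (y - h) - f y)" by simp
    then show "pr (- f (y - h) - - f y) (K h) = - pr (f (y - h) - f y) (K h)" by (simp only: minus_left)
  qed
  also have "\<dots> = - tlim f y" unfolding test_tlim_eq(2)[OF f] by (rule Bochner_Integration.integral_minus)
  finally show ?thesis .
qed

end

context odd_kernel
begin

text \<open>The term with the constant \<open>\<phi> y\<close> integrates to 0 against the odd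
  truncated kernel, for each \<open>r\<close> and not only in the limit.\<close>

lemma nl_div_tlim_aux:
  assumes \<phi>: "locally_integrable \<phi>" and r: "0 < r"
  shows "(LINT z:ball y \<delta> - ball y r|lebesgue. (\<phi> y + \<phi> z) \<bullet> K (y - z)) = V.trunc r \<phi> y"
proof -
  have c: "integrable lebesgue (\<lambda>z. \<phi> y \<bullet> Kt r (y - z))"
    using Kt_shift_integrable[OF r] by (rule integrable_inner_right)
  have c0: "(LINT z|lebesgue. \<phi> y \<bullet> Kt r (y - z)) = 0"
    using Kt_shift_integrable[OF r] by (simp add: Kt_integral_zero)
  have "(LINT z:ball y \<delta> - ball y r|lebesgue. (\<phi> y + \<phi> z) \<bullet> K (y - z))
      = (LINT z|lebesgue. \<phi> y \<bullet> Kt r (y - z) + \<phi> z \<bullet> Kt r (y - z))"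
    unfolding set_lebesgue_integral_def
  proof (intro Bochner_Integration.integral_cong refl)
    fix z
    show "indicator (ball y \<delta> - ball y r) z *\<^sub>R ((\<phi> y + \<phi> z) \<bullet> K (y - z))
        = \<phi> y \<bullet> Kt r (y - z) + \<phi> z \<bullet> Kt r (y - z)"
      using K_support[of "y - z"]
      by (cases "\<delta> \<le> norm (y - z)") (auto simp: Kt_def indicator_def dist_norm norm_minus_commute inner_add_left)
  qed
  also have "\<dots> = V.trunc r \<phi> y"
    unfolding V.trunc_def using c c0 V.trunc_integrable[OF \<phi> r] by simp
  finally show ?thesis .
qed

end

locale nl_operators =
  fixes s \<delta> b\<^sub>0 a\<^sub>0 :: real and w :: "real \<Rightarrow> real" and K :: "'a::euclidean_space \<Rightarrow> 'a" and c :: real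
  assumes s: "0 < s" "s < 1" and \<delta>: "0 < \<delta>" and w: "cutoff_profile \<delta> b\<^sub>0 a\<^sub>0 w"
    and K_def: "K = nl_kernel s w" and c_def: "c = c_const DIM('a) s"
begin

sublocale odd_kernel K \<delta>
  unfolding K_def by (rule odd_kernel_nl_kernel[OF s \<delta> w])

lemma nl_grad_eq:
  fixes u :: "'a \<Rightarrow> real"
  assumes u: "test_function u"
  shows "nl_grad s \<delta> w u y = - c *\<^sub>R S.tlim u y"
proof -
  have li: "locally_integrable u" using u by (rule test_function_locally_integrable)
  have "(LINT z:ball y \<delta>|lebesgue. (u y - u z) *\<^sub>R K (y - z)) = - (LINT z|lebesgue. (u z - u y) *\<^sub>R K (y - z))"
    unfolding set_lebesgue_integral_def Bochner_Integration.integral_minus[symmetric]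
  proof (intro Bochner_Integration.integral_cong refl)
    fix z
    show "indicator (ball y \<delta>) z *\<^sub>R (u y - u z) *\<^sub>R K (y - z) = - ((u z - u y) *\<^sub>R K (y - z))"
      using K_support[of "y - z"]
      by (cases "\<delta> \<le> norm (y - z)") (auto simp: dist_norm scaleR_diff_left)
  qed
  also have "(LINT z|lebesgue. (u z - u y) *\<^sub>R K (y - z)) = S.tlim u y"
    unfolding S.test_tlim_eq(2)[OF u] by (rule S.integral_near_shift[OF locally_integrable_measurable[OF li]])
  finally show ?thesis by (simp add: nl_grad_def K_def[symmetric] c_def)
qed

lemma nl_div_eq:
  fixes \<phi> :: "'a \<Rightarrow> 'a"
  assumes "locally_integrable \<phi>"
  shows "nl_div s \<delta> w \<phi> y = - c * V.tlim \<phi> y"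
proof -
  have "pv_integral y (ball y \<delta>) (\<lambda>z. (\<phi> y + \<phi> z) \<bullet> K (y - z)) = V.tlim \<phi> y"
    unfolding pv_integral_def V.tlim_def
    by (rule Lim_cong)
       (auto simp: eventually_at_right_field nl_div_tlim_aux[OF assms] intro!: exI[of _ 1])
  then show ?thesis by (simp add: nl_div_def K_def[symmetric] c_def)
qed

lemma test_nl_grad:
  fixes u :: "'a \<Rightarrow> real"
  assumes "test_function u"
  shows "test_function (nl_grad s \<delta> w u)"
proof -
  have "nl_grad s \<delta> w u = (\<lambda>y. - c *\<^sub>R S.tlim u y)" using nl_grad_eq[OF assms] by blast
  then show ?thesis
    by (metis test_function_scaleR[OF smooth_on_const[OF open_UNIV] S.test_function_tlim[OF assms]])
qed

lemma nl_laplace_eq: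
  fixes u :: "'a \<Rightarrow> real"
  assumes "test_function u"
  shows "nl_laplace s \<delta> w u y = - c * V.tlim (nl_grad s \<delta> w u) y"
  unfolding nl_laplace_def
  by (rule nl_div_eq[OF test_function_locally_integrable[OF test_nl_grad[OF assms]]])

lemma nl_div_reflect:
  fixes \<phi> :: "'a \<Rightarrow> 'a"
  assumes \<phi>: "test_function \<phi>"
  shows "nl_div s \<delta> w (\<lambda>z. \<phi> (x - z)) y = - nl_div s \<delta> w \<phi> (x - y)"
  using V.test_tlim_reflect[OF \<phi>] nl_div_eq[OF test_function_locally_integrable[OF \<phi>]]
    nl_div_eq[OF test_function_locally_integrable[OF test_function_reflect[OF \<phi>]]] by simp

text \<open>Gradient and divergence each change sign under the reflection
  \<open>y \<mapsto> x - y\<close>, and the two signs cancel.\<close>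

lemma nl_laplace_reflect:
  fixes u :: "'a \<Rightarrow> real"
  assumes u: "test_function u"
  shows "nl_laplace s \<delta> w (\<lambda>z. u (x - z)) y = nl_laplace s \<delta> w u (x - y)"
proof -
  note g = test_nl_grad[OF u]
  have "nl_grad s \<delta> w (\<lambda>z. u (x - z)) z = - nl_grad s \<delta> w u (x - z)" for z
    using S.test_tlim_reflect[OF u] by (simp add: nl_grad_eq[OF u] nl_grad_eq[OF test_function_reflect[OF u]])
  then have "nl_grad s \<delta> w (\<lambda>z. u (x - z)) = (\<lambda>z. - nl_grad s \<delta> w u (x - z))" by blast
  then show ?thesis
    using V.test_tlim_minus[OF test_function_reflect[OF g]] V.test_tlim_reflect[OF g]
    by (simp add: nl_laplace_eq[OF u] nl_laplace_eq[OF test_function_reflect[OF u]])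
qed

lemma nl_div_measurable:
  fixes \<phi> :: "'a \<Rightarrow> 'a"
  assumes \<phi>: "test_function \<phi>"
  shows "nl_div s \<delta> w \<phi> \<in> borel_measurable lebesgue"
proof -
  have "nl_div s \<delta> w \<phi> = (\<lambda>y. - c * V.tlim \<phi> y)"
    using nl_div_eq[OF test_function_locally_integrable[OF \<phi>]] by blast
  moreover have "V.tlim \<phi> \<in> borel_measurable lebesgue"
    by (intro locally_integrable_measurable test_function_locally_integrable V.test_function_tlim \<phi>)
  ultimately show ?thesis by simp
qed

lemma fundamental_solution_shift:
  fixes \<Phi> :: "'a \<Rightarrow> real"
  assumes \<Phi>: "locally_integrable \<Phi>"
    and fund: "\<And>\<phi>. test_function \<phi> \<Longrightarrow> (LINT y|lebesgue. \<Phi> y * nl_laplace s \<delta> w \<phi> y) = \<phi> 0"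
    and u: "test_function u"
  shows "(LINT y|lebesgue. \<Phi> (x - y) * nl_laplace s \<delta> w u y) = u x"
proof -
  let ?u = "\<lambda>z. u (x - z)"
  note tu = test_function_reflect[OF u]
  have m: "(\<lambda>y. \<Phi> y * nl_laplace s \<delta> w ?u y) \<in> borel_measurable lebesgue"
    unfolding nl_laplace_def
    by (intro borel_measurable_times locally_integrable_measurable[OF \<Phi>] nl_div_measurable test_nl_grad tu)
  have "(LINT y|lebesgue. \<Phi> (x - y) * nl_laplace s \<delta> w u y)
      = (LINT y|lebesgue. \<Phi> (x - y) * nl_laplace s \<delta> w ?u (x - y))"
    by (simp add: nl_laplace_reflect[OF u])
  also have "\<dots> = (LINT y|lebesgue. \<Phi> y * nl_laplace s \<delta> w ?u y)"
    by (rule integral_lebesgue_reflect[OF m])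
  also have "\<dots> = u x" using fund[OF tu] by simp
  finally show ?thesis .
qed

text \<open>Only one odd operator is involved here, so the reflected gradient carries a minus
  sign.\<close>

lemma dist_nl_grad_shift:
  fixes \<Phi> :: "'a \<Rightarrow> real"
  assumes \<Phi>: "locally_integrable \<Phi>" and G: "is_dist_nl_grad s \<delta> w \<Phi> G"
  shows "is_dist_nl_grad s \<delta> w (\<lambda>y. \<Phi> (x - y)) (\<lambda>y. - G (x - y))"
  unfolding is_dist_nl_grad_def
proof (intro conjI allI impI)
  have Gi: "locally_integrable G" using G by (simp add: is_dist_nl_grad_def)
  show "locally_integrable (\<lambda>y. - G (x - y))"
    using locally_integrable_reflect[OF Gi, of x] unfolding locally_integrable_def set_integrable_def by simp
  fix \<phi> :: "'a \<Rightarrow> 'a" assume \<phi>: "test_function \<phi>"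
  let ?\<phi> = "\<lambda>z. \<phi> (x - z)"
  note t\<phi> = test_function_reflect[OF \<phi>]
  have m1: "(\<lambda>y. G y \<bullet> ?\<phi> y) \<in> borel_measurable lebesgue"
    by (intro borel_measurable_inner locally_integrable_measurable Gi test_function_locally_integrable t\<phi>)
  have m2: "(\<lambda>y. \<Phi> y * nl_div s \<delta> w ?\<phi> y) \<in> borel_measurable lebesgue"
    by (intro borel_measurable_times locally_integrable_measurable[OF \<Phi>] nl_div_measurable t\<phi>)
  have "(LINT y|lebesgue. - G (x - y) \<bullet> \<phi> y) = - (LINT y|lebesgue. G (x - y) \<bullet> ?\<phi> (x - y))" by simp
  also have "(LINT y|lebesgue. G (x - y) \<bullet> ?\<phi> (x - y)) = (LINT y|lebesgue. G y \<bullet> ?\<phi> y)"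
    by (rule integral_lebesgue_reflect[OF m1])
  also have "\<dots> = - (LINT y|lebesgue. \<Phi> y * nl_div s \<delta> w ?\<phi> y)"
    using G t\<phi> unfolding is_dist_nl_grad_def by blast
  also have "(LINT y|lebesgue. \<Phi> y * nl_div s \<delta> w ?\<phi> y) = (LINT y|lebesgue. \<Phi> (x - y) * nl_div s \<delta> w ?\<phi> (x - y))"
    by (rule integral_lebesgue_reflect[OF m2, symmetric])
  also have "\<dots> = - (LINT y|lebesgue. \<Phi> (x - y) * nl_div s \<delta> w \<phi> y)" by (simp add: nl_div_reflect[OF \<phi>])
  finally show "(LINT y|lebesgue. - G (x - y) \<bullet> \<phi> y) = - (LINT y|lebesgue. \<Phi> (x - y) * nl_div s \<delta> w \<phi> y)" by simp
qed

lemma nl_normal_trunc_eq: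
  "nl_normal_trunc s w \<Omega> r \<phi> y = c * V.trunc r (\<lambda>z. indicator \<Omega> z *\<^sub>R \<phi> z) y"
  unfolding nl_normal_trunc_def c_def[symmetric] K_def[symmetric] V.set_integral_trunc ..

lemma nl_normal_eq:
  "nl_normal s w \<Omega> \<phi> y = c * V.tlim (\<lambda>z. indicator \<Omega> z *\<^sub>R \<phi> z) y"
  unfolding nl_normal_def pv_integral_def c_def[symmetric] K_def[symmetric] V.set_integral_trunc V.tlim_def ..

lemma pv_convergesI:
  assumes "locally_integrable \<phi>" "\<Omega> \<in> sets lebesgue" "bounded \<Omega>"
    and "((\<lambda>r. V.trunc r (\<lambda>z. indicator \<Omega> z *\<^sub>R \<phi> z) y) \<longlongrightarrow> l) (at_right 0)"
  shows "pv_converges y \<Omega> (\<lambda>z. \<phi> z \<bullet> nl_kernel s w (y - z))"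
proof -
  have "integrable lebesgue (\<lambda>z. indicator \<Omega> z *\<^sub>R \<phi> z)"
    using set_integrable_locally[OF assms(1,3,2)] by (simp add: set_integrable_def)
  then have "locally_integrable (\<lambda>z. indicator \<Omega> z *\<^sub>R \<phi> z)" by (rule integrable_imp_locally_integrable)
  then show ?thesis
    unfolding pv_converges_def K_def[symmetric] V.set_integral_trunc
    using V.set_integrable_trunc assms(4) by blast
qed

end

text \<open>Integrability and convergence are asserted next to the equality, since integrals and
  limits are total functions and an equality between default values would say nothing.\<close>

theorem theorem5p4:
  fixes s \<delta> b\<^sub>0 a\<^sub>0 :: real
    and w :: "real \<Rightarrow> real"
    and \<Omega> :: "'a::euclidean_space set"
    and \<Phi> v :: "'a \<Rightarrow> real"
    and x :: 'a
  assumes "0 < s" and "s < 1" and "0 < \<delta>"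
    and "open \<Omega>" and "bounded \<Omega>"
    and "cutoff_profile \<delta> b\<^sub>0 a\<^sub>0 w"
    and "nl_fundamental_solution s \<delta> w a\<^sub>0 \<Phi>"
    and "test_function v"
    and "x \<in> inner_set \<delta> \<Omega>"
  shows "let Dv = nl_grad s \<delta> w v;
      D\<Phi> = dist_nl_grad s \<delta> w (\<lambda>y. \<Phi> (x - y));
      lhs = (LINT y:inner_set \<delta> \<Omega>|lebesgue. \<Phi> (x - y) * nl_laplace s \<delta> w v y) - v x
    in
      set_integrable lebesgue (inner_set \<delta> \<Omega>) (\<lambda>y. \<Phi> (x - y) * nl_laplace s \<delta> w v y) \<and>
      (finite_nl_perimeter s w \<Omega> \<longrightarrow>
        (AE y in lebesgue. y \<in> collar \<delta> \<Omega> \<longrightarrow>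
          pv_converges y \<Omega> (\<lambda>z. Dv z \<bullet> nl_kernel s w (y - z)) \<and>
          pv_converges y \<Omega> (\<lambda>z. D\<Phi> z \<bullet> nl_kernel s w (y - z))) \<and>
        set_integrable lebesgue (collar \<delta> \<Omega>)
          (\<lambda>y. \<Phi> (x - y) * nl_normal s w \<Omega> Dv y - v y * nl_normal s w \<Omega> D\<Phi> y) \<and>
        lhs = (LINT y:collar \<delta> \<Omega>|lebesgue.
          \<Phi> (x - y) * nl_normal s w \<Omega> Dv y - v y * nl_normal s w \<Omega> D\<Phi> y)) \<and>
      (\<forall>r>0. set_integrable lebesgue (collar \<delta> \<Omega>)
        (\<lambda>y. \<Phi> (x - y) * nl_normal_trunc s w \<Omega> r Dv y
           - v y * nl_normal_trunc s w \<Omega> r D\<Phi> y)) \<and>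
      ((\<lambda>r. LINT y:collar \<delta> \<Omega>|lebesgue.
          \<Phi> (x - y) * nl_normal_trunc s w \<Omega> r Dv y
           - v y * nl_normal_trunc s w \<Omega> r D\<Phi> y) \<longlongrightarrow> lhs) (at_right 0)"
proof -
  let ?K = "nl_kernel s w :: 'a \<Rightarrow> 'a" and ?c = "c_const DIM('a) s"
  let ?\<Psi> = "\<lambda>y. \<Phi> (x - y)" and ?Dv = "nl_grad s \<delta> w v" and ?I = "inner_set \<delta> \<Omega>"
  let ?G = "dist_nl_grad s \<delta> w ?\<Psi>"
  interpret N: nl_operators s \<delta> b\<^sub>0 a\<^sub>0 w ?K ?c by (rule nl_operators.intro[OF assms(1,2,3,6) refl refl])
  obtain \<eta> \<sigma> \<tau> where \<eta>: "plateau \<eta> \<sigma> \<tau>" using plateau_exists[OF assms(6,3)] by blast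
  note fs = assms(7)[unfolded nl_fundamental_solution_def]
  have \<Phi>: "locally_integrable \<Phi>" using fs locally_integrable_tempered by blast
  have fund: "\<And>\<phi>. test_function \<phi> \<Longrightarrow> (LINT y|lebesgue. \<Phi> y * nl_laplace s \<delta> w \<phi> y) = \<phi> 0" using fs by blast
  have smooth: "smooth_on (- {0}) \<Phi>" using fs by blast
  obtain G0 where "is_dist_nl_grad s \<delta> w \<Phi> G0" using fs by blast
  \<comment> \<open>A distributional gradient of \<Psi> is exhibited, so that the choice made by
    \<open>dist_nl_grad\<close> is known to select one.\<close>
  then have "is_dist_nl_grad s \<delta> w ?\<Psi> (\<lambda>y. - G0 (x - y))" by (rule N.dist_nl_grad_shift[OF \<Phi>])
  then have G: "is_dist_nl_grad s \<delta> w ?\<Psi> ?G" unfolding dist_nl_grad_def by (rule someI[of "is_dist_nl_grad s \<delta> w ?\<Psi>"])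
  interpret g: green_data ?K \<delta> \<eta> \<sigma> \<tau> ?c x ?\<Psi> ?G
  proof unfold_locales
    show "plateau \<eta> \<sigma> \<tau>" by (rule \<eta>)
    show "locally_integrable ?\<Psi>" using \<Phi> by (rule locally_integrable_reflect)
    show "smooth_on (- {x}) ?\<Psi>" by (rule smooth_on_reflect[OF _ _ smooth]) auto
    show "locally_integrable ?G" using G by (simp add: is_dist_nl_grad_def)
    show "(LINT y|lebesgue. ?G y \<bullet> \<phi> y) = ?c * (LINT y|lebesgue. ?\<Psi> y * N.V.tlim \<phi> y)"
      if \<phi>: "test_function \<phi>" for \<phi>
    proof -
      have "(LINT y|lebesgue. ?G y \<bullet> \<phi> y) = - (LINT y|lebesgue. ?\<Psi> y * nl_div s \<delta> w \<phi> y)"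
        using G \<phi> unfolding is_dist_nl_grad_def by blast
      also have "\<dots> = - (LINT y|lebesgue. (- ?c) * (?\<Psi> y * N.V.tlim \<phi> y))"
        by (simp add: N.nl_div_eq[OF test_function_locally_integrable[OF \<phi>]] mult_ac)
      also have "\<dots> = ?c * (LINT y|lebesgue. ?\<Psi> y * N.V.tlim \<phi> y)"
        unfolding integral_mult_right_zero by simp
      finally show ?thesis .
    qed
    show "(LINT y|lebesgue. ?\<Psi> y * (- ?c * N.V.tlim (\<lambda>z. - ?c *\<^sub>R N.S.tlim u z) y)) = u x"
      if u: "test_function u" for u
    proof -
      have eq: "(\<lambda>z. - ?c *\<^sub>R N.S.tlim u z) = nl_grad s \<delta> w u" using N.nl_grad_eq[OF u] by (simp add: fun_eq_iff)
      show ?thesis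
        unfolding eq N.nl_laplace_eq[OF u, symmetric] by (rule N.fundamental_solution_shift[OF \<Phi> fund u])
    qed
  qed
  have Dv: "?Dv = g.grad v" using N.nl_grad_eq[OF assms(8)] by (simp add: g.grad_def fun_eq_iff)
  have Dvi: "locally_integrable ?Dv" by (rule test_function_locally_integrable[OF N.test_nl_grad[OF assms(8)]])
  have Lv: "nl_laplace s \<delta> w v y = - ?c * N.V.tlim (g.grad v) y" for y
    using N.nl_laplace_eq[OF assms(8)] Dv by simp
  have \<Omega>: "\<Omega> \<in> sets lebesgue" using assms(4) by simp
  \<comment> \<open>A truncated integral depends only on the almost-everywhere class of the field,
    so \<open>G\<close> can be exchanged for \<open>H\<close> at every \<open>y\<close>, and hence
    also inside the principal value.\<close>
  have truncG: "N.V.trunc r (\<lambda>z. indicator \<Omega> z *\<^sub>R ?G z) y = N.V.trunc r (\<lambda>z. indicator \<Omega> z *\<^sub>R g.H z) y" for r y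
  proof (rule N.V.trunc_cong_AE)
    show "AE z in lebesgue. indicator \<Omega> z *\<^sub>R ?G z = indicator \<Omega> z *\<^sub>R g.H z"
      using g.G_eq_H by eventually_elim simp
    show "(\<lambda>z. indicator \<Omega> z *\<^sub>R ?G z) \<in> borel_measurable lebesgue"
      by (intro borel_measurable_scaleR borel_measurable_indicator \<Omega> locally_integrable_measurable[OF g.G_int])
    show "(\<lambda>z. indicator \<Omega> z *\<^sub>R g.H z) \<in> borel_measurable lebesgue"
      by (intro borel_measurable_scaleR borel_measurable_indicator \<Omega> g.H_measurable)
  qed
  have nt: "nl_normal_trunc s w \<Omega> r ?Dv y = g.normal \<Omega> r (g.grad v) y"
    "nl_normal_trunc s w \<Omega> r ?G y = g.normal \<Omega> r g.H y" for r y
    by (simp_all add: N.nl_normal_trunc_eq g.normal_def Dv truncG)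
  have np: "nl_normal s w \<Omega> ?Dv y = g.normal_pv \<Omega> (g.grad v) y"
    "nl_normal s w \<Omega> ?G y = g.normal_pv \<Omega> g.H y" for y
    by (simp_all add: N.nl_normal_eq g.normal_pv_def Dv N.V.tlim_def truncG)
  have A: "bounded (outer_set \<delta> \<Omega>)" "outer_set \<delta> \<Omega> \<in> sets lebesgue"
    using bounded_outer_set[OF assms(5)] open_outer_set[of \<delta> \<Omega>] by auto
  have I: "?I \<in> sets lebesgue" using open_inner_set[OF assms(4)] by simp
  obtain \<rho> where \<rho>: "0 < \<rho>" "ball x \<rho> \<subseteq> ?I"
    using open_inner_set[OF assms(4)] assms(9) unfolding open_contains_ball by blast
  note limit = g.green_limit[OF assms(8,5) \<Omega> A I outer_setI inner_set_ball \<rho>]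
  note identity = g.green_identity[OF assms(8,5) \<Omega> A I outer_setI inner_set_ball \<rho>]
  have lim: "set_integrable lebesgue ?I (\<lambda>y. ?\<Psi> y * nl_laplace s \<delta> w v y)"
    "0 < r \<Longrightarrow> set_integrable lebesgue (collar \<delta> \<Omega>)
      (\<lambda>y. ?\<Psi> y * nl_normal_trunc s w \<Omega> r ?Dv y - v y * nl_normal_trunc s w \<Omega> r ?G y)"
    "((\<lambda>r. LINT y:collar \<delta> \<Omega>|lebesgue. ?\<Psi> y * nl_normal_trunc s w \<Omega> r ?Dv y - v y * nl_normal_trunc s w \<Omega> r ?G y)
      \<longlongrightarrow> (LINT y:?I|lebesgue. ?\<Psi> y * nl_laplace s \<delta> w v y) - v x) (at_right 0)" for r
    unfolding Lv nt collar_def by (rule limit; assumption)+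
  have ident: "AE y in lebesgue. y \<in> collar \<delta> \<Omega> \<longrightarrow>
        pv_converges y \<Omega> (\<lambda>z. ?Dv z \<bullet> nl_kernel s w (y - z)) \<and> pv_converges y \<Omega> (\<lambda>z. ?G z \<bullet> nl_kernel s w (y - z))"
      "set_integrable lebesgue (collar \<delta> \<Omega>) (\<lambda>y. ?\<Psi> y * nl_normal s w \<Omega> ?Dv y - v y * nl_normal s w \<Omega> ?G y)"
      "(LINT y:?I|lebesgue. ?\<Psi> y * nl_laplace s \<delta> w v y) - v x
        = (LINT y:collar \<delta> \<Omega>|lebesgue. ?\<Psi> y * nl_normal s w \<Omega> ?Dv y - v y * nl_normal s w \<Omega> ?G y)"
    if "finite_nl_perimeter s w \<Omega>"
  proof -
    note fin = that[unfolded finite_nl_perimeter_def]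
    have "AE y in lebesgue. y \<in> collar \<delta> \<Omega> \<longrightarrow>
      ((\<lambda>r. N.V.trunc r (\<lambda>z. indicator \<Omega> z *\<^sub>R g.grad v z) y) \<longlongrightarrow> N.V.tlim (\<lambda>z. indicator \<Omega> z *\<^sub>R g.grad v z) y) (at_right 0) \<and>
      ((\<lambda>r. N.V.trunc r (\<lambda>z. indicator \<Omega> z *\<^sub>R g.H z) y) \<longlongrightarrow> N.V.tlim (\<lambda>z. indicator \<Omega> z *\<^sub>R g.H z) y) (at_right 0)"
      unfolding collar_def using fin by (intro identity(1))
    then show "AE y in lebesgue. y \<in> collar \<delta> \<Omega> \<longrightarrow>
        pv_converges y \<Omega> (\<lambda>z. ?Dv z \<bullet> nl_kernel s w (y - z)) \<and> pv_converges y \<Omega> (\<lambda>z. ?G z \<bullet> nl_kernel s w (y - z))"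
    proof eventually_elim
      case (elim y)
      show ?case
      proof (intro impI conjI)
        assume y: "y \<in> collar \<delta> \<Omega>"
        show "pv_converges y \<Omega> (\<lambda>z. ?Dv z \<bullet> nl_kernel s w (y - z))"
          using elim y unfolding Dv[symmetric] by (intro N.pv_convergesI[OF Dvi \<Omega> assms(5)]) blast
        show "pv_converges y \<Omega> (\<lambda>z. ?G z \<bullet> nl_kernel s w (y - z))"
          using elim y unfolding truncG[symmetric] by (intro N.pv_convergesI[OF g.G_int \<Omega> assms(5)]) blast
      qed
    qed
    show "set_integrable lebesgue (collar \<delta> \<Omega>) (\<lambda>y. ?\<Psi> y * nl_normal s w \<Omega> ?Dv y - v y * nl_normal s w \<Omega> ?G y)"
      unfolding np collar_def using fin by (intro identity(2))
    show "(LINT y:?I|lebesgue. ?\<Psi> y * nl_laplace s \<delta> w v y) - v x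
        = (LINT y:collar \<delta> \<Omega>|lebesgue. ?\<Psi> y * nl_normal s w \<Omega> ?Dv y - v y * nl_normal s w \<Omega> ?G y)"
      unfolding np Lv collar_def using fin by (intro identity(3))
  qed
  show ?thesis
    unfolding Let_def using lim ident by blast
qed

end
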